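(* Let $n\geq 4$ be an even integer and let $u\in C^\infty(\mathbb{R}^n)$ be radially symmetric (about the origin). Consider the conformal metric $g=e^{2u}|dx|^2$ on $\mathbb{R}^n$ and assume that it has finite total Q-curvature, i.e. $Q_g e^{nu}\in L^1(\mathbb{R}^n)$. Suppose that $Q_g\leq (n-1)!$ on $\mathbb{R}^n$ and that the scalar curvature satisfies $R_g\geq 0$ near infinity (i.e. outside some compact set). Then $$\int_{\mathbb{R}^n}e^{nu}\,dx\geq |\mathbb{S}^n|,$$ with equality if and only if $u(x)=\log\frac{2\lambda}{\lambda^2+|x|^2}$ for some constant $\lambda>0$.
   Context: For $g=e^{2u}|dx|^2$ on $\mathbb{R}^n$ with $n$ even and $u$ smooth, the Q-curvature $Q_g$ is the function defined by $(-\Delta)^{n/2}u=Q_g e^{nu}$ on $\mathbb{R}^n$, and the scalar curvature is $R_g=2(n-1)e^{-2u}\left(-\Delta u-\frac{n-2}{2}|\nabla u|^2\right)$, where $\Delta$ is the Euclidean Laplacian. $|\mathbb{S}^n|$ denotes the volume of the standard unit $n$-sphere. The integral $\int_{\mathbb{R}^n} e^{nu}dx$ (the volume of $g$) is allowed to be $+\infty$. *)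

theory Defs
  imports "HOL-Analysis.Analysis"
begin

text \<open>
  Partial derivatives are read off the Frechet derivative; they are only used for functions that
  are differentiable, where this is the usual derivative along the line through \<open>x\<close> in
  direction \<open>b\<close>.
\<close>

definition partial_deriv :: "'a \<Rightarrow> ('a::euclidean_space \<Rightarrow> real) \<Rightarrow> 'a \<Rightarrow> real" where
  "partial_deriv b f x = frechet_derivative f (at x) b"

lemma partial_deriv_eq_deriv:
  assumes "f differentiable at x"
  shows "partial_deriv b f x = deriv (\<lambda>t. f (x + t *\<^sub>R b)) 0"
proof -
  have f: "(f has_derivative frechet_derivative f (at x)) (at (x + 0 *\<^sub>R b))"
    using assms by (simp add: frechet_derivative_works)
  have "((\<lambda>t. x + t *\<^sub>R b) has_derivative (\<lambda>t. t *\<^sub>R b)) (at 0)"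
    by (auto intro!: derivative_eq_intros)
  from diff_chain_at[OF this f]
  have "((\<lambda>t. f (x + t *\<^sub>R b)) has_derivative (\<lambda>t. frechet_derivative f (at x) (t *\<^sub>R b))) (at 0)"
    by (simp add: o_def)
  moreover have "frechet_derivative f (at x) (t *\<^sub>R b) = partial_deriv b f x * t" for t
    using linear_frechet_derivative[OF assms] by (simp add: partial_deriv_def linear_cmul)
  ultimately have "((\<lambda>t. f (x + t *\<^sub>R b)) has_field_derivative partial_deriv b f x) (at 0)"
    by (simp add: has_field_derivative_def)
  then show ?thesis by (simp add: DERIV_imp_deriv)
qed

primrec C_k :: "nat \<Rightarrow> ('a::euclidean_space \<Rightarrow> real) \<Rightarrow> bool" where
  "C_k 0 f \<longleftrightarrow> continuous_on UNIV f"
| "C_k (Suc k) f \<longleftrightarrow> (\<forall>x. f differentiable at x) \<and> (\<forall>b\<in>Basis. C_k k (partial_deriv b f))"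

definition C_infinity :: "('a::euclidean_space \<Rightarrow> real) \<Rightarrow> bool" where
  "C_infinity f \<longleftrightarrow> (\<forall>k. C_k k f)"

definition grad :: "('a::euclidean_space \<Rightarrow> real) \<Rightarrow> 'a \<Rightarrow> 'a" where
  "grad f x = (\<Sum>b\<in>Basis. partial_deriv b f x *\<^sub>R b)"

definition laplacian :: "('a::euclidean_space \<Rightarrow> real) \<Rightarrow> 'a \<Rightarrow> real" where
  "laplacian f x = (\<Sum>b\<in>Basis. partial_deriv b (partial_deriv b f) x)"

definition radially_symmetric :: "('a::euclidean_space \<Rightarrow> real) \<Rightarrow> bool" where
  "radially_symmetric f \<longleftrightarrow> (\<forall>x y. norm x = norm y \<longrightarrow> f x = f y)"

text \<open>
  Both curvatures below are those of the conformal metric \<open>e\<^sup>2\<^sup>u |dx|\<^sup>2\<close>, as functions of its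
  conformal factor \<open>u\<close>. The Q-curvature is meant for even dimension only.
\<close>

definition Q_curvature :: "('a::euclidean_space \<Rightarrow> real) \<Rightarrow> 'a \<Rightarrow> real" where
  "Q_curvature u x =
     ((\<lambda>v y. - laplacian v y) ^^ (DIM('a) div 2)) u x / exp (real DIM('a) * u x)"

lemma Q_curvature_iff:
  fixes u :: "'a::euclidean_space \<Rightarrow> real"
  shows "Q = Q_curvature u \<longleftrightarrow>
    (\<forall>x. ((\<lambda>v y. - laplacian v y) ^^ (DIM('a) div 2)) u x = Q x * exp (real DIM('a) * u x))"
  by (auto simp: Q_curvature_def fun_eq_iff field_simps)

definition scalar_curvature :: "('a::euclidean_space \<Rightarrow> real) \<Rightarrow> 'a \<Rightarrow> real" where
  "scalar_curvature u x =
     2 * (real DIM('a) - 1) * exp (- 2 * u x) *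
       (- laplacian u x - (real DIM('a) - 2) / 2 * (norm (grad u x))\<^sup>2)"

text \<open>
  The \<open>(d - 1)\<close>-dimensional volume of a compact hypersurface in a \<open>d\<close>-dimensional space,
  as the limit of the volume of its \<open>e\<close>-neighbourhood divided by \<open>2 e\<close>.
\<close>

definition hypersurface_volume :: "'a::euclidean_space set \<Rightarrow> real" where
  "hypersurface_volume S =
     Lim (at_right 0) (\<lambda>e. measure lebesgue (\<Union>a\<in>S. ball a e) / (2 * e))"

text \<open>For the unit sphere this is the classical value.\<close>

lemma tube_unit_sphere:
  assumes "0 < e" "e < 1"
  shows "(\<Union>a\<in>sphere (0::'a::euclidean_space) 1. ball a e) = ball 0 (1 + e) - cball 0 (1 - e)"
proof (intro set_eqI iffI)
  fix x :: 'a
  assume "x \<in> (\<Union>a\<in>sphere 0 1. ball a e)"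
  then obtain a where "norm a = 1" "norm (a - x) < e" by (auto simp: dist_norm)
  then show "x \<in> ball 0 (1 + e) - cball 0 (1 - e)"
    using norm_triangle_ineq3[of a x] by (auto simp: abs_le_iff)
next
  fix x :: 'a
  assume x: "x \<in> ball 0 (1 + e) - cball 0 (1 - e)"
  then have nz: "x \<noteq> 0" using assms by auto
  have "sgn x - x = (1 - norm x) *\<^sub>R sgn x"
    using nz by (simp add: sgn_div_norm algebra_simps)
  then have "norm (sgn x - x) = \<bar>1 - norm x\<bar>" using nz by (simp add: norm_sgn)
  then have "dist (sgn x) x < e" using x by (auto simp: dist_norm)
  then show "x \<in> (\<Union>a\<in>sphere 0 1. ball a e)" using nz by (force simp: norm_sgn)
qed

lemma hypersurface_volume_unit_sphere:
  "hypersurface_volume (sphere (0::'a::euclidean_space) 1) =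
     2 * pi powr (real DIM('a) / 2) / Gamma (real DIM('a) / 2)"
proof -
  let ?d = "DIM('a)" and ?V = "unit_ball_vol (real DIM('a))"
  let ?f = "\<lambda>e. measure lebesgue (\<Union>a\<in>sphere (0::'a) 1. ball a e) / (2 * e)"
  let ?g = "\<lambda>e. ?V * ((1 + e) ^ ?d - (1 - e) ^ ?d) / (2 * e)"
  have fg: "?f e = ?g e" if "0 < e" "e < 1" for e
  proof -
    have "measure lebesgue (ball (0::'a) (1 + e) - cball 0 (1 - e)) =
        measure lebesgue (ball (0::'a) (1 + e)) - measure lebesgue (cball (0::'a) (1 - e))"
      using that by (intro measurable_measure_Diff) auto
    then show ?thesis
      using that by (simp add: tube_unit_sphere content_ball content_cball algebra_simps)
  qed
  have "((\<lambda>e::real. (1 + e) ^ ?d - (1 - e) ^ ?d) has_field_derivative 2 * real ?d) (at 0)"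
    by (auto intro!: derivative_eq_intros)
  then have "((\<lambda>e::real. ((1 + e) ^ ?d - (1 - e) ^ ?d) / e) \<longlongrightarrow> 2 * real ?d) (at 0)"
    by (simp add: DERIV_def)
  then have "((\<lambda>e. ?V / 2 * (((1 + e) ^ ?d - (1 - e) ^ ?d) / e)) \<longlongrightarrow> ?V / 2 * (2 * real ?d)) (at_right 0)"
    by (intro tendsto_mult tendsto_const) (auto intro: filterlim_at_split[THEN iffD1, THEN conjunct2])
  then have g: "(?g \<longlongrightarrow> real ?d * ?V) (at_right 0)"
    by (simp add: mult.commute)
  have "\<forall>\<^sub>F e in at_right 0. ?g e = ?f e"
    unfolding eventually_at_right_field by (rule exI[of _ 1]) (auto simp: fg simp del: Union_iff)
  from Lim_transform_eventually[OF g this]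
  have "hypersurface_volume (sphere (0::'a) 1) = real ?d * ?V"
    unfolding hypersurface_volume_def by (intro tendsto_Lim) auto
  moreover have "real ?d / 2 \<notin> \<int>\<^sub>\<le>\<^sub>0"
    using nonpos_Ints_nonpos[of "real ?d / 2"] by fastforce
  then have "Gamma (real ?d / 2 + 1) = real ?d / 2 * Gamma (real ?d / 2)"
    by (rule Gamma_plus1)
  ultimately show ?thesis
    by (simp add: unit_ball_vol_def)
qed

end

theory Submission
  imports Defs "HOL-Real_Asymp.Real_Asymp"
begin

text \<open>
  Put \<open>t = ln r\<close> and \<open>w = u + t\<close>, so that the volume is \<open>|S\<^sup>n\<^sup>-\<^sup>1|\<close> times the mass of
  \<open>\<rho> = e\<^sup>n\<^sup>w\<close>. In this variable \<open>(-\<Delta>)\<^sup>n\<^sup>/\<^sup>2\<close> is a product of constant-coefficient operators of order one.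
  Nonnegative scalar curvature near infinity is a Riccati inequality that excludes polynomial growth of
  \<open>(-\<Delta>)\<^sup>j u\<close>; hence the factors can be inverted one by one by positive convolutions, and
  \<open>Q \<le> (n - 1)!\<close> gives \<open>1 - w' \<le> (n - 1)! H * \<rho>\<close> with a nondecreasing kernel satisfying
  \<open>H(z) + H(-z) = g\<close>. Integrating against \<open>\<rho>\<close>, the term \<open>w' \<rho>\<close> contributes nothing, and by
  the symmetry of \<open>H\<close> the interaction term is \<open>(n - 1)! g M\<^sup>2 / 2\<close> with \<open>M = \<integral> \<rho>\<close>. Therefore
  \<open>M \<ge> 2 / ((n - 1)! g)\<close>, which is the value for the sphere.

  In the equality case \<open>w' = 1 - (n - 1)! H * \<rho>\<close>. This is the Euler-Lagrange equation of a
  displacement convex energy on the line, so its solutions of given mass agree up to translation; the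
  translates of \<open>- ln cosh\<close> are the spherical metrics.
\<close>

section \<open>Convolution with one-sided exponentials\<close>

text \<open>The bound on Q is one-sided and Q may be very negative, so inverting a factor may keep
  only an upper bound. All convolutions therefore take values in \<open>ennreal\<close>: there
  \<open>ennreal x\<close> is the positive part of x, and Fubini holds without integrability. The
  obstacle lies at infinity, where u is not controlled pointwise. The factor 2j - D has the
  homogeneous solution e^(2jt), which corresponds to a constant value of (-\<Delta>)^j u. To discard
  it, it suffices that (-\<Delta>)^j u takes values below every e > 0 arbitrarily far out. At t =
  -infinity, smoothness at the origin gives the decay. The identity for H(z) + H(-z) comes from
  regrouping the factors into pairs 2j - D, 2j + D, which reflection exchanges; the unpaired factor
  D contributes the Heaviside function. The constants of bound and sphere agree because the
  spherical density satisfies the same identity M = (n - 1)! g M^2 / 2. In the equality case the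
  displacement T t - t is not known to be bounded, and arctan makes it a bounded test
  function.\<close>

definition conv :: "(real \<Rightarrow> ennreal) \<Rightarrow> (real \<Rightarrow> ennreal) \<Rightarrow> real \<Rightarrow> ennreal" where
  "conv k f t = (\<integral>\<^sup>+z. k z * f (t - z) \<partial>lborel)"

lemma borel_measurable_conv [measurable]:
  assumes [measurable]: "k \<in> borel_measurable borel" "f \<in> borel_measurable borel"
  shows "conv k f \<in> borel_measurable borel"
  unfolding conv_def by measurable

lemma conv_commute:
  assumes [measurable]: "k \<in> borel_measurable borel" "l \<in> borel_measurable borel"
    "f \<in> borel_measurable borel"
  shows "conv k (conv l f) = conv l (conv k f)"
proof
  fix t
  have "conv k (conv l f) t = (\<integral>\<^sup>+z. (\<integral>\<^sup>+y. k z * (l y * f (t - z - y)) \<partial>lborel) \<partial>lborel)"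
    unfolding conv_def by (simp add: nn_integral_cmult)
  also have "\<dots> = (\<integral>\<^sup>+y. (\<integral>\<^sup>+z. k z * (l y * f (t - z - y)) \<partial>lborel) \<partial>lborel)"
    by (rule lborel_pair.Fubini') measurable
  also have "\<dots> = (\<integral>\<^sup>+y. l y * (\<integral>\<^sup>+z. k z * f (t - y - z) \<partial>lborel) \<partial>lborel)"
    by (subst nn_integral_cmult[symmetric])
      (auto intro!: nn_integral_cong simp: mult.left_commute diff_diff_eq add.commute)
  finally show "conv k (conv l f) t = conv l (conv k f) t"
    unfolding conv_def .
qed

lemma conv_swap:
  assumes [measurable]: "k \<in> borel_measurable borel" "f \<in> borel_measurable borel"
  shows "conv k f = conv f k"
proof
  fix t
  show "conv k f t = conv f k t"
    unfolding conv_def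
    by (subst nn_integral_real_affine[where c = "-1" and t = t]) (auto simp: mult.commute)
qed

lemma conv_assoc:
  assumes [measurable]: "k \<in> borel_measurable borel" "l \<in> borel_measurable borel"
    "f \<in> borel_measurable borel"
  shows "conv (conv k l) f = conv k (conv l f)"
proof -
  have "conv (conv k l) f = conv f (conv k l)" by (rule conv_swap) measurable
  also have "\<dots> = conv k (conv f l)" by (rule conv_commute) measurable
  also have "conv f l = conv l f" by (rule conv_swap) measurable
  finally show ?thesis .
qed

lemma conv_reflect:
  assumes [measurable]: "k \<in> borel_measurable borel" "f \<in> borel_measurable borel"
  shows "conv k f (- t) = conv (\<lambda>z. k (- z)) (\<lambda>z. f (- z)) t"
  unfolding conv_def
  by (subst nn_integral_real_affine[where c = "-1" and t = 0]) auto

lemma conv_mono: "(\<And>t. f t \<le> g t) \<Longrightarrow> conv k f t \<le> conv k g t"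
  unfolding conv_def by (intro nn_integral_mono mult_left_mono) auto

lemma conv_cmult:
  assumes [measurable]: "k \<in> borel_measurable borel" "f \<in> borel_measurable borel"
  shows "conv k (\<lambda>t. c * f t) t = c * conv k f t"
  unfolding conv_def by (subst nn_integral_cmult[symmetric]) (auto simp: mult.left_commute)

lemma conv_add:
  assumes [measurable]: "k \<in> borel_measurable borel" "f \<in> borel_measurable borel"
    "g \<in> borel_measurable borel"
  shows "conv k f t + conv k g t = conv k (\<lambda>t. f t + g t) t"
  unfolding conv_def by (subst nn_integral_add[symmetric]) (auto simp: distrib_left)

text \<open>The exceptional point is the jump of the Heaviside kernel: at 0 it and its reflection
  add up to 2 instead of 1.\<close>

lemma conv_const_except_0:
  assumes [measurable]: "k \<in> borel_measurable borel"
    and "\<And>z. z \<noteq> 0 \<Longrightarrow> f z = c"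
  shows "conv k f t = c * (\<integral>\<^sup>+z. k z \<partial>lborel)"
proof -
  have "conv k f t = (\<integral>\<^sup>+z. c * k z \<partial>lborel)"
    unfolding conv_def
    by (rule nn_integral_cong_AE) (use AE_lborel_singleton[of t] in eventually_elim, auto simp: assms mult.commute)
  then show ?thesis by (simp add: nn_integral_cmult)
qed

text \<open>The chain of radial equations dictates the order in which the factors are inverted;
  commuting one kernel past a whole list allows regrouping them. Measurability is part of the same
  induction because every exchange needs it.\<close>

lemma conv_foldr_commute:
  assumes [measurable]: "k \<in> borel_measurable borel" "f \<in> borel_measurable borel"
    and "\<And>l. l \<in> set ls \<Longrightarrow> l \<in> borel_measurable borel"
  shows "foldr conv ls f \<in> borel_measurable borel \<and>
         conv k (foldr conv ls f) = foldr conv ls (conv k f)"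
  using assms(3) by (induction ls) (auto simp: conv_commute intro!: borel_measurable_conv)

lemma ennreal_integral_le:
  fixes f :: "'a \<Rightarrow> real"
  assumes "integrable M f"
  shows "ennreal (\<integral>x. f x \<partial>M) \<le> (\<integral>\<^sup>+x. ennreal (f x) \<partial>M)"
proof -
  have "(\<integral>x. f x \<partial>M) \<le> (\<integral>x. max 0 (f x) \<partial>M)"
    using assms by (intro integral_mono) auto
  also have "ennreal \<dots> = (\<integral>\<^sup>+x. ennreal (max 0 (f x)) \<partial>M)"
    using assms by (intro nn_integral_eq_integral[symmetric]) auto
  also have "\<dots> = (\<integral>\<^sup>+x. ennreal (f x) \<partial>M)"
    by (intro nn_integral_cong) (auto simp: max_def ennreal_neg)
  finally show ?thesis by (simp add: ennreal_leI)
qed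

section \<open>One-sided inverses of first-order operators\<close>

definition exp_kernel :: "real \<Rightarrow> real \<Rightarrow> ennreal" where
  "exp_kernel b z = ennreal (exp (- b * z)) * indicator {0..} z"

abbreviation exp_kernel' :: "real \<Rightarrow> real \<Rightarrow> ennreal" where
  "exp_kernel' a z \<equiv> exp_kernel a (- z)"

lemma borel_measurable_exp_kernel [measurable]: "exp_kernel b \<in> borel_measurable borel"
  unfolding exp_kernel_def by measurable

lemma nn_integral_exp_kernel:
  assumes "b > 0"
  shows "(\<integral>\<^sup>+z. exp_kernel b z \<partial>lborel) = ennreal (1 / b)"
proof -
  have "(\<integral>\<^sup>+z. ennreal (exp (- b * z)) * indicator {0..} z \<partial>lborel) = ennreal (0 - (- exp (- b * 0) / b))"
  proof (rule nn_integral_FTC_atLeast)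
    show "((\<lambda>z. - exp (- b * z) / b) \<longlongrightarrow> 0) at_top"
      using assms by real_asymp
  qed (use assms in \<open>auto intro!: derivative_eq_intros\<close>)
  then show ?thesis by (simp add: exp_kernel_def)
qed

lemma nn_integral_exp_kernel':
  assumes "b > 0"
  shows "(\<integral>\<^sup>+z. exp_kernel' b z \<partial>lborel) = ennreal (1 / b)"
  using nn_integral_real_affine[of "exp_kernel b" "-1" 0] nn_integral_exp_kernel[OF assms]
  by simp

text \<open>Substituting s = t - z gives the variation of constants formula for a y - y' = f, with
  the source integrated from t to infinity.\<close>

lemma nn_integral_conv_exp':
  assumes [measurable]: "f \<in> borel_measurable borel"
  shows "conv (exp_kernel' a) f t =
    ennreal (exp (a * t)) * (\<integral>\<^sup>+s. ennreal (exp (- a * s)) * f s * indicator {t..} s \<partial>lborel)"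
proof -
  have "conv (exp_kernel' a) f t = (\<integral>\<^sup>+s. exp_kernel' a (t - s) * f s \<partial>lborel)"
    unfolding conv_def
    by (subst nn_integral_real_affine[where c = "-1" and t = t]) auto
  also have "\<dots> = (\<integral>\<^sup>+s. ennreal (exp (a * t)) * (ennreal (exp (- a * s)) * f s * indicator {t..} s) \<partial>lborel)"
  proof (rule nn_integral_cong)
    fix s
    have "exp (- a * (s - t)) = exp (a * t) * exp (- a * s)"
      by (simp add: exp_add[symmetric] algebra_simps)
    then show "exp_kernel' a (t - s) * f s =
        ennreal (exp (a * t)) * (ennreal (exp (- a * s)) * f s * indicator {t..} s)"
      by (simp add: exp_kernel_def indicator_def ennreal_mult mult.assoc)
  qed
  finally show ?thesis by (simp add: nn_integral_cmult)
qed

text \<open>The operator \<open>a - D\<close> is inverted; when the right-hand side has no sign, only the upper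
  bound survives.\<close>

lemma le_conv_exp_kernel':
  fixes \<psi> \<eta> :: "real \<Rightarrow> real"
  assumes deriv: "\<And>t. (\<psi> has_real_derivative (a * \<psi> t - \<eta> t)) (at t)"
    and cont: "continuous_on UNIV \<eta>"
    and lim: "\<And>e T. e > 0 \<Longrightarrow> \<exists>s\<ge>T. exp (- a * s) * \<psi> s < e"
  shows "ennreal (\<psi> t) \<le> conv (exp_kernel' a) (\<lambda>s. ennreal (\<eta> s)) t"
proof -
  have [measurable]: "\<eta> \<in> borel_measurable borel"
    by (rule borel_measurable_continuous_onI[OF cont])
  let ?I = "\<integral>\<^sup>+s. ennreal (exp (- a * s)) * ennreal (\<eta> s) * indicator {t..} s \<partial>lborel"
  have "ennreal (exp (- a * t) * \<psi> t) \<le> ?I"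
  proof (rule ennreal_le_epsilon)
    fix e :: real assume "0 < e"
    then obtain s where s: "s \<ge> t" "exp (- a * s) * \<psi> s < e" using lim by blast
    \<comment> \<open>Integrating factor: e^(-ax) \<psi> has derivative -e^(-ax) \<eta>.\<close>
    have "((\<lambda>x. exp (- a * x) * \<eta> x) has_integral - (exp (- a * s) * \<psi> s) - - (exp (- a * t) * \<psi> t)) {t..s}"
      by (rule fundamental_theorem_of_calculus)
        (use s in \<open>auto intro!: derivative_eq_intros DERIV_subset[OF deriv]
          simp: has_real_derivative_iff_has_vector_derivative[symmetric] algebra_simps\<close>)
    then have eq: "integral {t..s} (\<lambda>x. exp (- a * x) * \<eta> x) = exp (- a * t) * \<psi> t - exp (- a * s) * \<psi> s"
      by (simp add: integral_unique)
    have cont': "continuous_on {t..s} (\<lambda>x. exp (- a * x) * \<eta> x)"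
      by (intro continuous_intros continuous_on_subset[OF cont]) auto
    have "exp (- a * t) * \<psi> t - exp (- a * s) * \<psi> s = (LINT x:{t..s}|lborel. exp (- a * x) * \<eta> x)"
      using set_borel_integral_eq_integral(2)[OF borel_integrable_atLeastAtMost'[OF cont']] eq by simp
    also have "ennreal \<dots> \<le> (\<integral>\<^sup>+x. ennreal (indicator {t..s} x *\<^sub>R (exp (- a * x) * \<eta> x)) \<partial>lborel)"
      unfolding set_lebesgue_integral_def
      using borel_integrable_atLeastAtMost'[OF cont'] unfolding set_integrable_def by (intro ennreal_integral_le)
    also have "\<dots> \<le> ?I"
      by (intro nn_integral_mono) (use s in \<open>auto simp: indicator_def ennreal_mult'\<close>)
    finally have "ennreal (exp (- a * t) * \<psi> t - exp (- a * s) * \<psi> s) \<le> ?I" .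
    then have "ennreal (exp (- a * t) * \<psi> t - exp (- a * s) * \<psi> s) + ennreal e \<le> ?I + ennreal e"
      by (rule add_right_mono)
    \<comment> \<open>\<open>ennreal\<close> truncates at 0, so a negative difference is a case of
      its own: then e^(-at) \<psi>(t) < e^(-as) \<psi>(s) < e.\<close>
    moreover have "ennreal (exp (- a * t) * \<psi> t) \<le> ennreal (exp (- a * t) * \<psi> t - exp (- a * s) * \<psi> s) + ennreal e"
    proof (cases "exp (- a * t) * \<psi> t - exp (- a * s) * \<psi> s \<ge> 0")
      case True
      then have "ennreal (exp (- a * t) * \<psi> t - exp (- a * s) * \<psi> s) + ennreal e =
          ennreal (exp (- a * t) * \<psi> t - exp (- a * s) * \<psi> s + e)"
        using \<open>0 < e\<close> by (intro ennreal_plus[symmetric]) auto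
      then show ?thesis using s by (auto intro!: ennreal_leI)
    next
      case False
      then show ?thesis using s \<open>0 < e\<close> by (simp add: ennreal_neg ennreal_leI)
    qed
    ultimately show "ennreal (exp (- a * t) * \<psi> t) \<le> ?I + ennreal e" by (rule order_trans[rotated])
  qed
  then have "ennreal (exp (a * t)) * ennreal (exp (- a * t) * \<psi> t) \<le> ennreal (exp (a * t)) * ?I"
    by (rule mult_left_mono) simp
  moreover have "ennreal (exp (a * t)) * ennreal (exp (- a * t) * \<psi> t) = ennreal (\<psi> t)"
    by (simp add: ennreal_mult'[symmetric] mult.assoc[symmetric] exp_add[symmetric])
  ultimately show ?thesis by (subst nn_integral_conv_exp') auto
qed

text \<open>A nonnegative source loses nothing by truncation, so the fundamental theorem of calculus
  on a half-line gives equality. This serves to evaluate the kernel on powers of sech.\<close>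

lemma eq_conv_exp_kernel':
  fixes \<psi> \<eta> :: "real \<Rightarrow> real"
  assumes deriv: "\<And>t. (\<psi> has_real_derivative (a * \<psi> t - \<eta> t)) (at t)"
    and cont: "continuous_on UNIV \<eta>"
    and nonneg: "\<And>t. \<eta> t \<ge> 0"
    and lim: "((\<lambda>s. exp (- a * s) * \<psi> s) \<longlongrightarrow> 0) at_top"
  shows "conv (exp_kernel' a) (\<lambda>s. ennreal (\<eta> s)) t = ennreal (\<psi> t)"
proof -
  have [measurable]: "\<eta> \<in> borel_measurable borel"
    by (rule borel_measurable_continuous_onI[OF cont])
  have "(\<integral>\<^sup>+s. ennreal (exp (- a * s) * \<eta> s) * indicator {t..} s \<partial>lborel) = ennreal (0 - - (exp (- a * t) * \<psi> t))"
  proof (rule nn_integral_FTC_atLeast)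
    show "((\<lambda>z. - (exp (- a * z) * \<psi> z)) \<longlongrightarrow> 0) at_top"
      using tendsto_minus[OF lim] by simp
    show "((\<lambda>z. - (exp (- a * z) * \<psi> z)) has_real_derivative exp (- a * x) * \<eta> x) (at x)" for x
      by (auto intro!: derivative_eq_intros deriv simp: algebra_simps)
  qed (auto intro: nonneg mult_nonneg_nonneg)
  then show ?thesis
    by (subst nn_integral_conv_exp')
      (auto simp: ennreal_mult'[symmetric] nonneg mult.assoc[symmetric] exp_add[symmetric])
qed

text \<open>Reflecting t turns b + D into b - D and moves the boundary condition to -infinity, where
  smoothness at the origin provides a genuine limit.\<close>

lemma le_conv_exp_kernel:
  fixes \<psi> \<eta> :: "real \<Rightarrow> real"
  assumes deriv: "\<And>t. (\<psi> has_real_derivative (\<eta> t - b * \<psi> t)) (at t)"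
    and cont: "continuous_on UNIV \<eta>"
    and lim: "((\<lambda>s. exp (b * s) * \<psi> s) \<longlongrightarrow> 0) at_bot"
  shows "ennreal (\<psi> t) \<le> conv (exp_kernel b) (\<lambda>s. ennreal (\<eta> s)) t"
proof -
  have [measurable]: "\<eta> \<in> borel_measurable borel"
    by (rule borel_measurable_continuous_onI[OF cont])
  have "ennreal (\<psi> (- (- t))) \<le> conv (exp_kernel' b) (\<lambda>s. ennreal (\<eta> (- s))) (- t)"
  proof (rule le_conv_exp_kernel'[where \<psi> = "\<lambda>t. \<psi> (- t)"])
    show "((\<lambda>t. \<psi> (- t)) has_real_derivative b * \<psi> (- t) - \<eta> (- t)) (at t)" for t
      using DERIV_mirror[where f = \<psi> and x = t] deriv[of "- t"] by (metis minus_diff_eq)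
    show "continuous_on UNIV (\<lambda>t. \<eta> (- t))"
      by (rule continuous_on_compose2[OF cont]) (auto intro: continuous_intros)
    fix e T :: real assume "e > 0"
    with lim have "\<forall>\<^sub>F s in at_bot. exp (b * s) * \<psi> s < e" by (rule order_tendstoD)
    then obtain S where "\<And>s. s \<le> S \<Longrightarrow> exp (b * s) * \<psi> s < e" by (auto simp: eventually_at_bot_linorder)
    from this[of "- max T (- S)"] show "\<exists>s\<ge>T. exp (- b * s) * \<psi> (- s) < e"
      by (intro exI[of _ "max T (- S)"]) auto
  qed
  then show ?thesis by (simp add: conv_reflect)
qed

lemma eq_conv_exp_kernel:
  fixes \<psi> \<eta> :: "real \<Rightarrow> real"
  assumes deriv: "\<And>t. (\<psi> has_real_derivative (\<eta> t - b * \<psi> t)) (at t)"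
    and cont: "continuous_on UNIV \<eta>"
    and nonneg: "\<And>t. \<eta> t \<ge> 0"
    and lim: "((\<lambda>s. exp (b * s) * \<psi> s) \<longlongrightarrow> 0) at_bot"
  shows "conv (exp_kernel b) (\<lambda>s. ennreal (\<eta> s)) t = ennreal (\<psi> t)"
proof -
  have [measurable]: "\<eta> \<in> borel_measurable borel"
    by (rule borel_measurable_continuous_onI[OF cont])
  have "conv (exp_kernel' b) (\<lambda>s. ennreal (\<eta> (- s))) (- t) = ennreal (\<psi> (- (- t)))"
  proof (rule eq_conv_exp_kernel'[where \<psi> = "\<lambda>t. \<psi> (- t)"])
    show "((\<lambda>t. \<psi> (- t)) has_real_derivative b * \<psi> (- t) - \<eta> (- t)) (at t)" for t
      using DERIV_mirror[where f = \<psi> and x = t] deriv[of "- t"] by (metis minus_diff_eq)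
    show "continuous_on UNIV (\<lambda>t. \<eta> (- t))"
      by (rule continuous_on_compose2[OF cont]) (auto intro: continuous_intros)
    show "((\<lambda>s. exp (- b * s) * \<psi> (- s)) \<longlongrightarrow> 0) at_top"
      using lim unfolding filterlim_at_bot_mirror by simp
  qed (rule nonneg)
  then show ?thesis by (simp add: conv_reflect)
qed

section \<open>The kernel of the radial polyharmonic operator\<close>

text \<open>In dimension \<open>n = 2 K + 2\<close> and with \<open>t = ln r\<close>, convolution with this kernel turns
  \<open>r\<^sup>n (-\<Delta>)\<^sup>n\<^sup>/\<^sup>2 u\<close> into \<open>- r u'\<close>.\<close>

primrec sphere_kernel :: "nat \<Rightarrow> real \<Rightarrow> ennreal" where
  "sphere_kernel 0 = exp_kernel 0"
| "sphere_kernel (Suc k) =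
     conv (exp_kernel' (2 * real (Suc k))) (conv (exp_kernel (2 * real (Suc k))) (sphere_kernel k))"

text \<open>The product of the masses 1/(2j) of the 2k exponentials that are convolved with the
  Heaviside function, hence the total increase of \<open>sphere_kernel k\<close>.\<close>

definition sphere_const :: "nat \<Rightarrow> real" where
  "sphere_const k = (\<Prod>j=1..k. 1 / (2 * real j)\<^sup>2)"

lemma sphere_const_pos: "sphere_const k > 0"
  unfolding sphere_const_def by (intro prod_pos) auto

lemma sphere_const_Suc: "sphere_const (Suc k) = sphere_const k * (1 / (2 * real (Suc k))\<^sup>2)"
  unfolding sphere_const_def by (simp only: prod.nat_ivl_Suc' mult.commute One_nat_def le_add1 plus_1_eq_Suc)

lemma borel_measurable_sphere_kernel [measurable]: "sphere_kernel k \<in> borel_measurable borel"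
  by (induction k) (auto intro!: borel_measurable_conv)

text \<open>The Heaviside function is nondecreasing, and convolution with a nonnegative kernel
  preserves this.\<close>

lemma sphere_kernel_mono: "s \<le> t \<Longrightarrow> sphere_kernel k s \<le> sphere_kernel k t"
proof (induction k arbitrary: s t)
  case 0
  then show ?case by (auto simp: exp_kernel_def indicator_def)
next
  case (Suc k)
  have *: "conv l f s \<le> conv l f t" if "s \<le> t" "\<And>s t. s \<le> t \<Longrightarrow> f s \<le> f t" for l f s t
    unfolding conv_def using that by (intro nn_integral_mono mult_left_mono) auto
  show ?case unfolding sphere_kernel.simps by (intro * Suc)
qed

text \<open>Reflection exchanges \<open>exp_kernel\<close> and \<open>exp_kernel'\<close>, which
  occur in pairs, so only the innermost Heaviside function changes. It and its reflection add up to
  1 off the origin, and each pair multiplies this constant by its mass 1/(2j)^2. For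
  \<open>k = 0\<close> the sum at the origin is 2, hence the disjunction.\<close>

lemma sphere_kernel_reflect:
  "z \<noteq> 0 \<or> k > 0 \<Longrightarrow> sphere_kernel k z + sphere_kernel k (- z) = ennreal (sphere_const k)"
proof (induction k arbitrary: z)
  case 0
  then show ?case by (auto simp: exp_kernel_def indicator_def sphere_const_def)
next
  case (Suc k)
  let ?b = "2 * real (Suc k)"
  let ?k = "exp_kernel ?b" and ?l = "exp_kernel' ?b"
  let ?R = "\<lambda>z. sphere_kernel k (- z)"
  have "sphere_kernel (Suc k) (- z) = conv (\<lambda>z. ?l (- z)) (\<lambda>z. conv ?k (sphere_kernel k) (- z)) z"
    unfolding sphere_kernel.simps by (rule conv_reflect) measurable
  also have "(\<lambda>z. conv ?k (sphere_kernel k) (- z)) = conv ?l ?R"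
    by (rule ext, rule conv_reflect) measurable
  also have "conv (\<lambda>z. ?l (- z)) (conv ?l ?R) = conv ?l (conv ?k ?R)"
    by (simp, rule conv_commute) measurable
  finally have "sphere_kernel (Suc k) z + sphere_kernel (Suc k) (- z)
      = conv ?l (\<lambda>z. conv ?k (sphere_kernel k) z + conv ?k ?R z) z"
    unfolding sphere_kernel.simps by (subst conv_add[symmetric]) auto
  also have "(\<lambda>z. conv ?k (sphere_kernel k) z + conv ?k ?R z) = (\<lambda>z. ennreal (sphere_const k) * ennreal (1 / ?b))"
  proof
    fix z
    have "conv ?k (sphere_kernel k) z + conv ?k ?R z = conv ?k (\<lambda>z. sphere_kernel k z + ?R z) z"
      by (rule conv_add) measurable
    also have "\<dots> = ennreal (sphere_const k) * (\<integral>\<^sup>+z. ?k z \<partial>lborel)"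
      by (rule conv_const_except_0) (auto simp: Suc.IH)
    finally show "conv ?k (sphere_kernel k) z + conv ?k ?R z = ennreal (sphere_const k) * ennreal (1 / ?b)"
      by (simp only: nn_integral_exp_kernel of_nat_0_less_iff zero_less_Suc zero_less_mult_iff zero_less_numeral simp_thms)
  qed
  also have "conv ?l (\<lambda>z. ennreal (sphere_const k) * ennreal (1 / ?b)) z =
      ennreal (sphere_const k) * ennreal (1 / ?b) * (\<integral>\<^sup>+z. ?l z \<partial>lborel)"
    by (rule conv_const_except_0) measurable
  also have "(\<integral>\<^sup>+z. ?l z \<partial>lborel) = ennreal (1 / ?b)"
    by (rule nn_integral_exp_kernel') simp
  also have "ennreal (sphere_const k) * ennreal (1 / ?b) * ennreal (1 / ?b) = ennreal (sphere_const (Suc k))"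
    unfolding sphere_const_Suc using sphere_const_pos[of k]
    by (simp only: ennreal_mult'[symmetric] less_imp_le power2_eq_square mult_nonneg_nonneg
        zero_le_divide_1_iff of_nat_0_le_iff zero_le_numeral times_divide_times_eq mult_1 mult.assoc)
  finally show ?case .
qed

text \<open>The recursion adds the new pair on the outside; moved next to \<open>f\<close>, it can
  be absorbed into the argument in an induction on \<open>k\<close>.\<close>

lemma conv_sphere_kernel:
  assumes [measurable]: "f \<in> borel_measurable borel"
  shows "conv (sphere_kernel (Suc k)) f =
    conv (sphere_kernel k) (conv (exp_kernel' (2 * real (Suc k))) (conv (exp_kernel (2 * real (Suc k))) f))"
proof -
  let ?k = "exp_kernel (2 * real (Suc k))" and ?l = "exp_kernel' (2 * real (Suc k))"
  have "conv (sphere_kernel (Suc k)) f = conv ?l (conv (conv ?k (sphere_kernel k)) f)"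
    unfolding sphere_kernel.simps by (rule conv_assoc) measurable
  also have "conv (conv ?k (sphere_kernel k)) f = conv ?k (conv (sphere_kernel k) f)"
    by (rule conv_assoc) measurable
  also have "\<dots> = conv (sphere_kernel k) (conv ?k f)"
    by (rule conv_commute) measurable
  also have "conv ?l \<dots> = conv (sphere_kernel k) (conv ?l (conv ?k f))"
    by (rule conv_commute) measurable
  finally show ?thesis .
qed

text \<open>The recursion of the kernel pairs 2j - D with 2j + D, while the radial chain pairs 2j -
  D with 2(K - j) + D. Both products consist of the same factors; \<open>j = 0\<close> in the second
  list is D itself.\<close>

lemma conv_sphere_kernel_foldr:
  assumes "f \<in> borel_measurable borel"
  shows "foldr conv (map (\<lambda>j. exp_kernel' (2 * real j)) [1..<Suc k])
      (foldr conv (map (\<lambda>j. exp_kernel (2 * real j)) [0..<Suc k]) f) = conv (sphere_kernel k) f"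
  using assms
proof (induction k arbitrary: f)
  case 0
  then show ?case by simp
next
  case (Suc k)
  note [measurable] = Suc.prems
  let ?k = "exp_kernel (2 * real (Suc k))" and ?l = "exp_kernel' (2 * real (Suc k))"
  let ?L = "map (\<lambda>j. exp_kernel' (2 * real j)) [1..<Suc k]"
    and ?B = "map (\<lambda>j. exp_kernel (2 * real j)) [0..<Suc k]"
  have "foldr conv (map (\<lambda>j. exp_kernel' (2 * real j)) [1..<Suc (Suc k)])
      (foldr conv (map (\<lambda>j. exp_kernel (2 * real j)) [0..<Suc (Suc k)]) f) =
      foldr conv ?L (conv ?l (foldr conv ?B (conv ?k f)))"
    by simp
  also have "conv ?l (foldr conv ?B (conv ?k f)) = foldr conv ?B (conv ?l (conv ?k f))"
    by (rule conv_foldr_commute[THEN conjunct2]) auto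
  also have "foldr conv ?L \<dots> = conv (sphere_kernel k) (conv ?l (conv ?k f))"
    by (rule Suc.IH) measurable
  finally show ?case
    using conv_sphere_kernel[OF Suc.prems] by simp
qed

text \<open>The radial polyharmonic operator factors into the first-order operators \<open>2 j - D\<close> and
  \<open>2 (K - j) + D\<close> in \<open>t = ln r\<close>; inverting them one at a time preserves the upper bound.\<close>

lemma le_conv_sphere_kernel:
  fixes \<psi> \<eta> :: "nat \<Rightarrow> real \<Rightarrow> real"
  assumes \<psi>: "\<And>j t. 1 \<le> j \<Longrightarrow> j \<le> K \<Longrightarrow>
      (\<psi> j has_real_derivative (2 * real j * \<psi> j t - \<eta> j t)) (at t)"
    and \<eta>: "\<And>j t. j \<le> K \<Longrightarrow>
      (\<eta> j has_real_derivative (\<psi> (Suc j) t - 2 * real (K - j) * \<eta> j t)) (at t)"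
    and cont: "continuous_on UNIV (\<psi> (Suc K))"
    and top: "\<And>j e T. 1 \<le> j \<Longrightarrow> j \<le> K \<Longrightarrow> e > 0 \<Longrightarrow> \<exists>s\<ge>T. exp (- (2 * real j) * s) * \<psi> j s < e"
    and bot: "\<And>j. j \<le> K \<Longrightarrow> ((\<lambda>s. exp (2 * real (K - j) * s) * \<eta> j s) \<longlongrightarrow> 0) at_bot"
    and F [measurable]: "F \<in> borel_measurable borel"
    and le: "\<And>t. ennreal (\<psi> (Suc K) t) \<le> F t"
  shows "ennreal (\<eta> 0 t) \<le> conv (sphere_kernel K) F t"
proof -
  \<comment> \<open>After i rounds the factors 2j - D with K - i < j \<le> K and 2j + D with j < i
    have been inverted; \<open>rev\<close> puts the latest one outermost.\<close>
  let ?A = "\<lambda>i. map (\<lambda>j. exp_kernel' (2 * real j)) [Suc K - i..<Suc K]"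
  let ?B = "\<lambda>i. map (\<lambda>j. exp_kernel (2 * real j)) (rev [0..<i])"
  have cont\<psi>: "continuous_on UNIV (\<psi> j)" if "1 \<le> j" "j \<le> Suc K" for j
  proof (cases "j = Suc K")
    case False
    with that have "j \<le> K" by simp
    with \<psi> that show ?thesis by (intro DERIV_continuous_on) (auto intro: DERIV_subset)
  qed (use cont in simp)
  have cont\<eta>: "continuous_on UNIV (\<eta> j)" if "j \<le> K" for j
    using \<eta> that by (intro DERIV_continuous_on) (auto intro: DERIV_subset)
  have meas: "foldr conv (?B i) F \<in> borel_measurable borel" for i
    by (rule conv_foldr_commute[where k = "exp_kernel 0", THEN conjunct1]) auto
  have step: "ennreal (\<eta> (K - i) t) \<le> foldr conv (?A i) (foldr conv (?B (Suc i)) F) t"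
    if "i \<le> K" "\<And>t. ennreal (\<psi> (Suc K - i) t) \<le> foldr conv (?A i) (foldr conv (?B i) F) t" for i t
  proof -
    have "ennreal (\<eta> (K - i) t) \<le> conv (exp_kernel (2 * real i)) (\<lambda>s. ennreal (\<psi> (Suc K - i) s)) t"
    proof (rule le_conv_exp_kernel)
      show "(\<eta> (K - i) has_real_derivative \<psi> (Suc K - i) t - 2 * real i * \<eta> (K - i) t) (at t)" for t
        using \<eta>[of "K - i" t] that(1) by (simp add: Suc_diff_le)
      show "((\<lambda>s. exp (2 * real i * s) * \<eta> (K - i) s) \<longlongrightarrow> 0) at_bot"
        using bot[of "K - i"] that(1) by simp
    qed (use cont\<psi> that in auto)
    also have "\<dots> \<le> conv (exp_kernel (2 * real i)) (foldr conv (?A i) (foldr conv (?B i) F)) t"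
      by (intro conv_mono that)
    also have "conv (exp_kernel (2 * real i)) (foldr conv (?A i) (foldr conv (?B i) F)) =
        foldr conv (?A i) (conv (exp_kernel (2 * real i)) (foldr conv (?B i) F))"
      by (rule conv_foldr_commute[THEN conjunct2]) (auto intro: meas)
    finally show ?thesis by simp
  qed
  have main: "ennreal (\<psi> (Suc K - i) t) \<le> foldr conv (?A i) (foldr conv (?B i) F) t" if "i \<le> K" for i t
    using that
  proof (induction i arbitrary: t)
    case 0
    then show ?case using le by simp
  next
    case (Suc i)
    have "ennreal (\<psi> (K - i) t) \<le> conv (exp_kernel' (2 * real (K - i))) (\<lambda>s. ennreal (\<eta> (K - i) s)) t"
    proof (rule le_conv_exp_kernel')
      show "(\<psi> (K - i) has_real_derivative 2 * real (K - i) * \<psi> (K - i) t - \<eta> (K - i) t) (at t)" for t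
        using Suc.prems by (intro \<psi>) auto
      show "\<exists>s\<ge>T. exp (- (2 * real (K - i)) * s) * \<psi> (K - i) s < e" if "e > 0" for e T
        using Suc.prems that by (intro top) auto
    qed (auto intro: cont\<eta>)
    also have "\<dots> \<le> conv (exp_kernel' (2 * real (K - i))) (foldr conv (?A i) (foldr conv (?B (Suc i)) F)) t"
      by (intro conv_mono step) (use Suc in auto)
    also have "\<dots> = foldr conv (?A (Suc i)) (foldr conv (?B (Suc i)) F) t"
    proof -
      have "[Suc K - Suc i..<Suc K] = (K - i) # [Suc K - i..<Suc K]"
        using Suc.prems upt_conv_Cons[of "K - i" "Suc K"] by (simp add: Suc_diff_le del: upt_Suc)
      then show ?thesis by (simp del: upt_Suc)
    qed
    finally show ?case by simp
  qed
  have "ennreal (\<eta> 0 t) \<le> foldr conv (?A K) (foldr conv (?B (Suc K)) F) t"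
    using step[of K] main[of K] by simp
  also have "foldr conv (?B (Suc K)) F = foldr conv (map (\<lambda>j. exp_kernel (2 * real j)) [0..<Suc K]) F"
  proof -
    have "foldr conv (?B i) F = foldr conv (map (\<lambda>j. exp_kernel (2 * real j)) [0..<i]) F" for i
    proof (induction i)
      case (Suc i)
      have "foldr conv (?B (Suc i)) F = conv (exp_kernel (2 * real i)) (foldr conv (?B i) F)" by simp
      also have "\<dots> = foldr conv (map (\<lambda>j. exp_kernel (2 * real j)) [0..<i]) (conv (exp_kernel (2 * real i)) F)"
        unfolding Suc by (rule conv_foldr_commute[THEN conjunct2]) auto
      finally show ?case by simp
    qed simp
    then show ?thesis .
  qed
  also have "foldr conv (?A K) \<dots> = conv (sphere_kernel K) F"
    using conv_sphere_kernel_foldr[OF F, of K] by simp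
  finally show ?thesis .
qed

section \<open>Powers of sech under the kernel\<close>

lemma has_real_derivative_sech_power:
  "((\<lambda>t. 1 / cosh t ^ i) has_real_derivative - real i * (1 / cosh t ^ i) * tanh t) (at t)"
proof (cases i)
  case (Suc k)
  have nz: "cosh t \<noteq> 0" using cosh_real_pos[of t] by simp
  have "((\<lambda>t. inverse (cosh t) ^ Suc k) has_real_derivative
      - real (Suc k) * (inverse (cosh t) ^ Suc k) * (sinh t / cosh t)) (at t)"
    by (rule derivative_eq_intros refl nz)+ (simp add: divide_inverse algebra_simps)
  then show ?thesis
    unfolding Suc by (simp only: tanh_def divide_inverse power_inverse mult_1)
qed simp

lemma tanh_square_real: "tanh t ^ 2 = (1::real) - 1 / cosh t ^ 2"
proof -
  have "(sinh t)\<^sup>2 = (cosh t)\<^sup>2 - 1" by (simp add: cosh_square_eq)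
  moreover have "(cosh t)\<^sup>2 \<noteq> 0" using cosh_real_pos[of t] by simp
  ultimately show ?thesis by (simp add: tanh_def power_divide diff_divide_distrib)
qed

lemma has_real_derivative_tanh_sech:
  "((\<lambda>t::real. tanh t) has_real_derivative 1 / cosh t ^ 2) (at t)"
proof -
  have nz: "cosh t \<noteq> 0" using cosh_real_pos[of t] by simp
  have "1 - tanh t ^ 2 = 1 / cosh t ^ 2" by (simp add: tanh_square_real)
  with has_field_derivative_tanh[OF nz DERIV_ident] show ?thesis by simp
qed

text \<open>This is the identity \<open>(j\<^sup>2 - D\<^sup>2) s\<^sup>j = j (j + 1) s\<^sup>j\<^sup>+\<^sup>2\<close> for \<open>s = 1 / cosh\<close>.\<close>

lemma conv_exp_kernel_sech:
  assumes "j > 0"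
  shows "conv (exp_kernel' (real j)) (conv (exp_kernel (real j)) (\<lambda>t. ennreal (1 / cosh t ^ (j + 2)))) t
    = ennreal (1 / (real j * (real j + 1)) * (1 / cosh t ^ j))"
proof -
  let ?c = "1 / (real j * (real j + 1))"
  \<comment> \<open>The intermediate function is forced: the outer kernel inverts j - D, and (j -
    D)(c s^j) = c j s^j (1 + tanh).\<close>
  let ?\<eta> = "\<lambda>t::real. ?c * (real j * (1 / cosh t ^ j) * (1 + tanh t))"
  have nz [simp]: "cosh t \<noteq> (0::real)" for t using cosh_real_pos[of t] by simp
  note ds = has_real_derivative_sech_power and dt = has_real_derivative_tanh_sech
  have tb: "\<bar>tanh t\<bar> \<le> (1::real)" for t
    using tanh_real_lt_1[of t] tanh_real_gt_neg1[of t] by linarith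
  note tsq = tanh_square_real
  have alg1: "c * (J * (- J * s * T) * (1 + T) + J * s * q) = c * J * s * (- J * T - J * T ^ 2 + q)" for c J s T q :: real
    by (simp add: algebra_simps power2_eq_square)
  have alg2: "c * (- J * s * T) = J * (c * s) - c * (J * s * (1 + T))" for c J s T :: real
    by (simp add: algebra_simps)
  have cont: "continuous_on UNIV (\<lambda>t::real. 1 / cosh t ^ i)" for i
    by (intro continuous_intros) auto
  have inner: "conv (exp_kernel (real j)) (\<lambda>t. ennreal (1 / cosh t ^ (j + 2))) = (\<lambda>t. ennreal (?\<eta> t))"
  proof (rule ext, rule eq_conv_exp_kernel)
    fix t :: real
    have "(?\<eta> has_real_derivative ?c * (real j * (- real j * (1 / cosh t ^ j) * tanh t) * (1 + tanh t)
        + real j * (1 / cosh t ^ j) * (1 / cosh t ^ 2))) (at t)"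
    proof -
      have "((\<lambda>t. real j * (1 / cosh t ^ j) * (1 + tanh t)) has_real_derivative
          real j * (- real j * (1 / cosh t ^ j) * tanh t) * (1 + tanh t) + (0 + 1 / cosh t ^ 2) * (real j * (1 / cosh t ^ j))) (at t)"
        by (intro DERIV_mult DERIV_add DERIV_const DERIV_cmult ds dt)
      from DERIV_cmult[OF this, of ?c] show ?thesis by (simp only: add_0 mult.commute)
    qed
    also have "?c * (real j * (- real j * (1 / cosh t ^ j) * tanh t) * (1 + tanh t)
        + real j * (1 / cosh t ^ j) * (1 / cosh t ^ 2)) =
        ?c * real j * (1 / cosh t ^ j) * (- real j * tanh t - real j * tanh t ^ 2 + 1 / cosh t ^ 2)"
      by (rule alg1)
    also have "\<dots> = ?c * real j * (1 / cosh t ^ j) * ((real j + 1) / cosh t ^ 2 - real j * (1 + tanh t))"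
      unfolding tsq by (intro arg_cong[where f = "\<lambda>x. ?c * real j * (1 / cosh t ^ j) * x"])
        (simp add: algebra_simps add_divide_distrib)
    also have "\<dots> = 1 / cosh t ^ (j + 2) - real j * ?\<eta> t"
    proof -
      have "?c * real j * (1 / cosh t ^ j) * ((real j + 1) / cosh t ^ 2) = 1 / cosh t ^ (j + 2)"
        using assms by (simp add: power_add divide_simps add_nonneg_eq_0_iff power2_eq_square)
      moreover have "?c * real j * (1 / cosh t ^ j) * (real j * (1 + tanh t)) = real j * ?\<eta> t"
        by (simp only: ac_simps)
      ultimately show ?thesis by (simp only: right_diff_distrib)
    qed
    finally show "(?\<eta> has_real_derivative 1 / cosh t ^ (j + 2) - real j * ?\<eta> t) (at t)" .
    show "0 \<le> 1 / cosh t ^ (j + 2)" by (simp add: cosh_real_nonneg)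
  next
    show "((\<lambda>s. exp (real j * s) * ?\<eta> s) \<longlongrightarrow> 0) at_bot"
    proof (rule Lim_null_comparison)
      show "((\<lambda>s. exp (real j * s) * (?c * (real j * 2))) \<longlongrightarrow> 0) at_bot"
        using assms by real_asymp
      have "\<bar>?\<eta> s\<bar> \<le> ?c * (real j * 2)" for s
      proof -
        let ?X = "1 / cosh s ^ j * (1 + tanh s)"
        have "1 / cosh s ^ j \<le> 1" using one_le_power[OF cosh_real_ge_1] by simp
        then have "?X \<le> 1 * 2" "0 \<le> ?X"
          using tb[of s] by (intro mult_mono mult_nonneg_nonneg; simp add: cosh_real_nonneg abs_le_iff)+
        then have X: "?X \<le> 2" "0 \<le> ?X" by simp_all
        have "0 \<le> ?c * (real j * ?X)"
          using X(2) by (intro mult_nonneg_nonneg[of ?c] mult_nonneg_nonneg[of "real j"]) auto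
        moreover have "?c * (real j * ?X) \<le> ?c * (real j * 2)"
          by (rule mult_left_mono[OF mult_left_mono[OF X(1)]]) auto
        ultimately show ?thesis by (simp only: mult.assoc abs_of_nonneg)
      qed
      then show "\<forall>\<^sub>F s in at_bot. norm (exp (real j * s) * ?\<eta> s) \<le> exp (real j * s) * (?c * (real j * 2))"
        by (intro always_eventually allI) (subst norm_mult, simp only: real_norm_def abs_exp_cancel mult_left_mono[OF _ exp_ge_zero])
    qed
  qed (rule cont)
  show ?thesis unfolding inner
  proof (rule eq_conv_exp_kernel')
    show "((\<lambda>t. ?c * (1 / cosh t ^ j)) has_real_derivative real j * (?c * (1 / cosh t ^ j)) - ?\<eta> t) (at t)" for t
    proof -
      have "((\<lambda>t. ?c * (1 / cosh t ^ j)) has_real_derivative ?c * (- real j * (1 / cosh t ^ j) * tanh t)) (at t)"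
        by (rule DERIV_cmult[OF ds])
      also have "?c * (- real j * (1 / cosh t ^ j) * tanh t) = real j * (?c * (1 / cosh t ^ j)) - ?\<eta> t"
        by (rule alg2)
      finally show ?thesis .
    qed
    show "continuous_on UNIV ?\<eta>"
      by (intro continuous_intros) auto
    show "?\<eta> t \<ge> 0" for t
      using tb[of t] by (auto intro!: mult_nonneg_nonneg simp: cosh_real_nonneg abs_le_iff)
    show "((\<lambda>s. exp (- real j * s) * (?c * (1 / cosh s ^ j))) \<longlongrightarrow> 0) at_top"
    proof (rule Lim_null_comparison)
      show "((\<lambda>s. exp (- real j * s) * (?c * 1)) \<longlongrightarrow> 0) at_top"
        using assms by real_asymp
      have "1 / cosh s ^ j \<le> 1" "0 \<le> 1 / cosh s ^ j" for s :: real
        using one_le_power[OF cosh_real_ge_1] by (auto simp: cosh_real_nonneg)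
      then show "\<forall>\<^sub>F s in at_top. norm (exp (- real j * s) * (?c * (1 / cosh s ^ j))) \<le> exp (- real j * s) * (?c * 1)"
        by (intro always_eventually allI)
          (simp only: real_norm_def abs_mult abs_exp_cancel abs_of_nonneg zero_le_divide_1_iff
            mult_nonneg_nonneg of_nat_0_le_iff add_nonneg_nonneg zero_le_one mult_left_mono exp_ge_zero)
    qed
  qed
qed

text \<open>Each pair lowers the power of sech by 2 and contributes 1/(2j (2j + 1)). These factors
  accumulate to 1/(2K + 1)!, and the remaining sech^2 integrates to 1 + tanh. With w = -ln cosh this
  says that 1 - w' equals (n - 1)! times the kernel convolved with e^(nw): the sphere attains
  equality in the comparison.\<close>

lemma conv_sphere_kernel_sech:
  "conv (sphere_kernel K) (\<lambda>t. ennreal (1 / cosh t ^ (2 * K + 2))) t = ennreal ((1 + tanh t) / fact (2 * K + 1))"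
proof (induction K arbitrary: t)
  case 0
  have nz [simp]: "cosh t \<noteq> (0::real)" for t using cosh_real_pos[of t] by simp
  have "conv (exp_kernel 0) (\<lambda>t. ennreal (1 / cosh t ^ 2)) t = ennreal (1 + tanh t)"
  proof (rule eq_conv_exp_kernel)
    show "((\<lambda>t. 1 + tanh t) has_real_derivative 1 / cosh t ^ 2 - 0 * (1 + tanh t)) (at t)" for t :: real
      using DERIV_add[OF DERIV_const has_real_derivative_tanh_sech] by simp
    show "continuous_on UNIV (\<lambda>t::real. 1 / cosh t ^ 2)" by (intro continuous_intros) auto
    have "((\<lambda>s::real. 1 + tanh s) \<longlongrightarrow> 0) at_bot"
      using tendsto_add[OF tendsto_const[of 1] tanh_real_at_bot] by simp
    then show "((\<lambda>s::real. exp (0 * s) * (1 + tanh s)) \<longlongrightarrow> 0) at_bot" by simp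
  qed simp
  then show ?case by (simp only: sphere_kernel.simps mult_0_right add_0 fact_1 div_by_1)
next
  case (Suc K)
  let ?j = "2 * Suc K" and ?c = "ennreal (1 / (real (2 * Suc K) * (real (2 * Suc K) + 1)))"
  have measurable_sech [measurable]: "(\<lambda>t::real. ennreal (1 / cosh t ^ i)) \<in> borel_measurable borel" for i
  proof -
    have [measurable]: "(cosh :: real \<Rightarrow> real) \<in> borel_measurable borel"
      by (intro borel_measurable_continuous_onI continuous_intros)
    show ?thesis by measurable
  qed
  have "conv (exp_kernel' (2 * real (Suc K))) (conv (exp_kernel (2 * real (Suc K)))
      (\<lambda>t. ennreal (1 / cosh t ^ (2 * Suc K + 2)))) = (\<lambda>t. ?c * ennreal (1 / cosh t ^ (2 * K + 2)))"
  proof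
    fix t :: real
    have eqs: "2 * K + 2 = 2 * Suc K" "2 * real (Suc K) = real (2 * Suc K)" by simp_all
    have "?c * ennreal (1 / cosh t ^ (2 * Suc K)) =
        ennreal (1 / (real (2 * Suc K) * (real (2 * Suc K) + 1)) * (1 / cosh t ^ (2 * Suc K)))"
      by (rule ennreal_mult'[symmetric]) simp
    with conv_exp_kernel_sech[of ?j t, OF mult_pos_pos[OF zero_less_numeral zero_less_Suc]]
    show "conv (exp_kernel' (2 * real (Suc K))) (conv (exp_kernel (2 * real (Suc K)))
        (\<lambda>t. ennreal (1 / cosh t ^ (2 * Suc K + 2)))) t = ?c * ennreal (1 / cosh t ^ (2 * K + 2))"
      by (simp only: eqs)
  qed
  then have "conv (sphere_kernel (Suc K)) (\<lambda>t. ennreal (1 / cosh t ^ (2 * Suc K + 2))) t =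
      conv (sphere_kernel K) (\<lambda>t. ?c * ennreal (1 / cosh t ^ (2 * K + 2))) t"
    using conv_sphere_kernel[of "\<lambda>t. ennreal (1 / cosh t ^ (2 * Suc K + 2))" K]
    by (simp only: measurable_sech)
  also have "\<dots> = ?c * ennreal ((1 + tanh t) / fact (2 * K + 1))"
    by (subst conv_cmult) (measurable, simp only: Suc.IH)
  also have "\<dots> = ennreal (1 / (real (2 * Suc K) * (real (2 * Suc K) + 1)) * ((1 + tanh t) / fact (2 * K + 1)))"
    by (intro ennreal_mult'[symmetric]) simp
  also have "1 / (real (2 * Suc K) * (real (2 * Suc K) + 1)) * ((1 + tanh t) / fact (2 * K + 1)) =
      (1 + tanh t) / fact (2 * Suc K + 1)"
  proof -
    have "(fact (2 * Suc K + 1) :: real) = (real (2 * Suc K) + 1) * (real (2 * Suc K) * fact (2 * K + 1))"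
      by (simp add: algebra_simps)
    then show ?thesis by simp
  qed
  finally show ?case .
qed

section \<open>Kernels symmetric up to a constant\<close>

lemma tendsto_integral_expanding_intervals:
  fixes f :: "real \<Rightarrow> real"
  assumes f [measurable]: "integrable lborel f"
    and a: "filterlim a at_bot sequentially" and b: "filterlim b at_top sequentially"
  shows "(\<lambda>k. \<integral>x. indicator {a k..b k} x * f x \<partial>lborel) \<longlonglongrightarrow> (\<integral>x. f x \<partial>lborel)"
proof (rule integral_dominated_convergence[where w = "\<lambda>x. norm (f x)"])
  show "AE x in lborel. (\<lambda>k. indicator {a k..b k} x * f x) \<longlonglongrightarrow> f x"
  proof (rule AE_I2)
    fix x
    from a have "\<forall>\<^sub>F k in sequentially. a k \<le> x" by (auto simp: filterlim_at_bot)
    moreover from b have "\<forall>\<^sub>F k in sequentially. x \<le> b k" by (auto simp: filterlim_at_top)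
    ultimately have "\<forall>\<^sub>F k in sequentially. indicator {a k..b k} x * f x = f x"
      by eventually_elim auto
    then show "(\<lambda>k. indicator {a k..b k} x * f x) \<longlonglongrightarrow> f x"
      by (rule tendsto_eventually)
  qed
  show "AE x in lborel. norm (indicator {a k..b k} x * f x) \<le> norm (f x)" for k
    by (auto simp: indicator_def)
qed (use f in auto)

text \<open>Applied to two densities, whose primitives are distribution functions, and to a tested
  difference of two equations, which has no definite sign.\<close>

lemma ex_antiderivative_lborel:
  fixes f :: "real \<Rightarrow> real"
  assumes cont: "continuous_on UNIV f" and f: "integrable lborel f"
  obtains F where "\<And>x. (F has_real_derivative f x) (at x)" "(F \<longlongrightarrow> 0) at_bot"
    "(F \<longlongrightarrow> (\<integral>x. f x \<partial>lborel)) at_top"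
proof
  let ?F = "\<lambda>t. \<integral>x. indicator {..t} x * f x \<partial>lborel"
  have ind: "integrable lborel (\<lambda>x. indicator A x * f x)" if "A \<in> sets borel" for A
    using integrable_mult_indicator[of A lborel f] f that by simp
  have diff: "?F t = ?F a + integral {a..t} f" if "a \<le> t" for a t
  proof -
    have "integral {a..t} f = (\<integral>x. indicator {a..t} x * f x \<partial>lborel)"
      using set_borel_integral_eq_integral(2)[of "{a..t}" f] ind[of "{a..t}"]
      by (simp add: set_integrable_def set_lebesgue_integral_def)
    moreover have "?F t = (\<integral>x. indicator {..a} x * f x + indicator {a..t} x * f x \<partial>lborel)"
      by (rule integral_cong_AE)
        (use AE_lborel_singleton[of a] that f in \<open>auto simp: indicator_def\<close>)
    ultimately show ?thesis using ind by simp
  qed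
  show "(?F has_real_derivative f x) (at x)" for x
  proof -
    have "((\<lambda>t. integral {x-1..t} f) has_real_derivative f x) (at x within {x-1..x+1})"
      by (rule integral_has_real_derivative) (auto intro: continuous_on_subset[OF cont])
    then have "((\<lambda>t. integral {x-1..t} f) has_real_derivative f x) (at x)"
      by (simp add: at_within_Icc_at)
    then have "((\<lambda>t. ?F (x - 1) + integral {x-1..t} f) has_real_derivative 0 + f x) (at x)"
      by (intro DERIV_add DERIV_const)
    moreover have "\<forall>\<^sub>F t in nhds x. ?F t = ?F (x - 1) + integral {x-1..t} f"
      using eventually_nhds_in_open[of "{x - 1<..}" x] by (auto elim!: eventually_mono intro: diff)
    ultimately show ?thesis
      using DERIV_cong_ev[of x x ?F "\<lambda>t. ?F (x - 1) + integral {x-1..t} f" "f x" "f x"] by simp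
  qed
  show "(?F \<longlongrightarrow> (\<integral>x. f x \<partial>lborel)) at_top"
    using tendsto_integral_at_top[of lborel f] f by simp
  \<comment> \<open>The limit at -infinity is read off from the limit at infinity for the reflected
    function.\<close>
  have "((\<lambda>y. \<integral>x. indicator {..y} x *\<^sub>R f (- x) \<partial>lborel) \<longlongrightarrow> (\<integral>x. f (- x) \<partial>lborel)) at_top"
    using lborel_integrable_real_affine[OF f, of "-1" 0] by (intro tendsto_integral_at_top) auto
  moreover have "(\<integral>x. indicator {..y} x *\<^sub>R f (- x) \<partial>lborel) = (\<integral>x. f x \<partial>lborel) - ?F (- y)" for y
  proof -
    have "(\<integral>x. indicator {..y} x *\<^sub>R f (- x) \<partial>lborel) = (\<integral>x. indicator {..y} (- x) *\<^sub>R f x \<partial>lborel)"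
      using lborel_integral_real_affine[of "-1" "\<lambda>x. indicator {..y} x *\<^sub>R f (- x)" 0] by simp
    also have "\<dots> = (\<integral>x. f x - indicator {..- y} x * f x \<partial>lborel)"
      by (rule integral_cong_AE)
        (use AE_lborel_singleton[of "- y"] f in \<open>auto simp: indicator_def\<close>)
    finally show ?thesis using ind f by simp
  qed
  moreover have "(\<integral>x. f (- x) \<partial>lborel) = (\<integral>x. f x \<partial>lborel)"
    using lborel_integral_real_affine[of "-1" f 0] by simp
  ultimately have "((\<lambda>y. (\<integral>x. f x \<partial>lborel) - ?F (- y)) \<longlongrightarrow> (\<integral>x. f x \<partial>lborel)) at_top" by simp
  from tendsto_diff[OF tendsto_const[of "\<integral>x. f x \<partial>lborel"] this]
  show "(?F \<longlongrightarrow> 0) at_bot" by (simp add: filterlim_at_bot_mirror)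
qed

text \<open>An integrable function need not tend to 0, but its lower limit at infinity is 0. A
  sequence of small values suffices to remove the boundary terms there.\<close>

lemma integrable_nonneg_small_values:
  fixes f :: "real \<Rightarrow> real"
  assumes f: "integrable lborel f" and nonneg: "\<And>x. f x \<ge> 0"
  obtains b where "filterlim b at_top sequentially" "(\<lambda>k. f (b k)) \<longlonglongrightarrow> 0"
proof -
  have "\<exists>b\<ge>T. f b < e" if "e > 0" for e T
  proof (rule ccontr)
    assume "\<not> (\<exists>b\<ge>T. f b < e)"
    then have ge: "f x \<ge> e" if "x \<ge> T" for x using that by force
    have "(\<integral>\<^sup>+x. ennreal e * indicator {T..} x \<partial>lborel) \<le> (\<integral>\<^sup>+x. ennreal (f x) \<partial>lborel)"
      by (intro nn_integral_mono) (auto simp: indicator_def ge ennreal_leI)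
    also have "\<dots> < \<infinity>" using integrableD(2)[OF f] nonneg by (simp add: real_integrable_def top.not_eq_extremum)
    finally have "ennreal e * emeasure lborel {T..} < \<infinity>" by (simp add: nn_integral_cmult)
    moreover have "emeasure lborel {T..} = (\<infinity> :: ennreal)"
    proof (rule ccontr)
      assume "emeasure lborel {T..} \<noteq> (\<infinity> :: ennreal)"
      then obtain r where r: "r \<ge> 0" "emeasure lborel {T..} = ennreal r" by (cases "emeasure lborel {T..}") auto
      have "emeasure lborel {T..T + r + 1} \<le> emeasure lborel {T..}" by (intro emeasure_mono) auto
      then show False using r by (simp add: ennreal_le_iff)
    qed
    ultimately show False using \<open>e > 0\<close> by (simp add: ennreal_mult_top)
  qed
  then have "\<exists>b\<ge>real k. f b < 1 / real (Suc k)" for k by simp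
  then obtain b where b: "\<And>k. b k \<ge> real k" "\<And>k. f (b k) < 1 / real (Suc k)" by metis
  show ?thesis
  proof
    show "filterlim b at_top sequentially"
      by (rule filterlim_at_top_mono[OF filterlim_real_sequentially]) (use b in auto)
    show "(\<lambda>k. f (b k)) \<longlonglongrightarrow> 0"
      by (rule tendsto_sandwich[OF _ _ tendsto_const LIMSEQ_inverse_real_of_nat])
        (auto intro!: always_eventually nonneg less_imp_le simp: inverse_eq_divide b simp del: of_nat_Suc)
  qed
qed

section \<open>Interaction energies of finite measures\<close>

lemma integral_swap_finite_measure:
  fixes F :: "real \<Rightarrow> real \<Rightarrow> real"
  assumes "finite_measure \<mu>" and [measurable_cong]: "sets \<mu> = sets borel"
    and [measurable]: "(\<lambda>(t, s). F t s) \<in> borel_measurable (borel \<Otimes>\<^sub>M borel)"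
    and bound: "\<And>t s. \<bar>F t s\<bar> \<le> B"
  shows "(\<integral>t. (\<integral>s. F t s \<partial>\<mu>) \<partial>\<mu>) = (\<integral>t. (\<integral>s. F s t \<partial>\<mu>) \<partial>\<mu>)"
proof -
  interpret finite_measure \<mu> by fact
  interpret pair_sigma_finite \<mu> \<mu> ..
  interpret P: finite_measure "\<mu> \<Otimes>\<^sub>M \<mu>"
    using assms(1) by (intro finite_measure_pair_measure)
  have "integrable (\<mu> \<Otimes>\<^sub>M \<mu>) (case_prod F)"
    by (rule P.integrable_const_bound[where B = B]) (auto simp: bound)
  from Fubini_integral[OF this] show ?thesis by simp
qed

text \<open>Equivalently, h - g/2 is odd and nondecreasing, so it has an even convex primitive, the
  interaction potential. Oddness makes the self-interaction explicit; monotonicity is the source of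
  displacement convexity.\<close>

locale balanced_kernel =
  fixes h :: "real \<Rightarrow> real" and g :: real
  assumes mono_h: "mono h"
    and nonneg_h: "\<And>z. 0 \<le> h z"
    and reflect_h: "\<And>z. h z + h (- z) = g"
begin

lemma h_le: "h z \<le> g"
  using reflect_h[of z] nonneg_h[of "- z"] by linarith

lemma abs_h_le: "\<bar>h z\<bar> \<le> g"
  using h_le[of z] nonneg_h[of z] by simp

lemma g_nonneg: "0 \<le> g"
  using h_le[of 0] nonneg_h[of 0] by simp

lemma measurable_h [measurable]: "h \<in> borel_measurable borel"
  by (rule borel_measurable_mono[OF mono_h])

context
  fixes \<mu> :: "real measure"
  assumes fin: "finite_measure \<mu>" and sets_\<mu> [measurable_cong]: "sets \<mu> = sets borel"
begin

lemma integrable_h [simp]: "T \<in> borel_measurable borel \<Longrightarrow> integrable \<mu> (\<lambda>s. h (T s))"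
  by (rule finite_measure.integrable_const_bound[OF fin, where B = g]) (auto simp: abs_h_le)

lemma integral_h_bounds:
  assumes [measurable]: "T \<in> borel_measurable borel"
  shows "0 \<le> (\<integral>s. h (T s) \<partial>\<mu>)" "(\<integral>s. h (T s) \<partial>\<mu>) \<le> g * measure \<mu> (space \<mu>)"
proof -
  show "0 \<le> (\<integral>s. h (T s) \<partial>\<mu>)" by (intro integral_nonneg_AE) (auto simp: nonneg_h)
  have "(\<integral>s. h (T s) \<partial>\<mu>) \<le> (\<integral>s. g \<partial>\<mu>)"
    using fin by (intro integral_mono) (auto simp: h_le finite_measure.integrable_const)
  then show "(\<integral>s. h (T s) \<partial>\<mu>) \<le> g * measure \<mu> (space \<mu>)" by (simp add: mult.commute)
qed

text \<open>Swapping t and s replaces h(t - s) by g - h(t - s), so the integral I satisfies I = g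
  M^2 - I, where M is the total mass.\<close>

lemma energy_balanced:
  "(\<integral>t. (\<integral>s. h (t - s) \<partial>\<mu>) \<partial>\<mu>) = g * (measure \<mu> (space \<mu>))\<^sup>2 / 2"
proof -
  interpret finite_measure \<mu> by (rule fin)
  let ?I = "\<integral>t. (\<integral>s. h (t - s) \<partial>\<mu>) \<partial>\<mu>"
  have i1: "integrable \<mu> (\<lambda>t. \<integral>s. h (t - s) \<partial>\<mu>)"
  proof (rule integrable_const_bound[where B = "g * measure \<mu> (space \<mu>)"])
    show "AE t in \<mu>. norm (\<integral>s. h (t - s) \<partial>\<mu>) \<le> g * measure \<mu> (space \<mu>)"
      using integral_h_bounds[of "\<lambda>s. t - s" for t] by (intro AE_I2) (simp add: abs_of_nonneg)
  qed measurable
  have "?I = (\<integral>t. (\<integral>s. h (s - t) \<partial>\<mu>) \<partial>\<mu>)"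
    by (rule integral_swap_finite_measure[OF fin sets_\<mu>, where B = g]) (auto simp: abs_h_le)
  also have "\<dots> = (\<integral>t. (\<integral>s. g - h (t - s) \<partial>\<mu>) \<partial>\<mu>)"
    using reflect_h by (intro Bochner_Integration.integral_cong refl) (metis add_diff_cancel_right' minus_diff_eq)
  also have "\<dots> = (\<integral>t. g * measure \<mu> (space \<mu>) - (\<integral>s. h (t - s) \<partial>\<mu>) \<partial>\<mu>)"
    by (intro Bochner_Integration.integral_cong refl, subst Bochner_Integration.integral_diff) auto
  also have "\<dots> = g * measure \<mu> (space \<mu>) * measure \<mu> (space \<mu>) - ?I"
    using i1 by (subst Bochner_Integration.integral_diff) auto
  finally show ?thesis by (simp add: power2_eq_square)
qed

text \<open>The difference F(t, s) = h(T t - T s) - h(t - s) is antisymmetric. Hence twice the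
  integral is that of F(t, s) (\<phi>(d t) - \<phi>(d s)) with d t = T t - t, and by monotonicity of
  h and \<phi> the two factors never have opposite signs.\<close>

lemma energy_transport_nonneg:
  assumes [measurable]: "T \<in> borel_measurable borel" and \<phi>: "mono \<phi>" "\<And>x. \<bar>\<phi> x\<bar> \<le> C"
  shows "0 \<le> (\<integral>t. (\<integral>s. h (T t - T s) - h (t - s) \<partial>\<mu>) * \<phi> (T t - t) \<partial>\<mu>)" (is "0 \<le> ?J")
proof -
  interpret finite_measure \<mu> by (rule fin)
  have [measurable]: "\<phi> \<in> borel_measurable borel" by (rule borel_measurable_mono[OF \<phi>(1)])
  let ?F = "\<lambda>t s. h (T t - T s) - h (t - s)" and ?d = "\<lambda>t. T t - t"
  have F: "\<bar>?F t s\<bar> \<le> g" for t s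
    using h_le[of "T t - T s"] nonneg_h[of "T t - T s"] h_le[of "t - s"] nonneg_h[of "t - s"] by linarith
  have C: "0 \<le> C" using \<phi>(2)[of 0] by linarith
  have anti: "?F s t = - ?F t s" for t s
    using reflect_h[of "T t - T s"] reflect_h[of "t - s"] by simp
  have bnd: "\<bar>?F t s * \<phi> x\<bar> \<le> g * C" for t s x
    unfolding abs_mult using F \<phi>(2) g_nonneg by (intro mult_mono) auto
  have int: "integrable \<mu> (\<lambda>s. ?F t s * \<phi> (?d t))" "integrable \<mu> (\<lambda>s. ?F t s * \<phi> (?d s))" for t
    by (rule integrable_const_bound[where B = "g * C"]; auto simp: bnd simp del: abs_mult)+
  have intb: "\<bar>\<integral>s. f s \<partial>\<mu>\<bar> \<le> B * measure \<mu> (space \<mu>)" if "\<And>s. \<bar>f s\<bar> \<le> B" "f \<in> borel_measurable borel" for f B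
  proof -
    have "\<bar>\<integral>s. f s \<partial>\<mu>\<bar> \<le> (\<integral>s. \<bar>f s\<bar> \<partial>\<mu>)" by (rule integral_abs_bound)
    also have "\<dots> \<le> (\<integral>s. B \<partial>\<mu>)"
      using that by (intro integral_mono integrable_abs integrable_const integrable_const_bound[where f = f and B = B]) auto
    finally have "\<bar>\<integral>s. f s \<partial>\<mu>\<bar> \<le> (\<integral>s. B \<partial>\<mu>)" .
    then show ?thesis by (simp add: mult.commute)
  qed
  have int2: "integrable \<mu> (\<lambda>t. \<integral>s. ?F t s * \<phi> (?d t) \<partial>\<mu>)" "integrable \<mu> (\<lambda>t. \<integral>s. ?F t s * \<phi> (?d s) \<partial>\<mu>)"
    by (rule integrable_const_bound[where B = "g * C * measure \<mu> (space \<mu>)"],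
        rule AE_I2, unfold real_norm_def, rule intb, rule bnd, measurable)+
  have J: "?J = (\<integral>t. (\<integral>s. ?F t s * \<phi> (?d t) \<partial>\<mu>) \<partial>\<mu>)" by simp
  also have "\<dots> = (\<integral>t. (\<integral>s. ?F s t * \<phi> (?d s) \<partial>\<mu>) \<partial>\<mu>)"
    by (rule integral_swap_finite_measure[OF fin sets_\<mu>, where B = "g * C"]) (auto simp: bnd simp del: abs_mult)
  also have "\<dots> = (\<integral>t. - (\<integral>s. ?F t s * \<phi> (?d s) \<partial>\<mu>) \<partial>\<mu>)"
    by (subst anti) (simp only: mult_minus_left Bochner_Integration.integral_minus)
  also have "\<dots> = - (\<integral>t. (\<integral>s. ?F t s * \<phi> (?d s) \<partial>\<mu>) \<partial>\<mu>)"
    by (rule Bochner_Integration.integral_minus)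
  finally have J': "?J = - (\<integral>t. (\<integral>s. ?F t s * \<phi> (?d s) \<partial>\<mu>) \<partial>\<mu>)" .
  have "(\<integral>t. (\<integral>s. ?F t s * \<phi> (?d t) \<partial>\<mu>) \<partial>\<mu>) - (\<integral>t. (\<integral>s. ?F t s * \<phi> (?d s) \<partial>\<mu>) \<partial>\<mu>)
      = (\<integral>t. (\<integral>s. ?F t s * \<phi> (?d t) - ?F t s * \<phi> (?d s) \<partial>\<mu>) \<partial>\<mu>)"
    using int int2 by (simp only: Bochner_Integration.integral_diff)
  also have "\<dots> \<ge> 0"
  proof (intro integral_nonneg_AE AE_I2)
    fix t s
    show "0 \<le> ?F t s * \<phi> (?d t) - ?F t s * \<phi> (?d s)"
    proof (cases "t - s \<le> T t - T s")
      case True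
      then have "\<phi> (?d s) \<le> \<phi> (?d t)" "0 \<le> ?F t s" using monoD[OF mono_h] monoD[OF \<phi>(1)] by auto
      then show ?thesis by (subst diff_ge_0_iff_ge) (rule mult_left_mono)
    next
      case False
      then have "\<phi> (?d t) \<le> \<phi> (?d s)" "?F t s \<le> 0" using monoD[OF mono_h] monoD[OF \<phi>(1)] by auto
      then show ?thesis by (subst diff_ge_0_iff_ge) (rule mult_left_mono_neg)
    qed
  qed
  finally have sum: "0 \<le> (\<integral>t. (\<integral>s. ?F t s * \<phi> (?d t) \<partial>\<mu>) \<partial>\<mu>) - (\<integral>t. (\<integral>s. ?F t s * \<phi> (?d s) \<partial>\<mu>) \<partial>\<mu>)" .
  have half: "0 \<le> x" if "0 \<le> a - y" "x = a" "x = - y" for x a y :: real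
    using that by simp
  show ?thesis by (rule half[OF sum J J'])
qed

end

end

section \<open>Mass bound and uniqueness for the integro-differential equation\<close>

lemma finite_measure_density_lborel:
  fixes \<rho> :: "real \<Rightarrow> real"
  assumes \<rho>: "integrable lborel \<rho>" and nonneg: "\<And>t. \<rho> t \<ge> 0"
  shows "finite_measure (density lborel \<rho>)"
    and "measure (density lborel \<rho>) UNIV = (\<integral>t. \<rho> t \<partial>lborel)"
proof -
  have "emeasure (density lborel \<rho>) UNIV = ennreal (\<integral>t. \<rho> t \<partial>lborel)"
    using \<rho> nonneg by (subst emeasure_density) (auto intro!: nn_integral_eq_integral)
  then show "finite_measure (density lborel \<rho>)" "measure (density lborel \<rho>) UNIV = (\<integral>t. \<rho> t \<partial>lborel)"
    using nonneg by (auto intro!: finite_measureI simp: measure_def integral_nonneg_AE)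
qed

context balanced_kernel
begin

text \<open>Written as an integral against the measure with density \<open>\<rho>\<close>, so that a
  change of variables along a transport map is a pushforward.\<close>

definition potential :: "(real \<Rightarrow> real) \<Rightarrow> real \<Rightarrow> real" where
  "potential \<rho> t = (\<integral>s. h (t - s) \<partial>density lborel \<rho>)"

context
  fixes \<rho> :: "real \<Rightarrow> real"
  assumes \<rho> [measurable]: "integrable lborel \<rho>" and nonneg: "\<And>t. \<rho> t \<ge> 0"
begin

lemma measurable_potential [measurable]: "potential \<rho> \<in> borel_measurable borel"
proof -
  interpret finite_measure "density lborel \<rho>"
    by (rule finite_measure_density_lborel[OF \<rho> nonneg])
  show ?thesis unfolding potential_def by measurable
qed

lemma potential_bounds: "0 \<le> potential \<rho> t" "potential \<rho> t \<le> g * (\<integral>t. \<rho> t \<partial>lborel)"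
  unfolding potential_def
  using integral_h_bounds[OF finite_measure_density_lborel(1)[OF \<rho> nonneg], of "\<lambda>s. t - s"]
    finite_measure_density_lborel(2)[OF \<rho> nonneg]
  by simp_all

lemma integrable_potential: "integrable lborel (\<lambda>t. potential \<rho> t * \<rho> t)"
proof (rule Bochner_Integration.integrable_bound)
  show "integrable lborel (\<lambda>t. g * (\<integral>t. \<rho> t \<partial>lborel) * \<rho> t)" using \<rho> by simp
  show "AE t in lborel. norm (potential \<rho> t * \<rho> t) \<le> norm (g * (\<integral>t. \<rho> t \<partial>lborel) * \<rho> t)"
    using potential_bounds nonneg g_nonneg by (intro AE_I2) (auto simp: abs_mult intro!: mult_right_mono)
qed measurable

lemma integral_potential: "(\<integral>t. potential \<rho> t * \<rho> t \<partial>lborel) = g * (\<integral>t. \<rho> t \<partial>lborel)\<^sup>2 / 2"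
proof -
  have "(\<integral>t. potential \<rho> t \<partial>density lborel \<rho>) = g * (measure (density lborel \<rho>) UNIV)\<^sup>2 / 2"
    unfolding potential_def
    using energy_balanced[OF finite_measure_density_lborel(1)[OF \<rho> nonneg]] by simp
  moreover have "(\<integral>t. potential \<rho> t \<partial>density lborel \<rho>) = (\<integral>t. \<rho> t *\<^sub>R potential \<rho> t \<partial>lborel)"
    using nonneg by (intro integral_density) auto
  ultimately show ?thesis
    by (simp add: finite_measure_density_lborel(2)[OF \<rho> nonneg] mult.commute)
qed

text \<open>Testing the differential inequality with \<open>\<rho>\<close> itself: \<open>w' \<rho>\<close> is the derivative of
  \<open>\<rho> / n\<close> and integrates to zero, and the interaction term is explicit.\<close>

lemma mass_bound:
  fixes w w' :: "real \<Rightarrow> real"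
  assumes w: "\<And>t. (w has_real_derivative w' t) (at t)" and cont: "continuous_on UNIV w'"
    and n: "n > 0" and \<rho>_def: "\<And>t. \<rho> t = exp (n * w t)" and c: "c \<ge> 0"
    and le: "\<And>t. 1 - w' t \<le> c * potential \<rho> t"
    and bot: "(\<rho> \<longlongrightarrow> 0) at_bot"
  defines "M \<equiv> \<integral>t. \<rho> t \<partial>lborel"
  shows "M \<le> c * g * M\<^sup>2 / 2"
    and "M = c * g * M\<^sup>2 / 2 \<Longrightarrow> AE t in lborel. w' t = 1 - c * potential \<rho> t"
proof -
  have pos: "\<rho> t > 0" for t by (simp add: \<rho>_def)
  have d\<rho>: "(\<rho> has_real_derivative n * w' t * \<rho> t) (at t)" for t
    unfolding \<rho>_def[abs_def] by (auto intro!: derivative_eq_intros w)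
  have cont\<rho>: "continuous_on UNIV \<rho>"
    using d\<rho> by (intro DERIV_continuous_on) (auto intro: DERIV_subset)
  obtain b where b: "filterlim b at_top sequentially" "(\<lambda>k. \<rho> (b k)) \<longlonglongrightarrow> 0"
    using integrable_nonneg_small_values[OF \<rho> nonneg] by blast
  have a: "filterlim (\<lambda>k. - real k) at_bot sequentially"
    by (simp add: filterlim_uminus_at_bot filterlim_real_sequentially)
  let ?f = "\<lambda>t. c * (potential \<rho> t * \<rho> t) - \<rho> t"
  \<comment> \<open>The defect of the differential inequality weighted with \<open>\<rho>\<close>;
    it is \<open>?f\<close> plus w' \<open>\<rho>\<close>. Integrability on the whole line is
    available for \<open>?f\<close> only, so the defect is integrated over bounded windows.\<close>
  let ?q = "\<lambda>t. (w' t - (1 - c * potential \<rho> t)) * \<rho> t"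
  let ?L = "c * g * M\<^sup>2 / 2 - M"
  have f: "integrable lborel ?f" using integrable_potential \<rho> by simp
  have f_int: "(\<integral>t. ?f t \<partial>lborel) = ?L"
    using integrable_potential \<rho> integral_potential by (simp add: M_def)
  have q_nonneg: "?q t \<ge> 0" for t using le[of t] pos[of t] by simp
  have [measurable]: "w' \<in> borel_measurable borel"
    by (rule borel_measurable_continuous_onI[OF cont])
  have int_dw: "integrable lborel (\<lambda>t. indicator {x..y} t * (w' t * \<rho> t))" for x y
    using borel_integrable_atLeastAtMost'[of x y "\<lambda>t. w' t * \<rho> t"]
      continuous_on_subset[OF continuous_on_mult[OF cont cont\<rho>], of "{x..y}"]
    by (simp add: set_integrable_def)
  have int_f: "integrable lborel (\<lambda>t. indicator {x..y} t * ?f t)" for x y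
    using integrable_mult_indicator[OF _ f, of "{x..y}"] by simp
  have q_eq: "indicator {x..y} t * ?q t = indicator {x..y} t * ?f t + indicator {x..y} t * (w' t * \<rho> t)" for x y t
    by (simp add: algebra_simps)
  have int_q: "integrable lborel (\<lambda>t. indicator {x..y} t * ?q t)" for x y
    unfolding q_eq using int_f int_dw by (rule Bochner_Integration.integrable_add)
  have integral_q: "(\<integral>t. indicator {x..y} t * ?q t \<partial>lborel) =
      (\<integral>t. indicator {x..y} t * ?f t \<partial>lborel) + (\<rho> y - \<rho> x) / n" if "x \<le> y" for x y
  proof -
    have "(\<integral>t. indicator {x..y} t * (w' t * \<rho> t) \<partial>lborel) = \<rho> y / n - \<rho> x / n"
    proof -
      have "((\<lambda>t. \<rho> t / n) has_real_derivative w' t * \<rho> t) (at t)" for t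
        using DERIV_cdivide[OF d\<rho>[of t], of n] n by (simp add: mult.assoc)
      then have "((\<lambda>t. w' t * \<rho> t) has_integral (\<rho> y / n - \<rho> x / n)) {x..y}"
        using that by (intro fundamental_theorem_of_calculus)
          (auto simp: has_real_derivative_iff_has_vector_derivative[symmetric] intro: DERIV_subset)
      then have "integral {x..y} (\<lambda>t. w' t * \<rho> t) = \<rho> y / n - \<rho> x / n" by (rule integral_unique)
      then show ?thesis
        using set_borel_integral_eq_integral(2)[of "{x..y}" "\<lambda>t. w' t * \<rho> t"] int_dw[of x y]
        by (simp add: set_integrable_def set_lebesgue_integral_def)
    qed
    then show ?thesis
      unfolding q_eq using int_f int_dw by (subst Bochner_Integration.integral_add) (auto simp: diff_divide_distrib)
  qed
  have lim: "(\<lambda>k. (\<integral>t. indicator {- real k..b k} t * ?f t \<partial>lborel) + (\<rho> (b k) - \<rho> (- real k)) / n) \<longlonglongrightarrow> ?L + (0 - 0) / n"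
    using n unfolding f_int[symmetric]
    by (intro tendsto_intros tendsto_integral_expanding_intervals[OF f a b(1)] b filterlim_compose[OF bot a]) auto
  \<comment> \<open>The defect is nonnegative, so a fixed window carries at most as much of it as
    [-k, b k] for large k. The latter integrals tend to \<open>?L\<close>: the boundary terms vanish
    on the left by \<open>bot\<close> and on the right by the choice of b.\<close>
  have main: "(\<integral>t. indicator {- A..A} t * ?q t \<partial>lborel) \<le> ?L" for A
  proof (rule tendsto_lowerbound[of _ "?L + (0 - 0) / n", simplified], rule lim[simplified])
    have "\<forall>\<^sub>F k in sequentially. - real k \<le> - \<bar>A\<bar>" using a unfolding filterlim_at_bot by blast
    moreover have "\<forall>\<^sub>F k in sequentially. \<bar>A\<bar> \<le> b k" using b unfolding filterlim_at_top by blast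
    ultimately show "\<forall>\<^sub>F k in sequentially. (\<integral>t. indicator {- A..A} t * ?q t \<partial>lborel) \<le>
        (\<integral>t. indicator {- real k..b k} t * ?f t \<partial>lborel) + (\<rho> (b k) - \<rho> (- real k)) / n"
    proof eventually_elim
      case (elim k)
      have "(\<integral>t. indicator {- A..A} t * ?q t \<partial>lborel) \<le> (\<integral>t. indicator {- real k..b k} t * ?q t \<partial>lborel)"
        by (intro integral_mono int_q mult_right_mono q_nonneg) (use elim in \<open>auto simp: indicator_def\<close>)
      also have "\<dots> = (\<integral>t. indicator {- real k..b k} t * ?f t \<partial>lborel) + (\<rho> (b k) - \<rho> (- real k)) / n"
        by (rule integral_q) (use elim in auto)
      finally show ?case .
    qed
  qed simp
  have q0: "0 \<le> (\<integral>t. indicator {- A..A} t * ?q t \<partial>lborel)" for A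
    by (intro integral_nonneg_AE AE_I2 mult_nonneg_nonneg q_nonneg) auto
  show "M \<le> c * g * M\<^sup>2 / 2" using main[of 0] q0[of 0] by linarith
  \<comment> \<open>Now \<open>?L = 0\<close>, so no window carries any defect; positivity of
    \<open>\<rho>\<close> leaves the equation almost everywhere.\<close>
  assume eq: "M = c * g * M\<^sup>2 / 2"
  have "(\<integral>t. indicator {- A..A} t * ?q t \<partial>lborel) = 0" for A
    using main[of A] q0[of A] eq by linarith
  then have "AE t in lborel. indicator {- A..A} t * ?q t = 0" for A
    using integral_nonneg_eq_0_iff_AE[OF int_q, of "- A" A] q_nonneg by auto
  then have "AE t in lborel. \<forall>k::nat. indicator {- real k..real k} t * ?q t = 0"
    by (subst AE_all_countable) (rule allI)
  then show "AE t in lborel. w' t = 1 - c * potential \<rho> t"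
  proof eventually_elim
    case (elim t)
    obtain k :: nat where "\<bar>t\<bar> \<le> real k" using real_arch_simple by blast
    then have "t \<in> {- real k..real k}" by auto
    with spec[OF elim, of k] pos[of t] show ?case by simp
  qed
qed

end


text \<open>Two solutions of the same mass: with \<open>T\<close> transporting one to the other, the equations
  are subtracted along \<open>T\<close> and tested with \<open>arctan (T t - t)\<close>. The interaction term is
  monotone under transport and the remaining term is minus a square, so \<open>T' = 1\<close>.\<close>

lemma unique_up_to_translation:
  fixes w1 w1' w2 w2' \<rho>1 \<rho>2 :: "real \<Rightarrow> real"
  assumes w1: "\<And>t. (w1 has_real_derivative w1' t) (at t)" and cont1: "continuous_on UNIV w1'"
    and w2: "\<And>t. (w2 has_real_derivative w2' t) (at t)" and cont2: "continuous_on UNIV w2'"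
    and n: "n > 0" and c: "c \<ge> 0"
    and \<rho>1_def: "\<And>t. \<rho>1 t = exp (n * w1 t)" and \<rho>2_def: "\<And>t. \<rho>2 t = exp (n * w2 t)"
    and \<rho>1: "integrable lborel \<rho>1" and \<rho>2: "integrable lborel \<rho>2"
    and mass: "(\<integral>t. \<rho>1 t \<partial>lborel) = (\<integral>t. \<rho>2 t \<partial>lborel)"
    and eq1: "AE t in lborel. w1' t = 1 - c * potential \<rho>1 t"
    and eq2: "\<And>t. w2' t = 1 - c * potential \<rho>2 t"
    and bot1: "(\<rho>1 \<longlongrightarrow> 0) at_bot" and bot2: "(\<rho>2 \<longlongrightarrow> 0) at_bot" and top2: "(\<rho>2 \<longlongrightarrow> 0) at_top"
  obtains d where "\<And>t. w1 t = w2 (t + d)"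
proof -
  have pos1: "\<rho>1 t > 0" and pos2: "\<rho>2 t > 0" for t by (simp_all add: \<rho>1_def \<rho>2_def)
  have nn1: "\<rho>1 t \<ge> 0" and nn2: "\<rho>2 t \<ge> 0" for t using pos1[of t] pos2[of t] by simp_all
  have d\<rho>1: "(\<rho>1 has_real_derivative n * w1' t * \<rho>1 t) (at t)" for t
    unfolding \<rho>1_def[abs_def] by (auto intro!: derivative_eq_intros w1)
  have d\<rho>2: "(\<rho>2 has_real_derivative n * w2' t * \<rho>2 t) (at t)" for t
    unfolding \<rho>2_def[abs_def] by (auto intro!: derivative_eq_intros w2)
  have cont\<rho>1: "continuous_on UNIV \<rho>1" and cont\<rho>2: "continuous_on UNIV \<rho>2"
    using d\<rho>1 d\<rho>2 by (auto intro!: DERIV_continuous_on intro: DERIV_subset)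
  define M where "M = (\<integral>t. \<rho>1 t \<partial>lborel)"
  obtain F1 where F1: "\<And>t. (F1 has_real_derivative \<rho>1 t) (at t)" "(F1 \<longlongrightarrow> 0) at_bot" "(F1 \<longlongrightarrow> M) at_top"
    by (rule ex_antiderivative_lborel[OF cont\<rho>1 \<rho>1, folded M_def]) (rule that; simp)
  obtain F2 where F2: "\<And>t. (F2 has_real_derivative \<rho>2 t) (at t)" "(F2 \<longlongrightarrow> 0) at_bot" "(F2 \<longlongrightarrow> M) at_top"
    by (rule ex_antiderivative_lborel[OF cont\<rho>2 \<rho>2, folded mass M_def]) (rule that; simp)
  have mono: "strict_mono F" if "\<And>t. (F has_real_derivative f t) (at t)" "\<And>t. f t > 0" for F f :: "real \<Rightarrow> real"
  proof (rule strict_monoI)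
    fix x y :: real assume "x < y"
    then show "F x < F y" by (rule DERIV_pos_imp_increasing) (use that in blast)
  qed
  have mono1: "strict_mono F1" and mono2: "strict_mono F2"
    using mono[OF F1(1) pos1] mono[OF F2(1) pos2] by auto
  have range: "0 < F t \<and> F t < M" if "strict_mono F" "(F \<longlongrightarrow> 0) at_bot" "(F \<longlongrightarrow> M) at_top" for F and t :: real
  proof
    have "0 \<le> F (t - 1)"
      by (rule tendsto_upperbound[OF that(2)])
        (use strict_mono_less_eq[OF that(1)] in \<open>auto intro: eventually_mono[OF eventually_le_at_bot[of "t - 1"]]\<close>)
    then show "0 < F t" using strict_monoD[OF that(1), of "t - 1" t] by simp
    have "F (t + 1) \<le> M"
      by (rule tendsto_lowerbound[OF that(3)])
        (use strict_mono_less_eq[OF that(1)] in \<open>auto intro: eventually_mono[OF eventually_ge_at_top[of "t + 1"]]\<close>)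
    then show "F t < M" using strict_monoD[OF that(1), of t "t + 1"] by simp
  qed
  have surj: "\<exists>x. F x = m" if "\<And>t. isCont F t" "(F \<longlongrightarrow> 0) at_bot" "(F \<longlongrightarrow> M) at_top" "0 < m" "m < M" for F :: "real \<Rightarrow> real" and m
  proof -
    have "\<forall>\<^sub>F t in at_bot. F t < m" "\<forall>\<^sub>F t in at_top. m < F t"
      using that by (auto intro: order_tendstoD)
    then obtain a b where a: "\<And>t. t \<le> a \<Longrightarrow> F t < m" and b: "\<And>t. t \<ge> b \<Longrightarrow> m < F t"
      by (auto simp: eventually_at_bot_linorder eventually_at_top_linorder)
    have "\<exists>x\<ge>min a b. x \<le> b \<and> F x = m"
      by (rule IVT) (use that a[of "min a b"] b[of b] in \<open>auto intro: less_imp_le\<close>)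
    then show ?thesis by blast
  qed
  have isCont1: "isCont F1 t" and isCont2: "isCont F2 t" for t
    using F1(1) F2(1) by (auto intro: DERIV_isCont)
  \<comment> \<open>The quantile function of \<open>\<rho>2\<close>, meaningful on (0, M), where all
    values of \<open>F1\<close> lie.\<close>
  define G where "G m = (THE x. F2 x = m)" for m
  have G: "G (F2 x) = x" for x
    unfolding G_def using strict_mono_eq[OF mono2] by auto
  have FG: "F2 (G m) = m" if "0 < m" "m < M" for m
    using surj[OF isCont2 F2(2,3) that] G by metis
  have dG: "(G has_real_derivative inverse (\<rho>2 (G m))) (at m)" if "0 < m" "m < M" for m
  proof (rule DERIV_inverse_function[where f = F2 and a = 0 and b = M])
    have "isCont G (F2 (G m))"
      by (rule isCont_inverse_function[where d = 1]) (auto simp: G isCont2)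
    then show "isCont G m" using FG that by simp
  qed (use F2(1) pos2[of "G m"] FG that in auto)
  \<comment> \<open>The monotone transport: \<open>\<rho>2\<close> has as much mass to the left of T
    t as \<open>\<rho>1\<close> to the left of t.\<close>
  define T where "T t = G (F1 t)" for t
  have T: "F2 (T t) = F1 t" for t
    unfolding T_def using range[OF mono1 F1(2,3)] by (intro FG) auto
  define T' where "T' t = \<rho>1 t / \<rho>2 (T t)" for t
  have dT: "(T has_real_derivative T' t) (at t)" for t
  proof -
    have "(G has_real_derivative inverse (\<rho>2 (T t))) (at (F1 t))"
      unfolding T_def using range[OF mono1 F1(2,3)] by (intro dG) auto
    from DERIV_chain2[OF this F1(1)] show ?thesis
      unfolding T_def T'_def by (simp add: divide_inverse mult.commute)
  qed
  have contT: "continuous_on UNIV T" using dT by (intro DERIV_continuous_on) (auto intro: DERIV_subset)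
  have [measurable]: "T \<in> borel_measurable borel" by (rule borel_measurable_continuous_onI[OF contT])
  have T_surj: "\<exists>s. F1 s = F2 x" for x
    using range[OF mono2 F2(2,3)] by (intro surj[OF isCont1 F1(2,3)]) auto
  have T_less: "x < T t \<longleftrightarrow> F2 x < F1 t" for x t
    using strict_mono_less[OF mono2, of x "T t"] T by simp
  have T_bot: "filterlim T at_bot at_bot" unfolding filterlim_at_bot
  proof
    fix x
    obtain s where s: "F1 s = F2 x" using T_surj by blast
    have "T t \<le> x" if "t \<le> s" for t
      using that s T_less[of x t] strict_mono_less_eq[OF mono1, of t s] by simp
    then show "\<forall>\<^sub>F t in at_bot. T t \<le> x" by (auto simp: eventually_at_bot_linorder)
  qed
  have T_top: "filterlim T at_top at_top" unfolding filterlim_at_top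
  proof
    fix x
    obtain s where s: "F1 s = F2 x" using T_surj by blast
    have "x \<le> T t" if "t \<ge> s" for t
      using that s T strict_mono_less_eq[OF mono1, of s t] strict_mono_less_eq[OF mono2, of x "T t"] by simp
    then show "\<forall>\<^sub>F t in at_top. x \<le> T t" by (auto simp: eventually_at_top_linorder)
  qed
  let ?\<mu> = "density lborel \<rho>1"
  have \<mu>: "finite_measure ?\<mu>" by (rule finite_measure_density_lborel[OF \<rho>1 nn1])
  have tail: "emeasure (density lborel \<rho>) {x<..} = ennreal (M - F x)"
    if "\<And>t. (F has_real_derivative \<rho> t) (at t)" "(F \<longlongrightarrow> M) at_top" "\<And>t. \<rho> t \<ge> 0"
      "integrable lborel \<rho>" for \<rho> F :: "real \<Rightarrow> real" and x
  proof -
    have "emeasure (density lborel \<rho>) {x<..} = (\<integral>\<^sup>+t. ennreal (\<rho> t) * indicator {x<..} t \<partial>lborel)"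
      using that(4) by (intro emeasure_density) auto
    also have "\<dots> = (\<integral>\<^sup>+t. ennreal (\<rho> t) * indicator {x..} t \<partial>lborel)"
      by (rule nn_integral_cong_AE) (use AE_lborel_singleton[of x] in \<open>eventually_elim, auto simp: indicator_def\<close>)
    also have "\<dots> = ennreal (M - F x)"
      by (rule nn_integral_FTC_atLeast) (use that in \<open>auto simp: borel_measurable_integrable\<close>)
    finally show ?thesis .
  qed
  have push: "distr ?\<mu> borel T = density lborel \<rho>2"
  proof (rule measure_eqI_lessThan)
    fix x
    obtain s where s: "F1 s = F2 x" using T_surj by blast
    have "T -` {x<..} = {s<..}"
      using T_less strict_mono_less[OF mono1, of s] s by auto
    then have e: "emeasure (distr ?\<mu> borel T) {x<..} = ennreal (M - F1 s)"
      using tail[OF F1(1,3) nn1 \<rho>1] by (subst emeasure_distr) auto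
    then show "emeasure (distr ?\<mu> borel T) {x<..} = emeasure (density lborel \<rho>2) {x<..}"
      using tail[OF F2(1,3) nn2 \<rho>2] s by simp
    show "emeasure (distr ?\<mu> borel T) {x<..} < \<infinity>" using e by simp
  qed auto
  have pot2: "potential \<rho>2 (T t) = (\<integral>s. h (T t - T s) \<partial>?\<mu>)" for t
    unfolding potential_def push[symmetric] by (rule integral_distr) auto
  \<comment> \<open>Two forms of the tested difference of the equations. \<open>p\<close> is
    continuous and has a classical primitive; \<open>p2\<close> agrees with it almost everywhere and
    is the form whose size and sign the interaction estimates control.\<close>
  define p where "p t = n * (w2' (T t) - w1' t) * \<rho>1 t * arctan (T t - t)" for t
  define p2 where "p2 t = - (n * c) * (\<rho>1 t * ((\<integral>s. h (T t - T s) - h (t - s) \<partial>?\<mu>) * arctan (T t - t)))" for t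
  have AEp: "AE t in lborel. p t = p2 t"
    using eq1
  proof eventually_elim
    case (elim t)
    have "w2' (T t) - w1' t = - c * (\<integral>s. h (T t - T s) - h (t - s) \<partial>?\<mu>)"
      unfolding elim eq2 pot2
      by (subst Bochner_Integration.integral_diff)
        (auto intro!: integrable_h[OF \<mu>] simp: potential_def algebra_simps)
    then show ?case unfolding p_def p2_def by simp
  qed
  have contp: "continuous_on UNIV p"
    unfolding p_def
    by (intro continuous_intros continuous_on_compose2[OF cont2] contT cont1 cont\<rho>1) auto
  have [measurable]: "\<rho>1 \<in> borel_measurable borel" "p \<in> borel_measurable borel"
    using contp cont\<rho>1 by (auto intro: borel_measurable_continuous_onI)
  interpret finite_measure ?\<mu> by (rule \<mu>)
  have [measurable]: "(arctan :: real \<Rightarrow> real) \<in> borel_measurable borel"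
    by (intro borel_measurable_continuous_onI continuous_intros)
  have [measurable]: "p2 \<in> borel_measurable borel" unfolding p2_def by measurable
  have atn: "\<bar>arctan x\<bar> \<le> pi / 2" for x
    using arctan_bounded[of x] by linarith
  have inth: "\<bar>\<integral>s. h (T t - T s) - h (t - s) \<partial>?\<mu>\<bar> \<le> g * M" for t
  proof -
    have "(\<integral>s. h (T t - T s) - h (t - s) \<partial>?\<mu>) = (\<integral>s. h (T t - T s) \<partial>?\<mu>) - (\<integral>s. h (t - s) \<partial>?\<mu>)"
      by (subst Bochner_Integration.integral_diff) (auto intro!: integrable_h[OF \<mu>])
    moreover have "measure ?\<mu> (space ?\<mu>) = M"
      using finite_measure_density_lborel(2)[OF \<rho>1 nn1] by (simp add: M_def)
    ultimately show ?thesis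
      using integral_h_bounds[OF \<mu>, of "\<lambda>s. T t - T s"] integral_h_bounds[OF \<mu>, of "\<lambda>s. t - s"]
      by (simp add: abs_le_iff)
  qed
  have gM: "0 \<le> g * M" using inth[of 0] by linarith
  have intp: "integrable lborel p"
  proof -
    have "integrable lborel p2"
    proof (rule Bochner_Integration.integrable_bound)
      show "integrable lborel (\<lambda>t. n * c * (g * M * (pi / 2)) * \<rho>1 t)" using \<rho>1 by simp
      have "norm (p2 t) \<le> norm (n * c * (g * M * (pi / 2)) * \<rho>1 t)" for t
      proof -
        have "\<bar>(\<integral>s. h (T t - T s) - h (t - s) \<partial>?\<mu>) * arctan (T t - t)\<bar> \<le> g * M * (pi / 2)"
          unfolding abs_mult using inth atn gM by (intro mult_mono) auto
        then have "(n * c * \<rho>1 t) * \<bar>(\<integral>s. h (T t - T s) - h (t - s) \<partial>?\<mu>) * arctan (T t - t)\<bar> \<le> (n * c * \<rho>1 t) * (g * M * (pi / 2))"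
          using n c nn1 by (intro mult_left_mono) auto
        moreover have "\<bar>n * c * \<rho>1 t\<bar> = n * c * \<rho>1 t" using n c nn1[of t] by simp
        moreover have "p2 t = - (n * c * \<rho>1 t) * ((\<integral>s. h (T t - T s) - h (t - s) \<partial>?\<mu>) * arctan (T t - t))"
          unfolding p2_def by (simp only: mult.assoc mult_minus_left)
        ultimately have "\<bar>p2 t\<bar> \<le> (n * c * \<rho>1 t) * (g * M * (pi / 2))"
          by (simp only: abs_mult abs_minus_cancel)
        then show ?thesis by (simp only: real_norm_def ac_simps)
      qed
      then show "AE t in lborel. norm (p2 t) \<le> norm (n * c * (g * M * (pi / 2)) * \<rho>1 t)" by simp
    qed measurable
    then show ?thesis using AEp by (subst integrable_cong_AE[of p _ p2]) auto
  qed
  have p_le: "(\<integral>t. p t \<partial>lborel) \<le> 0"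
  proof -
    let ?k = "\<lambda>t. (\<integral>s. h (T t - T s) - h (t - s) \<partial>?\<mu>) * arctan (T t - t)"
    have "(\<integral>t. p t \<partial>lborel) = (\<integral>t. p2 t \<partial>lborel)"
      using AEp by (intro integral_cong_AE) auto
    also have "\<dots> = - (n * c) * (\<integral>t. \<rho>1 t * ?k t \<partial>lborel)"
      unfolding p2_def by (rule integral_mult_right_zero)
    also have "(\<integral>t. \<rho>1 t * ?k t \<partial>lborel) = (\<integral>t. ?k t \<partial>?\<mu>)"
      using nn1 by (subst integral_density) auto
    finally have e: "(\<integral>t. p t \<partial>lborel) = - (n * c) * (\<integral>t. ?k t \<partial>?\<mu>)" .
    have "0 \<le> (\<integral>t. ?k t \<partial>?\<mu>)"
      by (rule energy_transport_nonneg[OF \<mu> _ _ _ atn]) (auto intro!: monoI arctan_monotone')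
    then show ?thesis unfolding e using n c by (simp add: mult_nonneg_nonneg)
  qed
  obtain P where P: "\<And>t. (P has_real_derivative p t) (at t)" "(P \<longlongrightarrow> 0) at_bot" "(P \<longlongrightarrow> (\<integral>t. p t \<partial>lborel)) at_top"
    by (rule ex_antiderivative_lborel[OF contp intp]) (rule that; simp)
  \<comment> \<open>Because \<rho>2(T) T' = \<rho>1, the derivative of \<rho>2(T) - \<rho>1 is n
    (w2'(T) - w1') \<rho>1. Subtracting P thus cancels the term with arctan, and what is left is
    (\<rho>2(T) - \<rho>1)(T' - 1) / (1 + (T - t)^2), minus a square.\<close>
  define D where "D t = (\<rho>2 (T t) - \<rho>1 t) * arctan (T t - t) - P t" for t
  define D' where "D' t = - (\<rho>2 (T t) * (T' t - 1)\<^sup>2 / (1 + (T t - t)\<^sup>2))" for t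
  have \<rho>1T: "\<rho>1 t = \<rho>2 (T t) * T' t" for t
    unfolding T'_def using pos2[of "T t"] by simp
  have dD: "(D has_real_derivative D' t) (at t)" for t
  proof -
    have "((\<lambda>t. \<rho>2 (T t)) has_real_derivative n * w2' (T t) * \<rho>2 (T t) * T' t) (at t)"
      by (rule DERIV_chain2[OF d\<rho>2 dT])
    moreover have "((\<lambda>t. arctan (T t - t)) has_real_derivative inverse (1 + (T t - t)\<^sup>2) * (T' t - 1)) (at t)"
      by (rule DERIV_chain2[OF DERIV_arctan DERIV_diff[OF dT DERIV_ident]])
    ultimately have "(D has_real_derivative (n * w2' (T t) * \<rho>2 (T t) * T' t - n * w1' t * \<rho>1 t) * arctan (T t - t)
        + inverse (1 + (T t - t)\<^sup>2) * (T' t - 1) * (\<rho>2 (T t) - \<rho>1 t) - p t) (at t)"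
      unfolding D_def by (intro DERIV_diff DERIV_mult d\<rho>1 P(1))
    moreover have "(n * w2' (T t) * \<rho>2 (T t) * T' t - n * w1' t * \<rho>1 t) * arctan (T t - t)
        + inverse (1 + (T t - t)\<^sup>2) * (T' t - 1) * (\<rho>2 (T t) - \<rho>1 t) - p t = D' t"
      unfolding D'_def p_def \<rho>1T by (simp add: algebra_simps power2_eq_square divide_inverse)
    ultimately show ?thesis by simp
  qed
  have D'_le: "D' t \<le> 0" for t
    unfolding D'_def using nn2 by (auto intro!: divide_nonneg_nonneg mult_nonneg_nonneg)
  have D_anti: "D t \<le> D s" if "s \<le> t" for s t
    by (rule DERIV_nonpos_imp_nonincreasing[OF that]) (use dD D'_le in blast)
  have null: "(\<lambda>k. (\<rho>2 (T (x k)) - \<rho>1 (x k)) * arctan (T (x k) - x k)) \<longlonglongrightarrow> 0"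
    if "(\<lambda>k. \<rho>2 (T (x k))) \<longlonglongrightarrow> 0" "(\<lambda>k. \<rho>1 (x k)) \<longlonglongrightarrow> 0" for x :: "nat \<Rightarrow> real"
  proof (rule Lim_null_comparison)
    show "(\<lambda>k. \<bar>\<rho>2 (T (x k)) - \<rho>1 (x k)\<bar> * (pi / 2)) \<longlonglongrightarrow> 0"
      using tendsto_mult_left_zero[OF tendsto_rabs_zero[OF tendsto_diff[OF that, simplified]]] by simp
    show "\<forall>\<^sub>F k in sequentially. norm ((\<rho>2 (T (x k)) - \<rho>1 (x k)) * arctan (T (x k) - x k)) \<le> \<bar>\<rho>2 (T (x k)) - \<rho>1 (x k)\<bar> * (pi / 2)"
      by (intro always_eventually allI) (simp only: real_norm_def abs_mult mult_left_mono[OF atn abs_ge_zero])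
  qed
  \<comment> \<open>D is nonincreasing and tends to 0 at -infinity; along a sequence going to
    infinity it tends to minus the integral of p, which is \<ge> 0. So it is squeezed to 0.\<close>
  have D0: "D t = 0" for t
  proof (rule antisym)
    have a: "filterlim (\<lambda>k. - real k) at_bot sequentially"
      by (simp add: filterlim_uminus_at_bot filterlim_real_sequentially)
    have "(\<lambda>k. D (- real k)) \<longlonglongrightarrow> 0 - 0"
      unfolding D_def
      by (intro tendsto_diff null filterlim_compose[OF bot2 filterlim_compose[OF T_bot a]]
          filterlim_compose[OF bot1 a] filterlim_compose[OF P(2) a])
    then have "(\<lambda>k. D (- real k)) \<longlonglongrightarrow> 0" by simp
    then show "D t \<le> 0"
    proof (rule tendsto_lowerbound)
      have "\<forall>\<^sub>F k in sequentially. - real k \<le> t" using a unfolding filterlim_at_bot by blast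
      then show "\<forall>\<^sub>F k in sequentially. D t \<le> D (- real k)" by eventually_elim (rule D_anti)
    qed simp
    obtain b where b: "filterlim b at_top sequentially" "(\<lambda>k. \<rho>1 (b k)) \<longlonglongrightarrow> 0"
      by (rule integrable_nonneg_small_values[OF \<rho>1 nn1])
    have "(\<lambda>k. D (b k)) \<longlonglongrightarrow> 0 - (\<integral>t. p t \<partial>lborel)"
      unfolding D_def
      by (intro tendsto_diff null filterlim_compose[OF top2 filterlim_compose[OF T_top b(1)]]
          b(2) filterlim_compose[OF P(3) b(1)])
    then have "0 - (\<integral>t. p t \<partial>lborel) \<le> D t"
    proof (rule tendsto_upperbound)
      have "\<forall>\<^sub>F k in sequentially. t \<le> b k" using b(1) unfolding filterlim_at_top by blast
      then show "\<forall>\<^sub>F k in sequentially. D (b k) \<le> D t" by eventually_elim (rule D_anti)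
    qed simp
    then show "0 \<le> D t" using p_le by linarith
  qed
  have T'1: "T' t = 1" for t
  proof -
    have "D = (\<lambda>t. 0)" using D0 by auto
    then have "D' t = 0" using DERIV_unique[OF dD[of t]] DERIV_const by metis
    then show ?thesis using pos2[of "T t"] by (simp add: D'_def add_nonneg_eq_0_iff)
  qed
  have "((\<lambda>t. T t - t) has_real_derivative 0) (at t)" for t
    using DERIV_diff[OF dT[of t] DERIV_ident] T'1 by simp
  then have const: "T t - t = T 0 - 0" for t
    by (intro DERIV_isconst_all[of "\<lambda>t. T t - t"]) auto
  show ?thesis
  proof (rule that[of "T 0"])
    fix t
    have "\<rho>1 t = \<rho>2 (T t)" using \<rho>1T[of t] T'1[of t] by simp
    moreover have "T t = t + T 0" using const[of t] by simp
    ultimately show "w1 t = w2 (t + T 0)" using n by (simp add: \<rho>1_def \<rho>2_def)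
  qed
qed

end

section \<open>Radial functions in logarithmic coordinates\<close>

lemma partial_deriv_eq: "(f has_derivative f') (at x) \<Longrightarrow> partial_deriv b f x = f' b"
  unfolding partial_deriv_def using frechet_derivative_at by metis

lemma C_k_add: "C_k k f \<Longrightarrow> C_k k g \<Longrightarrow> C_k k (\<lambda>x. f x + g x)"
proof (induction k arbitrary: f g)
  case (Suc k)
  have "partial_deriv b (\<lambda>x. f x + g x) = (\<lambda>x. partial_deriv b f x + partial_deriv b g x)" for b
  proof
    fix x
    have "(f has_derivative frechet_derivative f (at x)) (at x)" "(g has_derivative frechet_derivative g (at x)) (at x)"
      using Suc.prems by (auto simp: frechet_derivative_works[symmetric])
    from has_derivative_add[OF this]
    show "partial_deriv b (\<lambda>x. f x + g x) x = partial_deriv b f x + partial_deriv b g x"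
      by (simp add: partial_deriv_eq) (simp add: partial_deriv_def)
  qed
  with Suc show ?case by auto
qed (auto intro: continuous_intros)

lemma C_k_uminus: "C_k k f \<Longrightarrow> C_k k (\<lambda>x. - f x)"
proof (induction k arbitrary: f)
  case (Suc k)
  have "partial_deriv b (\<lambda>x. - f x) = (\<lambda>x. - partial_deriv b f x)" for b
  proof
    fix x
    have "(f has_derivative frechet_derivative f (at x)) (at x)"
      using Suc.prems by (auto simp: frechet_derivative_works[symmetric])
    from has_derivative_minus[OF this]
    show "partial_deriv b (\<lambda>x. - f x) x = - partial_deriv b f x"
      by (simp add: partial_deriv_eq) (simp add: partial_deriv_def)
  qed
  with Suc show ?case by auto
qed (auto intro: continuous_intros)

lemma C_k_const: "C_k k (\<lambda>x. c)"
proof (induction k arbitrary: c)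
  case (Suc k)
  have "partial_deriv b (\<lambda>x. c) = (\<lambda>x. 0)" for b :: 'a
    by (auto simp: fun_eq_iff intro: partial_deriv_eq[OF has_derivative_const])
  with Suc show ?case by auto
qed simp

lemma C_k_sum: "finite A \<Longrightarrow> (\<And>i. i \<in> A \<Longrightarrow> C_k k (f i)) \<Longrightarrow> C_k k (\<lambda>x. \<Sum>i\<in>A. f i x)"
proof (induction A rule: finite_induct)
  case empty
  show ?case by (simp add: C_k_const)
next
  case (insert i A)
  have "C_k k (\<lambda>x. f i x + (\<Sum>i\<in>A. f i x))"
    by (intro C_k_add insert.IH insert.prems) auto
  with insert.hyps show ?case by simp
qed

lemma C_infinityD: "C_infinity f \<Longrightarrow> C_k k f"
  unfolding C_infinity_def by simp

lemma C_infinity_differentiable: "C_infinity f \<Longrightarrow> f differentiable at x"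
  using C_infinityD[of f "Suc 0"] by simp

lemma C_infinity_continuous: "C_infinity f \<Longrightarrow> continuous_on UNIV f"
  using C_infinityD[of f 0] by simp

lemma C_infinity_partial_deriv: "C_infinity f \<Longrightarrow> b \<in> Basis \<Longrightarrow> C_infinity (partial_deriv b f)"
  unfolding C_infinity_def[of "partial_deriv b f"] using C_infinityD[of f "Suc k" for k] by simp

lemma C_infinity_minus_laplacian:
  assumes "C_infinity f"
  shows "C_infinity (\<lambda>x. - laplacian f x)"
proof -
  have "C_k k (partial_deriv b (partial_deriv b f))" if "b \<in> Basis" for k b
    by (intro C_infinityD C_infinity_partial_deriv assms that)
  then show ?thesis
    unfolding C_infinity_def laplacian_def by (intro allI C_k_uminus C_k_sum finite_Basis)
qed

section \<open>Radial functions along a ray\<close>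

definition axis0 :: "'a::euclidean_space" where
  "axis0 = (SOME b. b \<in> Basis)"

lemma axis0_Basis: "axis0 \<in> Basis"
  unfolding axis0_def by (rule SOME_Basis)

lemma norm_axis0 [simp]: "norm (axis0 :: 'a::euclidean_space) = 1"
  by (rule norm_Basis[OF axis0_Basis])

lemma axis0_nonzero [simp]: "(axis0 :: 'a::euclidean_space) \<noteq> 0"
  using norm_axis0[where 'a = 'a] by (auto simp del: norm_axis0)

definition log_profile :: "('a::euclidean_space \<Rightarrow> real) \<Rightarrow> real \<Rightarrow> real" where
  "log_profile f t = f (exp t *\<^sub>R axis0)"

text \<open>The derivative r df/dr of the profile, written with a partial derivative so that the
  smoothness of f can be applied to it again.\<close>

definition log_profile_deriv :: "('a::euclidean_space \<Rightarrow> real) \<Rightarrow> real \<Rightarrow> real" where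
  "log_profile_deriv f t = exp t * partial_deriv axis0 f (exp t *\<^sub>R axis0)"

lemma has_real_derivative_log_profile:
  assumes "f differentiable at (exp t *\<^sub>R axis0)"
  shows "(log_profile f has_real_derivative log_profile_deriv f t) (at t)"
proof -
  let ?D = "frechet_derivative f (at (exp t *\<^sub>R axis0))"
  have f: "(f has_derivative ?D) (at (exp t *\<^sub>R axis0))"
    using assms by (simp add: frechet_derivative_works)
  have "((\<lambda>t. exp t *\<^sub>R (axis0::'a)) has_derivative (\<lambda>h. (exp t * h) *\<^sub>R axis0)) (at t)"
    by (auto intro!: derivative_eq_intros)
  from diff_chain_at[OF this f]
  have "(log_profile f has_derivative (\<lambda>h. ?D ((exp t * h) *\<^sub>R axis0))) (at t)"
    by (simp add: o_def log_profile_def[abs_def])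
  moreover have "?D ((exp t * h) *\<^sub>R axis0) = log_profile_deriv f t * h" for h
    using linear_frechet_derivative[OF assms]
    by (simp add: log_profile_deriv_def partial_deriv_def linear_cmul)
  ultimately show ?thesis by (simp add: has_field_derivative_def)
qed

lemma radially_symmetric_log_profile:
  fixes f :: "'a::euclidean_space \<Rightarrow> real"
  assumes "radially_symmetric f" "x \<noteq> 0"
  shows "f x = log_profile f (ln (norm x))"
proof -
  have "norm x = norm (exp (ln (norm x)) *\<^sub>R (axis0 :: 'a))" using assms(2) by simp
  with assms(1) show ?thesis unfolding radially_symmetric_def log_profile_def by blast
qed

lemma has_derivative_ln_norm:
  fixes x :: "'a::euclidean_space"
  assumes "x \<noteq> 0"
  shows "((\<lambda>x. ln (norm x)) has_derivative (\<lambda>h. (x \<bullet> h) / (x \<bullet> x))) (at x)"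
proof -
  have "((\<lambda>x. ln (norm x)) has_derivative (\<lambda>h. (h \<bullet> sgn x) * inverse (norm x))) (at x)"
    using assms by (auto intro!: derivative_eq_intros has_derivative_norm)
  moreover have "(h \<bullet> sgn x) * inverse (norm x) = (x \<bullet> h) / (x \<bullet> x)" for h
    by (simp add: sgn_div_norm inner_commute dot_square_norm power2_eq_square divide_simps)
  ultimately show ?thesis by simp
qed

lemma partial_deriv_radial:
  fixes f :: "'a::euclidean_space \<Rightarrow> real"
  assumes f: "C_infinity f" "radially_symmetric f" and x: "x \<noteq> 0"
  shows "partial_deriv b f x = log_profile_deriv f (ln (norm x)) * ((x \<bullet> b) / (x \<bullet> x))"
proof -
  have "(log_profile f has_derivative (\<lambda>h. log_profile_deriv f (ln (norm x)) * h)) (at (ln (norm x)))"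
    using has_real_derivative_log_profile[OF C_infinity_differentiable[OF f(1)]]
    by (simp add: has_field_derivative_def)
  from diff_chain_at[OF has_derivative_ln_norm[OF x] this]
  have "((\<lambda>x. log_profile f (ln (norm x))) has_derivative
      (\<lambda>h. log_profile_deriv f (ln (norm x)) * ((x \<bullet> h) / (x \<bullet> x)))) (at x)"
    by (simp add: o_def)
  then have "(f has_derivative (\<lambda>h. log_profile_deriv f (ln (norm x)) * ((x \<bullet> h) / (x \<bullet> x)))) (at x)"
    by (rule has_derivative_transform_within_open[where s = "- {0}"])
      (use x radially_symmetric_log_profile[OF f(2)] in auto)
  then show ?thesis by (rule partial_deriv_eq)
qed

text \<open>In t = ln r the operator r^2 \<Delta> has constant coefficients, D^2 + (n - 2) D: apply
  the chain rule to ln|x| twice and take the trace. The second derivative \<open>D\<close> is a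
  parameter, to be supplied by the next lemma.\<close>

lemma laplacian_radial:
  fixes f :: "'a::euclidean_space \<Rightarrow> real"
  assumes f: "C_infinity f" "radially_symmetric f"
    and D: "\<And>t. (log_profile_deriv f has_real_derivative D t) (at t)" and x: "x \<noteq> 0"
  shows "laplacian f x = (D (ln (norm x)) + (real DIM('a) - 2) * log_profile_deriv f (ln (norm x))) / (x \<bullet> x)"
proof -
  let ?p = "log_profile_deriv f" and ?t = "ln (norm x)" and ?q = "x \<bullet> x"
  have q: "?q > 0" using x by simp
  have "partial_deriv b (partial_deriv b f) x =
      D ?t * ((x \<bullet> b)\<^sup>2 / ?q\<^sup>2) + ?p ?t * (1 / ?q - 2 * (x \<bullet> b)\<^sup>2 / ?q\<^sup>2)" if b: "b \<in> Basis" for b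
  proof -
    have "(?p has_derivative (\<lambda>h. D ?t * h)) (at ?t)"
      using D by (simp add: has_field_derivative_def)
    from diff_chain_at[OF has_derivative_ln_norm[OF x] this]
    have 1: "((\<lambda>x. ?p (ln (norm x))) has_derivative (\<lambda>h. D ?t * ((x \<bullet> h) / ?q))) (at x)"
      by (simp add: o_def)
    have 2: "((\<lambda>x. (x \<bullet> b) / (x \<bullet> x)) has_derivative
        (\<lambda>h. (h \<bullet> b) / ?q - (x \<bullet> b) * (2 * (x \<bullet> h)) / ?q\<^sup>2)) (at x)"
    proof -
      have "((\<lambda>x. (x \<bullet> b) / (x \<bullet> x)) has_derivative
          (\<lambda>h. - (x \<bullet> b) * (inverse ?q * (x \<bullet> h + h \<bullet> x) * inverse ?q) + (h \<bullet> b) / ?q)) (at x)"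
        by (intro has_derivative_divide has_derivative_inner_left has_derivative_inner has_derivative_ident) (use q in simp)
      moreover have "- (x \<bullet> b) * (inverse ?q * (x \<bullet> h + h \<bullet> x) * inverse ?q) + (h \<bullet> b) / ?q =
          (h \<bullet> b) / ?q - (x \<bullet> b) * (2 * (x \<bullet> h)) / ?q\<^sup>2" for h
        by (simp add: inner_commute divide_inverse power2_eq_square)
      ultimately show ?thesis by simp
    qed
    have "((\<lambda>x. ?p (ln (norm x)) * ((x \<bullet> b) / (x \<bullet> x))) has_derivative
        (\<lambda>h. ?p ?t * ((h \<bullet> b) / ?q - (x \<bullet> b) * (2 * (x \<bullet> h)) / ?q\<^sup>2) + D ?t * ((x \<bullet> h) / ?q) * ((x \<bullet> b) / ?q))) (at x)"
      by (rule has_derivative_mult[OF 1 2])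
    then have "(partial_deriv b f has_derivative
        (\<lambda>h. ?p ?t * ((h \<bullet> b) / ?q - (x \<bullet> b) * (2 * (x \<bullet> h)) / ?q\<^sup>2) + D ?t * ((x \<bullet> h) / ?q) * ((x \<bullet> b) / ?q))) (at x)"
      by (rule has_derivative_transform_within_open[where s = "- {0}"])
        (use x partial_deriv_radial[OF f] in auto)
    from partial_deriv_eq[OF this] show ?thesis
      using b by (simp add: inner_Basis power2_eq_square algebra_simps)
  qed
  then have "laplacian f x = (\<Sum>b\<in>Basis. D ?t * ((x \<bullet> b)\<^sup>2 / ?q\<^sup>2) + ?p ?t * (1 / ?q - 2 * (x \<bullet> b)\<^sup>2 / ?q\<^sup>2))"
    unfolding laplacian_def by simp
  also have "\<dots> = D ?t * ((\<Sum>b\<in>Basis. (x \<bullet> b)\<^sup>2) / ?q\<^sup>2) + ?p ?t * (real DIM('a) / ?q - 2 * (\<Sum>b\<in>Basis. (x \<bullet> b)\<^sup>2) / ?q\<^sup>2)"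
    by (simp add: sum.distrib sum_distrib_left[symmetric] sum_subtractf sum_divide_distrib[symmetric])
  also have "(\<Sum>b\<in>Basis. (x \<bullet> b)\<^sup>2) = ?q"
    by (subst euclidean_inner) (simp add: power2_eq_square)
  finally show ?thesis using q by (simp add: power2_eq_square divide_simps)
qed

text \<open>The second derivative of the profile is obtained from Cartesian partial derivatives, and
  the radial formula for the Laplacian is then solved for it. The same formula shows that the
  Laplacian depends on |x| only; the origin is alone on its sphere.\<close>

lemma
  fixes f :: "'a::euclidean_space \<Rightarrow> real"
  assumes f: "C_infinity f" "radially_symmetric f"
  shows has_real_derivative_log_profile_deriv:
    "(log_profile_deriv f has_real_derivative
      exp (2 * t) * log_profile (laplacian f) t - (real DIM('a) - 2) * log_profile_deriv f t) (at t)"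
    and radially_symmetric_laplacian: "radially_symmetric (laplacian f)"
proof -
  let ?g = "partial_deriv (axis0 :: 'a) f"
  define D where "D t = exp t * ?g (exp t *\<^sub>R axis0) + exp t * log_profile_deriv ?g t" for t
  have D: "(log_profile_deriv f has_real_derivative D t) (at t)" for t
  proof -
    have "(log_profile ?g has_real_derivative log_profile_deriv ?g t) (at t)"
      by (rule has_real_derivative_log_profile[OF C_infinity_differentiable[OF C_infinity_partial_deriv[OF f(1) axis0_Basis]]])
    moreover have "log_profile_deriv f = (\<lambda>t. exp t * log_profile ?g t)"
      by (simp add: fun_eq_iff log_profile_deriv_def log_profile_def)
    ultimately show ?thesis
      unfolding D_def using DERIV_mult[OF DERIV_exp, of "log_profile ?g" "log_profile_deriv ?g t" t]
      by (simp add: log_profile_def mult.commute)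
  qed
  note L = laplacian_radial[OF f D]
  have "exp (2 * t) * log_profile (laplacian f) t = D t + (real DIM('a) - 2) * log_profile_deriv f t" for t
    unfolding log_profile_def using L[of "exp t *\<^sub>R axis0"]
    by (simp add: dot_square_norm power2_eq_square exp_add[symmetric])
  then show "(log_profile_deriv f has_real_derivative
      exp (2 * t) * log_profile (laplacian f) t - (real DIM('a) - 2) * log_profile_deriv f t) (at t)"
    using D[of t] by simp
  show "radially_symmetric (laplacian f)"
    unfolding radially_symmetric_def
  proof (intro allI impI)
    fix x y :: 'a assume "norm x = norm y"
    then show "laplacian f x = laplacian f y"
      by (cases "x = 0 \<or> y = 0") (auto simp: L dot_square_norm)
  qed
qed

lemma norm_grad_radial:
  fixes f :: "'a::euclidean_space \<Rightarrow> real"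
  assumes f: "C_infinity f" "radially_symmetric f"
  shows "(norm (grad f (exp t *\<^sub>R axis0)))\<^sup>2 = (exp (- t) * log_profile_deriv f t)\<^sup>2"
proof -
  let ?x = "exp t *\<^sub>R (axis0 :: 'a)"
  have "grad f ?x = (\<Sum>b\<in>Basis. (log_profile_deriv f t / (?x \<bullet> ?x)) *\<^sub>R ((?x \<bullet> b) *\<^sub>R b))"
    unfolding grad_def by (intro sum.cong refl, subst partial_deriv_radial[OF f]) auto
  also have "\<dots> = (log_profile_deriv f t / (?x \<bullet> ?x)) *\<^sub>R ?x"
    by (simp only: scaleR_sum_right[symmetric] euclidean_representation)
  finally have "norm (grad f ?x) = \<bar>log_profile_deriv f t\<bar> / exp t"
    by (simp add: dot_square_norm power2_eq_square)
  then show ?thesis by (simp add: power_mult_distrib power_divide exp_minus divide_inverse power_inverse mult.commute)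
qed

lemma tendsto_log_profile_at_bot:
  assumes "continuous_on UNIV f"
  shows "(log_profile f \<longlongrightarrow> f 0) at_bot"
proof -
  have "((\<lambda>t. exp t *\<^sub>R (axis0 :: 'a)) \<longlongrightarrow> 0 *\<^sub>R axis0) at_bot"
    by (intro tendsto_scaleR tendsto_const exp_at_bot)
  then show ?thesis
    unfolding log_profile_def[abs_def] using assms
    by (intro continuous_on_tendsto_compose[of UNIV f]) auto
qed

text \<open>Smoothness at the origin: r df/dr is r times a partial derivative, which stays bounded
  as r tends to 0. This is the decay at -infinity required for inverting the factors 2i + D.\<close>

lemma exp_log_profile_deriv_at_bot:
  assumes "C_infinity f" "c \<ge> 0"
  shows "((\<lambda>t. exp (c * t) * log_profile_deriv f t) \<longlongrightarrow> 0) at_bot"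
proof -
  have "((\<lambda>t. exp ((c + 1) * t) * log_profile (partial_deriv axis0 f) t) \<longlongrightarrow> 0 * partial_deriv axis0 f 0) at_bot"
  proof (intro tendsto_mult tendsto_log_profile_at_bot C_infinity_continuous C_infinity_partial_deriv assms axis0_Basis)
    show "((\<lambda>t. exp ((c + 1) * t)) \<longlongrightarrow> 0) at_bot" using assms(2) by real_asymp
  qed
  then show ?thesis
    by (simp add: log_profile_deriv_def log_profile_def distrib_right exp_add mult.assoc)
qed

text \<open>Polar coordinates from the volume of balls. Up to a null set the upper tails of -ln|x|
  are balls; having finite volume, they determine its distribution. The sign matters: ln|x| has
  upper tails of infinite volume.\<close>

lemma nn_integral_ln_norm:
  assumes [measurable]: "F \<in> borel_measurable borel"
  shows "(\<integral>\<^sup>+x. F (ln (norm (x :: 'a::euclidean_space))) \<partial>lborel) =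
    (\<integral>\<^sup>+t. ennreal (real DIM('a) * unit_ball_vol DIM('a) * exp (real DIM('a) * t)) * F t \<partial>lborel)"
proof -
  let ?n = "real DIM('a)" and ?\<omega> = "unit_ball_vol DIM('a)"
  let ?L = "\<lambda>x::'a. - ln (norm x)" and ?d = "\<lambda>t. ennreal (?n * ?\<omega> * exp (- ?n * t))"
  have n: "?n > 0" by simp
  have "distr lborel borel ?L = density lborel ?d"
  proof (rule measure_eqI_lessThan)
    fix y
    have "emeasure (distr lborel borel ?L) {y<..} = emeasure lborel {x. y < ?L x}"
      by (subst emeasure_distr) (auto simp: vimage_def)
    also have "\<dots> = emeasure lborel (ball (0::'a) (exp (- y)))"
    proof (rule emeasure_eq_AE)
      show "AE x in lborel. (x \<in> {x. y < ?L x}) = (x \<in> ball (0::'a) (exp (- y)))"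
        using AE_lborel_singleton[of "0::'a"]
      proof eventually_elim
        case (elim x)
        have "ln (norm x) < - y \<longleftrightarrow> norm x < exp (- y)"
          using elim by (metis exp_less_cancel_iff exp_ln zero_less_norm_iff)
        then show ?case by (auto simp: less_minus_iff)
      qed
    qed auto
    also have "\<dots> = ennreal (?\<omega> * exp (- ?n * y))"
      by (simp add: emeasure_ball exp_of_nat_mult[symmetric])
    finally have 1: "emeasure (distr lborel borel ?L) {y<..} = ennreal (?\<omega> * exp (- ?n * y))" .
    have "emeasure (density lborel ?d) {y<..} = (\<integral>\<^sup>+t. ?d t * indicator {y<..} t \<partial>lborel)"
      by (intro emeasure_density) auto
    also have "\<dots> = (\<integral>\<^sup>+t. ?d t * indicator {y..} t \<partial>lborel)"
      by (rule nn_integral_cong_AE) (use AE_lborel_singleton[of y] in \<open>eventually_elim, auto simp: indicator_def\<close>)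
    also have "\<dots> = ennreal (0 - (- ?\<omega> * exp (- ?n * y)))"
    proof (rule nn_integral_FTC_atLeast)
      show "((\<lambda>t. - ?\<omega> * exp (- ?n * t)) \<longlongrightarrow> 0) at_top" using n by real_asymp
      show "((\<lambda>t. - ?\<omega> * exp (- ?n * t)) has_real_derivative ?n * ?\<omega> * exp (- ?n * x)) (at x)" for x
        by (auto intro!: derivative_eq_intros)
    qed auto
    finally show "emeasure (distr lborel borel ?L) {y<..} = emeasure (density lborel ?d) {y<..}"
      using 1 by simp
    show "emeasure (distr lborel borel ?L) {y<..} < \<infinity>" using 1 by simp
  qed auto
  then have "(\<integral>\<^sup>+t. F (- t) \<partial>distr lborel borel ?L) = (\<integral>\<^sup>+t. F (- t) \<partial>density lborel ?d)" by simp
  moreover have "(\<integral>\<^sup>+t. F (- t) \<partial>distr lborel borel ?L) = (\<integral>\<^sup>+x. F (ln (norm (x :: 'a))) \<partial>lborel)"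
    by (subst nn_integral_distr) auto
  moreover have "(\<integral>\<^sup>+t. F (- t) \<partial>density lborel ?d) = (\<integral>\<^sup>+t. ?d t * F (- t) \<partial>lborel)"
    by (rule nn_integral_density) auto
  moreover have "\<dots> = (\<integral>\<^sup>+t. ennreal (?n * ?\<omega> * exp (?n * t)) * F t \<partial>lborel)"
    by (subst nn_integral_real_affine[where c = "-1" and t = 0]) auto
  ultimately show ?thesis by simp
qed

section \<open>Consequences of nonnegative scalar curvature near infinity\<close>

text \<open>Comparison with a constant source: for -\<Delta>f = e the solution -e r^2/(2n) has r
  df/dr = -e/(N + 2) e^(2t), where N = n - 2. A source \<ge> e outside a ball makes
  \<open>\<phi>'\<close> at least as negative up to a bounded term, so \<open>\<phi>'\<close> and
  \<open>\<phi>\<close> tend to -infinity.\<close>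

lemma source_positive_imp_at_bot:
  fixes \<phi> \<phi>' \<psi> :: "real \<Rightarrow> real"
  assumes \<phi>: "\<And>t. (\<phi> has_real_derivative \<phi>' t) (at t)"
    and \<phi>': "\<And>t. (\<phi>' has_real_derivative - exp (2 * t) * \<psi> t - N * \<phi>' t) (at t)"
    and N: "N \<ge> 0" and e: "e > 0" and ge: "\<And>t. t \<ge> T \<Longrightarrow> \<psi> t \<ge> e"
  shows "filterlim \<phi>' at_bot at_top" and "filterlim \<phi> at_bot at_top"
proof -
  define B where "B t = exp (N * t) * \<phi>' t + e / (N + 2) * exp ((N + 2) * t)" for t
  have B_le: "B t \<le> B T" if "t \<ge> T" for t
  proof (rule DERIV_nonpos_imp_nonincreasing[OF that])
    fix s assume s: "T \<le> s" "s \<le> t"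
    have "(B has_real_derivative exp (N * s) * N * \<phi>' s + exp (N * s) * (- exp (2 * s) * \<psi> s - N * \<phi>' s)
        + e / (N + 2) * (exp ((N + 2) * s) * (N + 2))) (at s)"
      unfolding B_def by (auto intro!: derivative_eq_intros \<phi>')
    also have "exp (N * s) * N * \<phi>' s + exp (N * s) * (- exp (2 * s) * \<psi> s - N * \<phi>' s)
        + e / (N + 2) * (exp ((N + 2) * s) * (N + 2)) = exp ((N + 2) * s) * (e - \<psi> s)"
    proof -
      have "e / (N + 2) * (exp ((N + 2) * s) * (N + 2)) = exp ((N + 2) * s) * e" using N by simp
      moreover have "exp ((N + 2) * s) = exp (N * s) * exp (2 * s)"
        by (simp add: exp_add[symmetric] distrib_right)
      ultimately show ?thesis by (simp add: algebra_simps)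
    qed
    finally have "(B has_real_derivative exp ((N + 2) * s) * (e - \<psi> s)) (at s)" .
    moreover have "exp ((N + 2) * s) * (e - \<psi> s) \<le> 0"
      using ge[OF s(1)] by (simp add: mult_nonneg_nonpos)
    ultimately show "\<exists>y. (B has_real_derivative y) (at s) \<and> y \<le> 0" by blast
  qed
  have le: "\<phi>' t \<le> \<bar>B T\<bar> * exp (- N * T) - e / (N + 2) * exp (2 * t)" if t: "t \<ge> T" for t
  proof -
    have "exp (N * t) * \<phi>' t \<le> \<bar>B T\<bar> - e / (N + 2) * exp ((N + 2) * t)"
      using B_le[OF t] abs_ge_self[of "B T"] unfolding B_def by linarith
    then have "exp (- N * t) * (exp (N * t) * \<phi>' t) \<le> exp (- N * t) * (\<bar>B T\<bar> - e / (N + 2) * exp ((N + 2) * t))"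
      by (rule mult_left_mono) simp
    also have "exp (- N * t) * (exp (N * t) * \<phi>' t) = \<phi>' t"
      by (simp add: mult.assoc[symmetric] exp_add[symmetric])
    also have "exp (- N * t) * (\<bar>B T\<bar> - e / (N + 2) * exp ((N + 2) * t)) = exp (- N * t) * \<bar>B T\<bar> - e / (N + 2) * exp (2 * t)"
    proof -
      have "exp (- N * t) * exp ((N + 2) * t) = exp (2 * t)"
        by (simp add: exp_add[symmetric] algebra_simps)
      then show ?thesis by (simp add: right_diff_distrib)
    qed
    also have "exp (- N * t) * \<bar>B T\<bar> \<le> \<bar>B T\<bar> * exp (- N * T)"
      using N t by (subst mult.commute, intro mult_left_mono) (auto simp: mult_left_mono)
    finally show ?thesis by simp
  qed
  show bot: "filterlim \<phi>' at_bot at_top"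
  proof (rule filterlim_at_bot_mono)
    have "e / (N + 2) > 0" using e N by simp
    then show "filterlim (\<lambda>t. \<bar>B T\<bar> * exp (- N * T) - e / (N + 2) * exp (2 * t)) at_bot at_top"
      by real_asymp
    show "\<forall>\<^sub>F t in at_top. \<phi>' t \<le> \<bar>B T\<bar> * exp (- N * T) - e / (N + 2) * exp (2 * t)"
      using eventually_ge_at_top[of T] by eventually_elim (rule le)
  qed
  from bot have "\<forall>\<^sub>F t in at_top. \<phi>' t \<le> -1" unfolding filterlim_at_bot by blast
  then obtain S where S: "\<And>t. t \<ge> S \<Longrightarrow> \<phi>' t \<le> -1" by (auto simp: eventually_at_top_linorder)
  have "\<phi> t \<le> \<phi> S + S - t" if "t \<ge> S" for t
  proof -
    have "\<phi> t + t \<le> \<phi> S + S"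
    proof (rule DERIV_nonpos_imp_nonincreasing[OF that])
      fix s assume "S \<le> s"
      then have "\<phi>' s + 1 \<le> 0" using S by fastforce
      moreover have "((\<lambda>t. \<phi> t + t) has_real_derivative \<phi>' s + 1) (at s)"
        by (intro DERIV_add \<phi> DERIV_ident)
      ultimately show "\<exists>y. ((\<lambda>t. \<phi> t + t) has_real_derivative y) (at s) \<and> y \<le> 0" by blast
    qed
    then show ?thesis by simp
  qed
  then have "\<forall>\<^sub>F t in at_top. \<phi> t \<le> \<phi> S + S - t"
    unfolding eventually_at_top_linorder by blast
  moreover have "filterlim (\<lambda>t. \<phi> S + S - t) at_bot at_top" by real_asymp
  ultimately show "filterlim \<phi> at_bot at_top" by (rule filterlim_at_bot_mono[rotated])
qed

text \<open>Nonnegative scalar curvature turns into a Riccati inequality for \<open>p = - r u'\<close>, whose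
  solutions blow up in finite time once they exceed \<open>2\<close>.\<close>

lemma riccati_blowup:
  fixes p S :: "real \<Rightarrow> real"
  assumes p: "\<And>t. (p has_real_derivative S t - N * p t) (at t)" and N: "N \<ge> 2"
    and S: "\<And>t. t \<ge> T \<Longrightarrow> S t \<ge> N / 2 * (p t)\<^sup>2"
    and top: "filterlim p at_top at_top"
  shows False
proof -
  \<comment> \<open>The threshold 4 lies above the critical value 2 so that N p \<le> N p^2/4,
    leaving p' \<ge> p^2/2. Then 1/p, being at most 1/4, would have to drop by 1/2 within one unit
    of time and yet stay positive.\<close>
  from top have "\<forall>\<^sub>F t in at_top. 4 \<le> p t" unfolding filterlim_at_top by blast
  then obtain T1 where T1: "\<And>t. t \<ge> T1 \<Longrightarrow> 4 \<le> p t" by (auto simp: eventually_at_top_linorder)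
  define T2 where "T2 = max T T1"
  have "- inverse (p T2) - T2 / 2 \<le> - inverse (p (T2 + 1)) - (T2 + 1) / 2"
  proof (rule DERIV_nonneg_imp_nondecreasing[where f = "\<lambda>t. - inverse (p t) - t / 2"])
    fix t assume "T2 \<le> t"
    then have t: "t \<ge> T" "4 \<le> p t" using T1 by (auto simp: T2_def)
    have "N * (p t)\<^sup>2 / 4 \<ge> N * p t"
      using N t(2) by (simp add: power2_eq_square)
    moreover have "N * (p t)\<^sup>2 \<ge> 2 * (p t)\<^sup>2" using N by (intro mult_right_mono) auto
    ultimately have "S t - N * p t \<ge> (p t)\<^sup>2 / 2"
      using S[OF t(1)] by (simp add: field_simps)
    then have lower: "(S t - N * p t) / (p t)\<^sup>2 \<ge> 1 / 2"
      using t(2) by (simp add: field_simps)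
    have deriv: "((\<lambda>t. - inverse (p t) - t / 2) has_real_derivative (S t - N * p t) / (p t)\<^sup>2 - 1 / 2) (at t)"
    proof -
      have "((\<lambda>t. inverse (p t)) has_real_derivative - (inverse (p t) * (S t - N * p t) * inverse (p t))) (at t)"
        by (rule DERIV_inverse'[OF p]) (use t(2) in simp)
      note D = DERIV_diff[OF DERIV_minus[OF this] DERIV_cdivide[OF DERIV_ident, of 2]]
      have "i * x * i = x / y\<^sup>2" if "i = inverse y" for i x y :: real
        unfolding that by (simp add: power2_eq_square divide_inverse)
      then show ?thesis by (intro DERIV_cong[OF D]) simp
    qed
    show "\<exists>y. ((\<lambda>t. - inverse (p t) - t / 2) has_real_derivative y) (at t) \<and> 0 \<le> y"
      by (rule exI, rule conjI[OF deriv]) (use lower in \<open>simp only: diff_ge_0_iff_ge\<close>)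
  qed simp
  moreover have "4 \<le> p T2" "4 \<le> p (T2 + 1)" by (rule T1, simp add: T2_def)+
  then have "inverse (p T2) \<le> 1 / 4" "inverse (p (T2 + 1)) > 0"
    using le_imp_inverse_le[of 4 "p T2"] by auto
  ultimately show False by argo
qed

section \<open>Iterated Laplacians along a ray\<close>

abbreviation minus_laplacian_pow :: "nat \<Rightarrow> ('a::euclidean_space \<Rightarrow> real) \<Rightarrow> 'a \<Rightarrow> real" where
  "minus_laplacian_pow j u \<equiv> ((\<lambda>v y. - laplacian v y) ^^ j) u"

locale radial_smooth =
  fixes u :: "'a::euclidean_space \<Rightarrow> real"
  assumes smooth: "C_infinity u" and radial: "radially_symmetric u"
begin

definition \<phi> :: "nat \<Rightarrow> real \<Rightarrow> real" where
  "\<phi> j = log_profile (minus_laplacian_pow j u)"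

definition \<phi>' :: "nat \<Rightarrow> real \<Rightarrow> real" where
  "\<phi>' j = log_profile_deriv (minus_laplacian_pow j u)"

lemma pow_smooth: "C_infinity (minus_laplacian_pow j u)"
proof (induction j)
  case (Suc j)
  from C_infinity_minus_laplacian[OF this] show ?case by simp
qed (use smooth in simp)

lemma pow_radial: "radially_symmetric (minus_laplacian_pow j u)"
proof (induction j)
  case (Suc j)
  show ?case
    unfolding radially_symmetric_def
  proof (intro allI impI)
    fix x y :: 'a assume "norm x = norm y"
    with radially_symmetric_laplacian[OF pow_smooth Suc]
    have "laplacian (minus_laplacian_pow j u) x = laplacian (minus_laplacian_pow j u) y"
      unfolding radially_symmetric_def by blast
    then show "minus_laplacian_pow (Suc j) u x = minus_laplacian_pow (Suc j) u y" by simp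
  qed
qed (use radial in simp)

lemma has_real_derivative_\<phi>: "(\<phi> j has_real_derivative \<phi>' j t) (at t)"
  unfolding \<phi>_def \<phi>'_def
  by (rule has_real_derivative_log_profile[OF C_infinity_differentiable[OF pow_smooth]])

lemma has_real_derivative_\<phi>':
  "(\<phi>' j has_real_derivative - exp (2 * t) * \<phi> (Suc j) t - (real DIM('a) - 2) * \<phi>' j t) (at t)"
  using has_real_derivative_log_profile_deriv[OF pow_smooth pow_radial, of j t]
  by (simp add: \<phi>_def \<phi>'_def log_profile_def)

lemma continuous_\<phi>: "continuous_on UNIV (\<phi> j)"
  by (rule DERIV_continuous_on[OF has_field_derivative_at_within[OF has_real_derivative_\<phi>]])

lemma continuous_\<phi>': "continuous_on UNIV (\<phi>' j)"
  by (rule DERIV_continuous_on[OF has_field_derivative_at_within[OF has_real_derivative_\<phi>']])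

lemma \<phi>'_at_bot: "c \<ge> 0 \<Longrightarrow> ((\<lambda>t. exp (c * t) * \<phi>' j t) \<longlongrightarrow> 0) at_bot"
  unfolding \<phi>'_def by (rule exp_log_profile_deriv_at_bot[OF pow_smooth])

lemma \<phi>_at_bot: "(\<phi> j \<longlongrightarrow> minus_laplacian_pow j u 0) at_bot"
  unfolding \<phi>_def by (rule tendsto_log_profile_at_bot[OF C_infinity_continuous[OF pow_smooth]])

text \<open>The form needed for the Riccati argument: with p = -\<open>\<phi>' 0\<close>, the
  right-hand side is the source in the equation p' = e^(2t) \<open>\<phi> 1\<close> - (n - 2)
  p.\<close>

lemma scalar_curvature_nonneg_iff:
  assumes "DIM('a) \<ge> 2"
  shows "scalar_curvature u (exp t *\<^sub>R axis0) \<ge> 0 \<longleftrightarrow>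
    (real DIM('a) - 2) / 2 * (\<phi>' 0 t)\<^sup>2 \<le> exp (2 * t) * \<phi> 1 t"
proof -
  have "scalar_curvature u (exp t *\<^sub>R axis0) =
      (2 * (real DIM('a) - 1) * exp (- 2 * u (exp t *\<^sub>R axis0)) * exp (- 2 * t)) *
      (exp (2 * t) * \<phi> 1 t - (real DIM('a) - 2) / 2 * (\<phi>' 0 t)\<^sup>2)"
  proof -
    have l: "- laplacian u (exp t *\<^sub>R axis0) = \<phi> 1 t"
      by (simp add: \<phi>_def log_profile_def)
    have g: "(norm (grad u (exp t *\<^sub>R axis0)))\<^sup>2 = exp (- 2 * t) * (\<phi>' 0 t)\<^sup>2"
      using norm_grad_radial[OF smooth radial, of t]
      by (simp add: \<phi>'_def power_mult_distrib exp_double[symmetric] flip: exp_of_nat_mult)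
    have alg: "a * (p - k * (E * q)) = a * E * (X * p - k * q)" if "E * X = 1" for a p k E q X :: real
    proof -
      have "a * E * (X * p - k * q) = a * ((E * X) * p - k * (E * q))" by (simp add: algebra_simps)
      with that show ?thesis by (simp only: mult_1)
    qed
    have "exp (- 2 * t) * exp (2 * t) = 1" by (simp add: exp_add[symmetric])
    then show ?thesis
      unfolding scalar_curvature_def l g by (rule alg)
  qed
  moreover have "2 * (real DIM('a) - 1) * exp (- 2 * u (exp t *\<^sub>R axis0)) * exp (- 2 * t) > 0"
    using assms by (intro mult_pos_pos) auto
  ultimately show ?thesis by (simp add: zero_le_mult_iff)
qed

text \<open>If (-\<Delta>)^j u stays \<ge> e near infinity, the next lower power tends to -infinity,
  the one below to +infinity, and so on down to -\<Delta>u, which is then bounded away from 0 with a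
  fixed sign. A negative sign contradicts nonnegative scalar curvature directly; a positive one
  sends p = -r u' to infinity, where the Riccati inequality forbids it.\<close>

lemma scalar_curvature_nonneg_imp_\<phi>_small:
  assumes R: "\<And>t. t \<ge> T0 \<Longrightarrow> scalar_curvature u (exp t *\<^sub>R axis0) \<ge> 0"
    and dim: "DIM('a) \<ge> 4" and j: "1 \<le> j" and e: "e > 0"
  shows "\<exists>s\<ge>T. \<phi> j s < e"
proof (rule ccontr)
  assume "\<not> (\<exists>s\<ge>T. \<phi> j s < e)"
  then have ge: "\<And>s. s \<ge> T \<Longrightarrow> \<phi> j s \<ge> e" by force
  let ?N = "real DIM('a) - 2"
  have N: "?N \<ge> 2" "?N \<ge> 0" using dim by simp_all
  have R': "?N / 2 * (\<phi>' 0 t)\<^sup>2 \<le> exp (2 * t) * \<phi> 1 t" if "t \<ge> T0" for t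
    using scalar_curvature_nonneg_iff[of t] R[OF that] dim by simp
  \<comment> \<open>Each step down flips the sign, so the induction hypothesis admits both.\<close>
  let ?P = "\<lambda>i. \<exists>e>0. \<exists>T. (\<forall>t\<ge>T. e \<le> \<phi> i t) \<or> (\<forall>t\<ge>T. \<phi> i t \<le> - e)"
  have step: "?P i" if P: "?P (Suc i)" for i
  proof -
    obtain e T where e: "e > 0" "(\<forall>t\<ge>T. e \<le> \<phi> (Suc i) t) \<or> (\<forall>t\<ge>T. \<phi> (Suc i) t \<le> - e)"
      using P by blast
    from e(2) show "?P i"
    proof
      assume a: "\<forall>t\<ge>T. e \<le> \<phi> (Suc i) t"
      have "filterlim (\<phi> i) at_bot at_top"
        by (rule source_positive_imp_at_bot(2)[OF has_real_derivative_\<phi> has_real_derivative_\<phi>' N(2) e(1)]) (use a in auto)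
      then have "\<forall>\<^sub>F t in at_top. \<phi> i t \<le> - 1" unfolding filterlim_at_bot by blast
      then obtain S where "\<forall>t\<ge>S. \<phi> i t \<le> - 1" by (auto simp: eventually_at_top_linorder)
      then show ?thesis by (intro exI[of _ 1]) auto
    next
      assume a: "\<forall>t\<ge>T. \<phi> (Suc i) t \<le> - e"
      have "filterlim (\<lambda>t. - \<phi> i t) at_bot at_top"
      proof (rule source_positive_imp_at_bot(2)[where \<phi>' = "\<lambda>t. - \<phi>' i t" and \<psi> = "\<lambda>t. - \<phi> (Suc i) t" and T = T, OF _ _ N(2) e(1)])
        show "((\<lambda>t. - \<phi> i t) has_real_derivative - \<phi>' i t) (at t)" for t
          by (rule DERIV_minus[OF has_real_derivative_\<phi>])
        show "((\<lambda>t. - \<phi>' i t) has_real_derivative - exp (2 * t) * - \<phi> (Suc i) t - ?N * - \<phi>' i t) (at t)" for t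
          using DERIV_minus[OF has_real_derivative_\<phi>'[of i t]] by (simp add: algebra_simps)
      qed (use a in force)
      then have "\<forall>\<^sub>F t in at_top. - \<phi> i t \<le> - 1" unfolding filterlim_at_bot by blast
      then obtain S where "\<forall>t\<ge>S. 1 \<le> \<phi> i t" by (auto simp: eventually_at_top_linorder)
      then show ?thesis by (intro exI[of _ 1]) auto
    qed
  qed
  have "?P j" using ge e by blast
  with j have "?P 1"
  proof (induction j rule: dec_induct)
    case (step i)
    then show ?case using \<open>?P (Suc i) \<Longrightarrow> ?P i\<close> by blast
  qed blast
  then obtain e T where e: "e > 0" "(\<forall>t\<ge>T. e \<le> \<phi> 1 t) \<or> (\<forall>t\<ge>T. \<phi> 1 t \<le> - e)" by blast
  from e(2) show False
  proof
    assume a: "\<forall>t\<ge>T. e \<le> \<phi> 1 t"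
    have "filterlim (\<phi>' 0) at_bot at_top"
      by (rule source_positive_imp_at_bot(1)[OF has_real_derivative_\<phi> has_real_derivative_\<phi>' N(2) e(1)]) (use a in auto)
    then have top: "filterlim (\<lambda>t. - \<phi>' 0 t) at_top at_top" by (simp add: filterlim_uminus_at_bot)
    show False
    proof (rule riccati_blowup[where p = "\<lambda>t. - \<phi>' 0 t", OF _ N(1) _ top])
      show "((\<lambda>t. - \<phi>' 0 t) has_real_derivative exp (2 * t) * \<phi> 1 t - ?N * - \<phi>' 0 t) (at t)" for t
        using DERIV_minus[OF has_real_derivative_\<phi>'[of 0 t]] by (simp add: add.commute)
      show "?N / 2 * (- \<phi>' 0 t)\<^sup>2 \<le> exp (2 * t) * \<phi> 1 t" if "t \<ge> T0" for t
        using R'[OF that] by simp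
    qed
  next
    assume a: "\<forall>t\<ge>T. \<phi> 1 t \<le> - e"
    let ?t = "max T T0"
    have "0 \<le> ?N / 2 * (\<phi>' 0 ?t)\<^sup>2" using N by simp
    also have "\<dots> \<le> exp (2 * ?t) * \<phi> 1 ?t" using R'[of ?t] by simp
    finally have "0 \<le> \<phi> 1 ?t" by (simp add: zero_le_mult_iff)
    moreover have "\<phi> 1 ?t \<le> - e" using a by simp
    ultimately show False using e(1) by linarith
  qed
qed

end

section \<open>The spherical profile\<close>

text \<open>The energy arguments subtract potentials and therefore need a real-valued
  kernel.\<close>

definition real_kernel :: "nat \<Rightarrow> real \<Rightarrow> real" where
  "real_kernel K z = enn2real (sphere_kernel K z)"

lemma ennreal_real_kernel:
  assumes "K > 0"
  shows "ennreal (real_kernel K z) = sphere_kernel K z"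
proof -
  have "sphere_kernel K z \<le> ennreal (sphere_const K)"
    unfolding sphere_kernel_reflect[of z K, OF disjI2[OF assms], symmetric] by simp
  then show ?thesis unfolding real_kernel_def by (simp add: le_less_trans[OF _ ennreal_less_top])
qed

text \<open>\<open>K > 0\<close>, that is n \<ge> 4, provides the reflection identity at z = 0 as
  well; the Heaviside kernel itself would give 2 there instead of 1.\<close>

lemma balanced_real_kernel:
  assumes "K > 0"
  shows "balanced_kernel (real_kernel K) (sphere_const K)"
proof
  show "mono (real_kernel K)"
  proof (rule monoI)
    fix s t :: real assume "s \<le> t"
    then have "ennreal (real_kernel K s) \<le> ennreal (real_kernel K t)"
      unfolding ennreal_real_kernel[OF assms] by (rule sphere_kernel_mono)
    then show "real_kernel K s \<le> real_kernel K t"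
      by (simp add: real_kernel_def)
  qed
  show nonneg: "0 \<le> real_kernel K z" for z by (simp add: real_kernel_def)
  show "real_kernel K z + real_kernel K (- z) = sphere_const K" for z
  proof -
    have "ennreal (real_kernel K z + real_kernel K (- z)) = ennreal (sphere_const K)"
      using sphere_kernel_reflect[of z K] assms nonneg by (simp add: ennreal_plus ennreal_real_kernel)
    then show ?thesis
      by (subst (asm) ennreal_inj) (use nonneg[of z] nonneg[of "- z"] sphere_const_pos[of K] in auto)
  qed
qed

text \<open>The kernel is bounded and the mass finite, so the convolution is a real number; this
  carries the estimates obtained in \<open>ennreal\<close> over to the potential.\<close>

lemma conv_sphere_kernel_eq_potential:
  assumes K: "K > 0" and \<rho> [measurable]: "integrable lborel \<rho>" and nonneg: "\<And>t. \<rho> t \<ge> 0" and c: "c \<ge> 0"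
  shows "conv (sphere_kernel K) (\<lambda>t. ennreal (c * \<rho> t)) t = ennreal (c * balanced_kernel.potential (real_kernel K) \<rho> t)"
proof -
  interpret balanced_kernel "real_kernel K" "sphere_const K" by (rule balanced_real_kernel[OF K])
  note fin = finite_measure_density_lborel(1)[OF \<rho> nonneg]
  have [measurable]: "\<rho> \<in> borel_measurable borel" using \<rho> by simp
  have "conv (sphere_kernel K) (\<lambda>t. ennreal (c * \<rho> t)) t = ennreal c * conv (sphere_kernel K) (\<lambda>t. ennreal (\<rho> t)) t"
    using c nonneg by (subst conv_cmult[symmetric]) (auto simp: ennreal_mult)
  also have "conv (sphere_kernel K) (\<lambda>t. ennreal (\<rho> t)) = conv (\<lambda>t. ennreal (\<rho> t)) (sphere_kernel K)"
    by (rule conv_swap) measurable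
  also have "conv (\<lambda>t. ennreal (\<rho> t)) (sphere_kernel K) t = (\<integral>\<^sup>+s. ennreal (real_kernel K (t - s)) \<partial>density lborel \<rho>)"
    unfolding conv_def ennreal_real_kernel[OF K] by (subst nn_integral_density) auto
  also have "\<dots> = ennreal (potential \<rho> t)"
    unfolding potential_def
    by (rule nn_integral_eq_integral) (auto intro!: integrable_h[OF fin] simp: nonneg_h)
  also have "ennreal c * ennreal (potential \<rho> t) = ennreal (c * potential \<rho> t)"
    using c by (simp add: ennreal_mult potential_bounds(1)[OF \<rho> nonneg])
  finally show ?thesis .
qed

text \<open>The density e^(nw) of the round metric: u = ln(2/(1 + r^2)) gives w = u + t = -ln cosh
  t.\<close>

definition sech_pow :: "nat \<Rightarrow> real \<Rightarrow> real" where
  "sech_pow n t = 1 / cosh t ^ n"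

lemma sech_pow_pos: "sech_pow n t > 0"
  unfolding sech_pow_def using cosh_real_pos[of t] by simp

lemma sech_pow_eq_exp: "sech_pow n t = exp (real n * - ln (cosh t))"
  unfolding sech_pow_def using cosh_real_pos[of t]
  by (simp add: exp_of_nat_mult exp_minus divide_inverse power_inverse)

lemma cosh_ge_exp: "cosh t \<ge> exp t / 2" "cosh t \<ge> exp (- t) / (2::real)"
  by (auto simp: cosh_def)

lemma measurable_sech_pow [measurable]: "sech_pow n \<in> borel_measurable borel"
proof -
  have [measurable]: "(cosh :: real \<Rightarrow> real) \<in> borel_measurable borel"
    by (intro borel_measurable_continuous_onI continuous_intros)
  show ?thesis unfolding sech_pow_def[abs_def] by measurable
qed

lemma sech_pow_le:
  assumes "n > 0"
  shows "sech_pow n t \<le> 2 * exp (- t)" "sech_pow n t \<le> 2 * exp t"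
proof -
  have "cosh t ^ 1 \<le> cosh t ^ n"
    using assms cosh_real_ge_1[of t] by (intro power_increasing) auto
  then have "sech_pow n t \<le> 1 / cosh t"
    unfolding sech_pow_def using cosh_real_pos[of t] by (intro divide_left_mono) auto
  moreover have "1 / cosh t \<le> 1 / (exp t / 2)" "1 / cosh t \<le> 1 / (exp (- t) / 2)"
    by (intro divide_left_mono cosh_ge_exp mult_pos_pos cosh_real_pos; simp)+
  moreover have "1 / (exp t / 2) = 2 * exp (- t)" "1 / (exp (- t) / 2) = 2 * exp t"
    by (simp_all add: exp_minus field_simps)
  ultimately show "sech_pow n t \<le> 2 * exp (- t)" "sech_pow n t \<le> 2 * exp t"
    by (auto intro: order_trans)
qed

lemma integrable_sech_pow:
  assumes "n > 0"
  shows "integrable lborel (sech_pow n)"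
proof (rule integrableI_nonneg)
  have "(\<integral>\<^sup>+t. ennreal (sech_pow n t) \<partial>lborel) \<le> (\<integral>\<^sup>+t. 2 * (exp_kernel 1 t + exp_kernel' 1 t) \<partial>lborel)"
  proof (rule nn_integral_mono)
    fix t
    show "ennreal (sech_pow n t) \<le> 2 * (exp_kernel 1 t + exp_kernel' 1 t)"
    proof (cases "t \<ge> 0")
      case True
      have "ennreal (sech_pow n t) \<le> ennreal (2 * exp (- t))" using sech_pow_le[OF assms] by (intro ennreal_leI)
      also have "\<dots> = 2 * exp_kernel 1 t" using True by (simp add: exp_kernel_def ennreal_mult')
      also have "\<dots> \<le> 2 * (exp_kernel 1 t + exp_kernel' 1 t)" by (intro mult_left_mono) auto
      finally show ?thesis .
    next
      case False
      have "ennreal (sech_pow n t) \<le> ennreal (2 * exp t)" using sech_pow_le[OF assms] by (intro ennreal_leI)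
      also have "\<dots> = 2 * exp_kernel' 1 t" using False by (simp add: exp_kernel_def ennreal_mult')
      also have "\<dots> \<le> 2 * (exp_kernel 1 t + exp_kernel' 1 t)" by (intro mult_left_mono) auto
      finally show ?thesis .
    qed
  qed
  also have "\<dots> = 2 * (1 + 1)"
    using nn_integral_exp_kernel[of 1] nn_integral_exp_kernel'[of 1]
    by (subst nn_integral_cmult, measurable, subst nn_integral_add) auto
  also have "\<dots> < \<infinity>" by (simp add: ennreal_mult_less_top)
  finally show "(\<integral>\<^sup>+t. ennreal (sech_pow n t) \<partial>lborel) < \<infinity>" .
qed (auto intro!: AE_I2 less_imp_le sech_pow_pos)

text \<open>This is the equation w' = 1 - (n - 1)! H * e^(nw) for w = -ln cosh.\<close>

lemma potential_sech_pow:
  assumes "K > 0"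
  shows "fact (2 * K + 1) * balanced_kernel.potential (real_kernel K) (sech_pow (2 * K + 2)) t = 1 + tanh t"
proof -
  interpret balanced_kernel "real_kernel K" "sphere_const K" by (rule balanced_real_kernel[OF assms])
  have int: "integrable lborel (sech_pow (2 * K + 2))" by (rule integrable_sech_pow) simp
  have nn: "sech_pow (2 * K + 2) t \<ge> 0" for t using sech_pow_pos less_imp_le by blast
  have "ennreal (potential (sech_pow (2 * K + 2)) t) = ennreal ((1 + tanh t) / fact (2 * K + 1))"
  proof -
    have "(\<lambda>t. ennreal (1 * sech_pow (2 * K + 2) t)) = (\<lambda>t. ennreal (1 / cosh t ^ (2 * K + 2)))"
      by (simp only: sech_pow_def mult_1)
    with conv_sphere_kernel_eq_potential[OF assms int nn, of 1 t] conv_sphere_kernel_sech[of K t]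
    show ?thesis by (simp only: mult_1 zero_le_one)
  qed
  moreover have "0 \<le> (1 + tanh t) / fact (2 * K + 1)"
    using tanh_real_gt_neg1[of t] by simp
  ultimately have "potential (sech_pow (2 * K + 2)) t = (1 + tanh t) / fact (2 * K + 1)"
    using potential_bounds(1)[OF int nn, of t] by (simp only: ennreal_inj)
  then show ?thesis by simp
qed

text \<open>Instead of a Wallis recursion, the equation of the sphere is tested with its own
  density. The term with tanh is odd and drops out, and the energy identity leaves M = (2K + 1)! g
  M^2 / 2 with M > 0.\<close>

lemma integral_sech_pow:
  assumes "K > 0"
  shows "(\<integral>t. sech_pow (2 * K + 2) t \<partial>lborel) = 2 / (fact (2 * K + 1) * sphere_const K)"
proof -
  interpret balanced_kernel "real_kernel K" "sphere_const K" by (rule balanced_real_kernel[OF assms])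
  let ?\<rho> = "sech_pow (2 * K + 2)" and ?c = "fact (2 * K + 1) :: real"
  define M where "M = (\<integral>t. ?\<rho> t \<partial>lborel)"
  have int: "integrable lborel ?\<rho>" by (rule integrable_sech_pow) simp
  have nn: "?\<rho> t \<ge> 0" for t using sech_pow_pos less_imp_le by blast
  have [measurable]: "(tanh :: real \<Rightarrow> real) \<in> borel_measurable borel"
    by (intro borel_measurable_continuous_onI continuous_intros) (use cosh_real_pos in \<open>simp add: less_imp_neq[symmetric]\<close>)
  have intt: "integrable lborel (\<lambda>t. tanh t * ?\<rho> t)"
  proof (rule Bochner_Integration.integrable_bound[OF int])
    have "\<bar>tanh t\<bar> \<le> (1 :: real)" for t
      using tanh_real_lt_1[of t] tanh_real_gt_neg1[of t] by linarith
    then show "AE t in lborel. norm (tanh t * ?\<rho> t) \<le> norm (?\<rho> t)"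
      by (intro AE_I2) (simp add: abs_mult mult_left_le_one_le)
  qed measurable
  have "(\<integral>t. tanh t * ?\<rho> t \<partial>lborel) = (\<integral>t. tanh (- t) * ?\<rho> (- t) \<partial>lborel)"
    using lborel_integral_real_affine[of "-1" "\<lambda>t. tanh t * ?\<rho> t" 0] by simp
  also have "\<dots> = - (\<integral>t. tanh t * ?\<rho> t \<partial>lborel)"
    by (simp add: sech_pow_def)
  finally have "(\<integral>t. tanh t * ?\<rho> t \<partial>lborel) = 0" by simp
  then have "M = (\<integral>t. (1 + tanh t) * ?\<rho> t \<partial>lborel)"
    using int intt by (simp add: M_def distrib_right)
  also have "\<dots> = ?c * (\<integral>t. potential ?\<rho> t * ?\<rho> t \<partial>lborel)"
    unfolding potential_sech_pow[OF assms, symmetric] by (simp only: mult.assoc integral_mult_right_zero)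
  also have "\<dots> = ?c * sphere_const K * M\<^sup>2 / 2"
    unfolding integral_potential[OF int nn] M_def by simp
  finally have "M = (?c * sphere_const K / 2 * M) * M" by (simp add: power2_eq_square)
  moreover have "M > 0"
  proof -
    have "M \<noteq> 0"
    proof
      assume "M = 0"
      then have "AE t in lborel. ?\<rho> t = 0"
        using integral_nonneg_eq_0_iff_AE[OF int] nn by (simp add: M_def)
      then have "AE t in (lborel :: real measure). False"
        by eventually_elim (metis less_irrefl sech_pow_pos)
      then show False by (simp add: trivial_limit_def[symmetric] ae_filter_eq_bot_iff)
    qed
    moreover have "M \<ge> 0" unfolding M_def using nn by (intro integral_nonneg_AE) auto
    ultimately show ?thesis by simp
  qed
  ultimately have "?c * sphere_const K / 2 * M = 1" by simp
  then have "?c * sphere_const K * M = 2" by simp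
  moreover have "?c * sphere_const K \<noteq> 0" using sphere_const_pos[of K] by simp
  ultimately show ?thesis unfolding M_def[symmetric] by (metis mult.commute nonzero_eq_divide_eq)
qed

text \<open>Without its poles the n-sphere is a cylinder over the (n - 1)-sphere with conformal
  factor sech, so its volume is that of the (n - 1)-sphere, n times the unit ball volume, times the
  integral of sech^n. Here this is verified on the closed forms of both sides.\<close>

lemma hypersurface_volume_sphere_even:
  fixes K :: nat
  assumes dim: "DIM('a::euclidean_space) = 2 * K + 2" "DIM('b::euclidean_space) = 2 * K + 3"
  shows "hypersurface_volume (sphere (0 :: 'b) 1) =
    real DIM('a) * unit_ball_vol (real DIM('a)) * (2 / (fact (2 * K + 1) * sphere_const K))"
proof -
  let ?d = "real DIM('b)"
  have "?d / 2 \<notin> \<int>\<^sub>\<le>\<^sub>0"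
    using nonpos_Ints_nonpos[of "?d / 2"] by fastforce
  then have G: "Gamma (?d / 2 + 1) = ?d / 2 * Gamma (?d / 2)" by (rule Gamma_plus1)
  have alg: "2 * z / y = ?d * (z / (?d / 2 * y))" for y z :: real by simp
  have "hypersurface_volume (sphere (0 :: 'b) 1) = ?d * unit_ball_vol ?d"
    unfolding hypersurface_volume_unit_sphere unit_ball_vol_def G by (rule alg)
  also have "?d = real (2 * (K + 1) + 1)" using dim by simp
  also have "unit_ball_vol (real (2 * (K + 1) + 1)) = (2 ^ (2 * (K + 2)) * fact (K + 2)) / fact (2 * (K + 2)) * pi ^ (K + 1)"
    by (subst unit_ball_vol_odd) (simp add: numeral_2_eq_2)
  also have "real (2 * (K + 1) + 1) * \<dots> = real (2 * (K + 1)) * (pi ^ (K + 1) / fact (K + 1)) * (2 / (fact (2 * K + 1) * sphere_const K))"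
  proof -
    have sc: "sphere_const K = 1 / (4 ^ K * (fact K)\<^sup>2)"
    proof (induction K)
      case (Suc K)
      show ?case unfolding sphere_const_Suc Suc fact_Suc power_Suc by (simp only: power_mult_distrib) simp
    qed (simp add: sphere_const_def)
    have F: "(fact (Suc m) :: real) = (real m + 1) * fact m" for m by simp
    have "2 * (K + 2) = Suc (Suc (Suc (2 * K + 1)))" by simp
    moreover have "(fact (Suc (Suc (Suc (2 * K + 1)))) :: real) = (real (Suc (Suc (2 * K + 1))) + 1) *
        ((real (Suc (2 * K + 1)) + 1) * ((real (2 * K + 1) + 1) * fact (2 * K + 1)))" by (simp only: F)
    moreover have "real (Suc (Suc (2 * K + 1))) + 1 = 2 * real K + 4" "real (Suc (2 * K + 1)) + 1 = 2 * real K + 3"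
      "real (2 * K + 1) + 1 = 2 * real K + 2" by simp_all
    ultimately have f1: "(fact (2 * (K + 2)) :: real) =
        (2 * real K + 4) * ((2 * real K + 3) * ((2 * real K + 2) * fact (2 * K + 1)))" by (simp only:)
    have f2: "(fact (K + 2) :: real) = (real K + 2) * ((real K + 1) * fact K)"
      and f3: "(fact (K + 1) :: real) = (real K + 1) * fact K"
      using F[of "Suc K"] F[of K] by (simp_all add: add.commute)
    have p2: "(2 :: real) ^ (2 * (K + 2)) = 16 * 4 ^ K"
      by (simp add: power_mult power_add)
    \<comment> \<open>To be read with a = K + 1, b = K + 2, c = 2K + 3, f = K!, F = (2K + 1)!, p =
      4^K and q = pi^(K+1).\<close>
    have alg: "c * ((16 * p * (b * (a * f))) / (2 * b * (c * (2 * a * F))) * q)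
        = 2 * a * (q / (a * f)) * (2 / (F * (1 / (p * f\<^sup>2))))"
      if "a \<noteq> 0" "b \<noteq> 0" "c \<noteq> 0" "f \<noteq> 0" "F \<noteq> 0" "p \<noteq> 0" for a b c f F p q :: real
      using that by (simp add: power2_eq_square)
    have e: "real (2 * (K + 1) + 1) = 2 * real K + 3" "real (2 * (K + 1)) = 2 * (real K + 1)"
      "2 * real K + 4 = 2 * (real K + 2)" "2 * real K + 2 = 2 * (real K + 1)" by simp_all
    show ?thesis unfolding sc f1 f2 f3 p2 e
      by (rule alg) auto
  qed
  also have "pi ^ (K + 1) / fact (K + 1) = unit_ball_vol (real DIM('a))"
    using unit_ball_vol_even[of "K + 1"] dim by simp
  also have "real (2 * (K + 1)) = real DIM('a)" using dim by simp
  finally show ?thesis .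
qed

section \<open>Volume comparison\<close>

context radial_smooth
begin

text \<open>In polar coordinates \<open>e\<^sup>2\<^sup>u |dx|\<^sup>2\<close> is \<open>e\<^sup>2\<^sup>w\<close> times the product metric of the cylinder.\<close>

definition w :: "real \<Rightarrow> real" where
  "w t = \<phi> 0 t + t"

lemma u_eq_w: "x \<noteq> 0 \<Longrightarrow> u x = w (ln (norm x)) - ln (norm x)"
  using radially_symmetric_log_profile[OF radial, of x] by (simp add: w_def \<phi>_def)

lemma has_real_derivative_w: "(w has_real_derivative \<phi>' 0 t + 1) (at t)"
  unfolding w_def[abs_def] by (intro DERIV_add has_real_derivative_\<phi> DERIV_ident)

lemma exp_w_at_bot: "n > 0 \<Longrightarrow> ((\<lambda>t. exp (n * w t)) \<longlongrightarrow> 0) at_bot"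
proof -
  assume n: "n > 0"
  have "((\<lambda>t. exp (n * \<phi> 0 t) * exp (n * t)) \<longlongrightarrow> exp (n * u 0) * 0) at_bot"
  proof (intro tendsto_mult tendsto_exp tendsto_const)
    show "(\<phi> 0 \<longlongrightarrow> u 0) at_bot" using \<phi>_at_bot[of 0] by simp
    show "((\<lambda>t. exp (n * t)) \<longlongrightarrow> 0) at_bot" using n by real_asymp
  qed
  then show ?thesis by (simp add: w_def distrib_left exp_add)
qed

lemma volume_eq:
  "(\<integral>\<^sup>+x. ennreal (exp (real DIM('a) * u x)) \<partial>lborel) =
    ennreal (real DIM('a) * unit_ball_vol (real DIM('a))) * (\<integral>\<^sup>+t. ennreal (exp (real DIM('a) * w t)) \<partial>lborel)"
proof -
  let ?n = "real DIM('a)"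
  have [measurable]: "w \<in> borel_measurable borel"
    by (rule borel_measurable_continuous_onI)
      (rule DERIV_continuous_on[OF has_field_derivative_at_within[OF has_real_derivative_w]])
  have "(\<integral>\<^sup>+x. ennreal (exp (?n * u x)) \<partial>lborel) =
      (\<integral>\<^sup>+x. ennreal (exp (?n * (w (ln (norm (x :: 'a))) - ln (norm x)))) \<partial>lborel)"
    by (rule nn_integral_cong_AE)
      (use AE_lborel_singleton[of "0::'a"] in \<open>eventually_elim, simp add: u_eq_w\<close>)
  also have "\<dots> = (\<integral>\<^sup>+t. ennreal (?n * unit_ball_vol ?n * exp (?n * t)) * ennreal (exp (?n * (w t - t))) \<partial>lborel)"
    by (rule nn_integral_ln_norm) measurable
  also have "\<dots> = (\<integral>\<^sup>+t. ennreal (?n * unit_ball_vol ?n) * ennreal (exp (?n * w t)) \<partial>lborel)"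
  proof (rule nn_integral_cong)
    fix t
    have "exp (?n * t) * exp (?n * (w t - t)) = exp (?n * w t)"
      by (simp add: exp_add[symmetric] algebra_simps)
    then show "ennreal (?n * unit_ball_vol ?n * exp (?n * t)) * ennreal (exp (?n * (w t - t))) =
        ennreal (?n * unit_ball_vol ?n) * ennreal (exp (?n * w t))"
      by (simp add: ennreal_mult[symmetric] mult.assoc)
  qed
  finally show ?thesis by (simp add: nn_integral_cmult)
qed

text \<open>All hypotheses on the metric enter here: smoothness at the origin gives the decay at
  -infinity, the scalar curvature the small values at infinity, and the bound on Q the source, since
  r^n e^(nu) = e^(nw).\<close>

lemma minus_\<phi>'_le_conv:
  assumes dim: "DIM('a) = 2 * K + 2" and K: "K > 0" and c: "c \<ge> 0"
    and R: "\<And>t. t \<ge> T0 \<Longrightarrow> scalar_curvature u (exp t *\<^sub>R axis0) \<ge> 0"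
    and Q: "\<And>x. Q_curvature u x \<le> c"
  shows "ennreal (- \<phi>' 0 t) \<le> conv (sphere_kernel K) (\<lambda>t. ennreal (c * exp (real DIM('a) * w t))) t"
proof -
  \<comment> \<open>The weights r^(2j) absorb the factor e^(2t) of the radial Laplacian, which makes
    the chain of equations autonomous in t.\<close>
  define \<psi> where "\<psi> j t = exp (2 * real j * t) * \<phi> j t" for j t
  define \<eta> where "\<eta> j t = - (exp (2 * real j * t) * \<phi>' j t)" for j t
  have N: "real DIM('a) - 2 = 2 * real K" using dim by simp
  have "ennreal (\<eta> 0 t) \<le> conv (sphere_kernel K) (\<lambda>t. ennreal (c * exp (real DIM('a) * w t))) t"
  proof (rule le_conv_sphere_kernel[where \<psi> = \<psi> and \<eta> = \<eta>])
    have dexp: "((\<lambda>t. exp (a * t)) has_real_derivative exp (a * t) * a) (at t)" for a t :: real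
      by (auto intro!: derivative_eq_intros)
    show "(\<psi> j has_real_derivative 2 * real j * \<psi> j t - \<eta> j t) (at t)" for j t
      unfolding \<psi>_def[abs_def] \<eta>_def
      by (rule DERIV_cong[OF DERIV_mult[OF dexp has_real_derivative_\<phi>]]) (simp add: algebra_simps)
    show "(\<eta> j has_real_derivative \<psi> (Suc j) t - 2 * real (K - j) * \<eta> j t) (at t)" if "j \<le> K" for j t
    proof -
      have "exp (2 * real (Suc j) * t) = exp (2 * real j * t) * exp (2 * t)"
        by (simp add: exp_add[symmetric] algebra_simps)
      moreover have "real (K - j) = real K - real j" using that by (rule of_nat_diff)
      ultimately show ?thesis
        unfolding \<psi>_def \<eta>_def[abs_def]
        by (intro DERIV_cong[OF DERIV_minus[OF DERIV_mult[OF dexp has_real_derivative_\<phi>']]])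
          (simp only: N, simp add: algebra_simps)
    qed
    show "continuous_on UNIV (\<psi> (Suc K))"
      unfolding \<psi>_def[abs_def] by (intro continuous_intros continuous_\<phi>)
    show "\<exists>s\<ge>T. exp (- (2 * real j) * s) * \<psi> j s < e" if "1 \<le> j" "e > 0" for j e T
    proof -
      have "exp (- (2 * real j) * s) * \<psi> j s = \<phi> j s" for s
        by (simp add: \<psi>_def mult.assoc[symmetric] exp_add[symmetric])
      then show ?thesis
        using scalar_curvature_nonneg_imp_\<phi>_small[OF R _ that, of T0 T] dim K by simp
    qed
    show "((\<lambda>s. exp (2 * real (K - j) * s) * \<eta> j s) \<longlongrightarrow> 0) at_bot" if "j \<le> K" for j
    proof -
      have "exp (2 * real (K - j) * s) * \<eta> j s = - (exp (2 * real K * s) * \<phi>' j s)" for s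
      proof -
        have "exp (2 * real K * s) = exp (2 * real (K - j) * s) * exp (2 * real j * s)"
          using that by (simp add: exp_add[symmetric] of_nat_diff algebra_simps)
        then show ?thesis by (simp add: \<eta>_def)
      qed
      then show ?thesis using tendsto_minus[OF \<phi>'_at_bot[of "2 * real K" j]] by simp
    qed
    have "continuous_on UNIV w"
      by (rule DERIV_continuous_on[OF has_field_derivative_at_within[OF has_real_derivative_w]])
    then have [measurable]: "w \<in> borel_measurable borel" by (rule borel_measurable_continuous_onI)
    show "(\<lambda>t. ennreal (c * exp (real DIM('a) * w t))) \<in> borel_measurable borel" by measurable
    show "ennreal (\<psi> (Suc K) t) \<le> ennreal (c * exp (real DIM('a) * w t))" for t
    proof (rule ennreal_leI)
      let ?x = "exp t *\<^sub>R (axis0 :: 'a)"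
      have "DIM('a) div 2 = Suc K" using dim by simp
      then have "\<phi> (Suc K) t = Q_curvature u ?x * exp (real DIM('a) * u ?x)"
        unfolding Q_curvature_def by (simp add: \<phi>_def log_profile_def)
      also have "\<dots> \<le> c * exp (real DIM('a) * u ?x)" by (intro mult_right_mono Q) simp
      finally have "exp (2 * real (Suc K) * t) * \<phi> (Suc K) t \<le> exp (2 * real (Suc K) * t) * (c * exp (real DIM('a) * u ?x))"
        by (rule mult_left_mono) simp
      also have "\<dots> = c * exp (real DIM('a) * w t)"
      proof -
        have "exp (real DIM('a) * w t) = exp (2 * real (Suc K) * t) * exp (real DIM('a) * u ?x)"
          using dim by (simp add: w_def \<phi>_def log_profile_def exp_add[symmetric] algebra_simps)
        then show ?thesis by simp
      qed
      finally show "\<psi> (Suc K) t \<le> c * exp (real DIM('a) * w t)" by (simp only: \<psi>_def)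
    qed
  qed
  then show ?thesis by (simp add: \<eta>_def)
qed

text \<open>A translation in t is a dilation of the Euclidean space: d = -ln c.\<close>

lemma w_spherical_iff:
  "(\<exists>d. \<forall>t. w t = - ln (cosh (t + d))) \<longleftrightarrow> (\<exists>c>0. \<forall>x. u x = ln (2 * c / (c\<^sup>2 + (norm x)\<^sup>2)))"
proof
  have cosh_eq: "- ln (cosh (t - ln c)) = ln (2 * c / (c\<^sup>2 + (exp t)\<^sup>2)) + t" if "c > 0" for c t :: real
  proof -
    have "cosh (t - ln c) = (c\<^sup>2 + (exp t)\<^sup>2) / (2 * c * exp t)"
      using that by (simp add: cosh_def exp_diff exp_minus field_simps power2_eq_square)
    moreover have pos: "c\<^sup>2 + (exp t)\<^sup>2 > 0" using that by (intro add_pos_pos) auto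
    ultimately have "- ln (cosh (t - ln c)) = - (ln (c\<^sup>2 + (exp t)\<^sup>2) - (ln (2 * c) + t))"
      using that by (simp add: ln_div ln_mult)
    also have "\<dots> = ln (2 * c / (c\<^sup>2 + (exp t)\<^sup>2)) + t"
      using that pos by (simp add: ln_div)
    finally show ?thesis .
  qed
  {
    assume "\<exists>d. \<forall>t. w t = - ln (cosh (t + d))"
    then obtain d where d: "\<And>t. w t = - ln (cosh (t + d))" by blast
    define c where "c = exp (- d)"
    let ?v = "\<lambda>x::'a. ln (2 * c / (c\<^sup>2 + (norm x)\<^sup>2))"
    have c: "c > 0" "d = - ln c" by (simp_all add: c_def)
    have nz: "u x = ?v x" if "x \<noteq> 0" for x
    proof -
      have "w (ln (norm x)) = ?v x + ln (norm x)"
        using cosh_eq[OF c(1), of "ln (norm x)"] d[of "ln (norm x)"] that c(2) by simp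
      with u_eq_w[OF that] show ?thesis by simp
    qed
    have pos: "c\<^sup>2 + (norm x)\<^sup>2 > 0" for x :: 'a using c(1) by (intro add_pos_nonneg) auto
    \<comment> \<open>Logarithmic coordinates miss the origin; the value of u there follows by
      continuity.\<close>
    have "isCont ?v 0"
      using c(1) pos[of 0] by (intro continuous_intros) auto
    then have "(?v \<longlongrightarrow> ?v 0) (at 0)" by (simp add: isCont_def)
    moreover have "(u \<longlongrightarrow> u 0) (at 0)"
      using C_infinity_continuous[OF smooth] by (simp add: continuous_on_eq_continuous_at isCont_def)
    then have "(?v \<longlongrightarrow> u 0) (at 0)"
      by (rule Lim_transform_eventually) (auto simp: eventually_at_filter nz)
    ultimately have "u 0 = ?v 0" by (intro tendsto_unique[of "at (0::'a)"]) auto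
    with nz have "u x = ?v x" for x by (cases "x = 0") auto
    with c(1) show "\<exists>c>0. \<forall>x. u x = ln (2 * c / (c\<^sup>2 + (norm x)\<^sup>2))" by blast
  next
    assume "\<exists>c>0. \<forall>x. u x = ln (2 * c / (c\<^sup>2 + (norm x)\<^sup>2))"
    then obtain c where c: "c > 0" "\<And>x. u x = ln (2 * c / (c\<^sup>2 + (norm x)\<^sup>2))" by blast
    have "w t = - ln (cosh (t + - ln c))" for t
      using cosh_eq[OF c(1), of t] by (simp add: w_def \<phi>_def log_profile_def c(2))
    then show "\<exists>d. \<forall>t. w t = - ln (cosh (t + d))" by blast
  }
qed

text \<open>\<open>M0\<close> is both the positive root of M = (n - 1)! g M^2 / 2 and the mass of
  sech^n. Equality thus provides two solutions of equal mass, w and -ln cosh, to which uniqueness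
  applies.\<close>

lemma volume_comparison:
  assumes dim: "DIM('a) = 2 * K + 2" and K: "K > 0"
    and R: "\<And>t. t \<ge> T0 \<Longrightarrow> scalar_curvature u (exp t *\<^sub>R axis0) \<ge> 0"
    and Q: "\<And>x. Q_curvature u x \<le> fact (2 * K + 1)"
  defines "V \<equiv> \<integral>\<^sup>+t. ennreal (exp (real DIM('a) * w t)) \<partial>lborel"
    and "M0 \<equiv> 2 / (fact (2 * K + 1) * sphere_const K)"
  shows "ennreal M0 \<le> V" and "V = ennreal M0 \<longleftrightarrow> (\<exists>d. \<forall>t. w t = - ln (cosh (t + d)))"
proof -
  interpret balanced_kernel "real_kernel K" "sphere_const K" by (rule balanced_real_kernel[OF K])
  let ?n = "real DIM('a)" and ?c = "fact (2 * K + 1) :: real"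
  let ?\<rho> = "\<lambda>t. exp (?n * w t)" and ?\<sigma> = "sech_pow (2 * K + 2)"
  have n: "?n > 0" by simp
  have cg: "?c * sphere_const K > 0" using sphere_const_pos by simp
  have w'_cont: "continuous_on UNIV (\<lambda>t. \<phi>' 0 t + 1)" by (intro continuous_intros continuous_\<phi>')
  have \<sigma>: "integrable lborel ?\<sigma>" by (rule integrable_sech_pow) simp
  have \<sigma>_nn: "?\<sigma> t \<ge> 0" for t by (rule less_imp_le[OF sech_pow_pos])
  have \<sigma>_M0: "(\<integral>t. ?\<sigma> t \<partial>lborel) = M0" unfolding M0_def by (rule integral_sech_pow[OF K])
  have \<sigma>_exp: "?\<sigma> t = exp (?n * - ln (cosh t))" for t using sech_pow_eq_exp dim by simp
  have meas_w [measurable]: "w \<in> borel_measurable borel"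
    by (rule borel_measurable_continuous_onI)
      (rule DERIV_continuous_on[OF has_field_derivative_at_within[OF has_real_derivative_w]])
  have main: "ennreal M0 \<le> V \<and> (V = ennreal M0 \<longrightarrow> (\<exists>d. \<forall>t. w t = - ln (cosh (t + d))))"
  \<comment> \<open>An infinite volume exceeds \<open>ennreal M0\<close> and differs from it, so
    only finite mass needs an argument.\<close>
  proof (cases "V = \<infinity>")
    case False
    then have \<rho>: "integrable lborel ?\<rho>"
      unfolding V_def by (intro integrableI_nonneg) (auto simp: top.not_eq_extremum)
    have \<rho>_nn: "?\<rho> t \<ge> 0" for t by simp
    define M where "M = (\<integral>t. ?\<rho> t \<partial>lborel)"
    have V: "V = ennreal M" unfolding V_def M_def using \<rho> by (intro nn_integral_eq_integral) auto
    have le: "1 - (\<phi>' 0 t + 1) \<le> ?c * potential ?\<rho> t" for t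
    proof -
      have "ennreal (- \<phi>' 0 t) \<le> ennreal (?c * potential ?\<rho> t)"
        using minus_\<phi>'_le_conv[OF dim K _ R Q, of T0 t]
          conv_sphere_kernel_eq_potential[OF K \<rho> \<rho>_nn, of ?c t] by simp
      moreover have "0 \<le> ?c * potential ?\<rho> t" using potential_bounds(1)[OF \<rho> \<rho>_nn] by simp
      ultimately show ?thesis by (simp add: ennreal_le_iff)
    qed
    note mb = mass_bound[OF \<rho> \<rho>_nn has_real_derivative_w w'_cont n refl _ le exp_w_at_bot[OF n], folded M_def]
    have M: "M \<le> ?c * sphere_const K * M\<^sup>2 / 2" by (rule mb) simp
    have "M \<noteq> 0"
    proof
      assume "M = 0"
      then have "AE t in lborel. ?\<rho> t = 0"
        using integral_nonneg_eq_0_iff_AE[OF \<rho>] by (simp add: M_def)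
      then have "AE t in (lborel :: real measure). False" by simp
      then show False by (simp add: trivial_limit_def[symmetric] ae_filter_eq_bot_iff)
    qed
    moreover have "M \<ge> 0" unfolding M_def by (intro integral_nonneg_AE) auto
    ultimately have M_pos: "M > 0" by simp
    have "M * 1 \<le> M * (?c * sphere_const K * M / 2)" using M by (simp add: power2_eq_square mult_ac)
    then have "1 \<le> ?c * sphere_const K * M / 2" using M_pos by (simp only: mult_le_cancel_left_pos)
    then have M0_le: "M0 \<le> M" unfolding M0_def using cg by (simp add: field_simps)
    moreover have "\<exists>d. \<forall>t. w t = - ln (cosh (t + d))" if eq: "V = ennreal M0"
    proof -
      have "M = M0" using eq M_pos M0_le cg unfolding V by (simp add: M0_def)
      then have "M = ?c * sphere_const K * M\<^sup>2 / 2"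
        unfolding M0_def using cg by (simp add: power2_eq_square)
      then have ae: "AE t in lborel. \<phi>' 0 t + 1 = 1 - ?c * potential ?\<rho> t" by (intro mb) simp_all
      have dln: "((\<lambda>t. - ln (cosh t)) has_real_derivative - tanh t) (at t)" for t :: real
        using cosh_real_pos[of t] by (auto intro!: derivative_eq_intros simp: tanh_def)
      obtain d where "\<And>t. w t = - ln (cosh (t + d))"
      proof (rule unique_up_to_translation[where ?w1.0 = w and ?w2.0 = "\<lambda>t. - ln (cosh t)" and
            ?\<rho>1.0 = ?\<rho> and ?\<rho>2.0 = ?\<sigma> and n = ?n and c = ?c, OF has_real_derivative_w w'_cont dln])
        show "continuous_on UNIV (\<lambda>t::real. - tanh t)"
          by (intro continuous_intros) (use cosh_real_pos in \<open>simp add: less_imp_neq[symmetric]\<close>)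
        show "- tanh t = 1 - ?c * potential ?\<sigma> t" for t
          using potential_sech_pow[OF K, of t] by simp
        show "(\<integral>t. ?\<rho> t \<partial>lborel) = (\<integral>t. ?\<sigma> t \<partial>lborel)"
          using \<open>M = M0\<close> \<sigma>_M0 by (simp add: M_def)
        show "(?\<rho> \<longlongrightarrow> 0) at_bot" by (rule exp_w_at_bot[OF n])
        have b: "norm (?\<sigma> t) \<le> 2 * exp (- t)" "norm (?\<sigma> t) \<le> 2 * exp t" for t
          using sech_pow_le[of "2 * K + 2" t] \<sigma>_nn[of t] by simp_all
        have "((\<lambda>t::real. 2 * exp t) \<longlongrightarrow> 0) at_bot" by real_asymp
        then show "(?\<sigma> \<longlongrightarrow> 0) at_bot"
          by (rule Lim_null_comparison[OF always_eventually[OF allI[OF b(2)]]])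
        have "((\<lambda>t::real. 2 * exp (- t)) \<longlongrightarrow> 0) at_top" by real_asymp
        then show "(?\<sigma> \<longlongrightarrow> 0) at_top"
          by (rule Lim_null_comparison[OF always_eventually[OF allI[OF b(1)]]])
      qed (use \<rho> \<sigma> \<sigma>_exp ae in simp_all)
      then show ?thesis by blast
    qed
    ultimately show ?thesis unfolding V using M_pos by (auto intro: ennreal_leI)
  qed simp
  then show "ennreal M0 \<le> V" by simp
  show "V = ennreal M0 \<longleftrightarrow> (\<exists>d. \<forall>t. w t = - ln (cosh (t + d)))"
  proof
    assume "\<exists>d. \<forall>t. w t = - ln (cosh (t + d))"
    then obtain d where d: "\<And>t. w t = - ln (cosh (t + d))" by blast
    have "V = (\<integral>\<^sup>+t. ennreal (?\<sigma> (t + d)) \<partial>lborel)"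
      unfolding V_def by (simp only: \<sigma>_exp d)
    also have "\<dots> = (\<integral>\<^sup>+t. ennreal (?\<sigma> t) \<partial>lborel)"
      using nn_integral_real_affine[of "\<lambda>t. ennreal (?\<sigma> t)" 1 d] by (simp add: add.commute)
    also have "\<dots> = ennreal M0"
      unfolding \<sigma>_M0[symmetric] using \<sigma> \<sigma>_nn by (intro nn_integral_eq_integral) auto
    finally show "V = ennreal M0" .
  qed (use main in blast)
qed

end

theorem theorem1p3:
  fixes u :: "real ^ 'n \<Rightarrow> real" and n :: nat
  assumes "n = CARD('n)" and "n \<ge> 4" and "even n"
    and "C_infinity u" and "radially_symmetric u"
    and "integrable lborel (\<lambda>x. Q_curvature u x * exp (real n * u x))"
    and "\<forall>x. Q_curvature u x \<le> fact (n - 1)"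
    and "\<exists>K. compact K \<and> (\<forall>x. x \<notin> K \<longrightarrow> scalar_curvature u x \<ge> 0)"
  shows "((\<integral>\<^sup>+x. ennreal (exp (real n * u x)) \<partial>lborel)
           \<ge> ennreal (hypersurface_volume (sphere (0 :: (real ^ 'n) \<times> real) 1)))
    \<and> ((\<integral>\<^sup>+x. ennreal (exp (real n * u x)) \<partial>lborel)
           = ennreal (hypersurface_volume (sphere (0 :: (real ^ 'n) \<times> real) 1))
         \<longleftrightarrow> (\<exists>c>0. \<forall>x. u x = ln (2 * c / (c\<^sup>2 + (norm x)\<^sup>2))))"
proof -
  interpret radial_smooth u using assms by unfold_locales
  define K where "K = n div 2 - 1"
  have n: "n = 2 * K + 2" and K: "K > 0" using assms(2,3) unfolding K_def by presburger+
  have dim: "DIM(real ^ 'n) = 2 * K + 2" and dim_n: "DIM(real ^ 'n) = n" using n assms(1) by simp_all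
  obtain C r where C: "compact C" "\<And>x. x \<notin> C \<Longrightarrow> scalar_curvature u x \<ge> 0" "\<And>x. x \<in> C \<Longrightarrow> norm x \<le> r"
    using assms(8) compact_imp_bounded bounded_iff by metis
  \<comment> \<open>For t \<ge> |r| one has e^t > t \<ge> r, so the point of norm e^t lies outside
    the compact set.\<close>
  have R: "scalar_curvature u (exp t *\<^sub>R axis0) \<ge> 0" if "t \<ge> \<bar>r\<bar>" for t
  proof (rule C(2), rule notI)
    assume "exp t *\<^sub>R axis0 \<in> C"
    from C(3)[OF this] have "exp t \<le> r" by simp
    moreover have "t < exp t" by (rule less_le_trans[OF _ exp_ge_add_one_self]) simp
    ultimately show False using that by linarith
  qed
  have Q: "Q_curvature u x \<le> fact (2 * K + 1)" for x using assms(7) n by simp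
  let ?V = "\<integral>\<^sup>+t. ennreal (exp (real DIM(real ^ 'n) * w t)) \<partial>lborel"
    and ?M = "2 / (fact (2 * K + 1) * sphere_const K) :: real"
    and ?S = "real DIM(real ^ 'n) * unit_ball_vol (real DIM(real ^ 'n))"
  have S: "?S > 0" using assms(2) dim_n by (intro mult_pos_pos) auto
  have vol: "(\<integral>\<^sup>+x. ennreal (exp (real n * u x)) \<partial>lborel) = ennreal ?S * ?V"
    using volume_eq unfolding dim_n .
  have "DIM((real ^ 'n) \<times> real) = 2 * K + 3" using dim by simp
  from hypersurface_volume_sphere_even[OF dim this]
  have sph: "ennreal (hypersurface_volume (sphere (0 :: (real ^ 'n) \<times> real) 1)) = ennreal ?S * ennreal ?M"
    using S sphere_const_pos[of K] by (simp only: ennreal_mult' less_imp_le)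
  have "ennreal ?S \<noteq> 0" using S by (simp only: ennreal_eq_0_iff not_le)
  \<comment> \<open>The common factor \<open>?S\<close>, the volume of the (n - 1)-sphere, is
    positive and finite, which reduces everything to the masses on the line.\<close>
  then have cancel: "ennreal ?S * x = ennreal ?S * y \<longleftrightarrow> x = y" for x y
    by (simp only: ennreal_mult_cancel_left ennreal_neq_top) blast
  note vc = volume_comparison[OF dim K R Q]
  show ?thesis
    unfolding vol sph cancel w_spherical_iff[symmetric]
    using vc by (auto intro: mult_left_mono)
qed

end
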